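(* Let $\zeta,\theta>0$ and $\eta\in(1,2)$. For every $\varepsilon>0$ and for Lebesgue-almost every $\underline{x}\in\mathbb{R}^2$ there is a constant $C>0$ (depending only on $\underline{x},\zeta,\theta,\varepsilon$ and the fixed $\eta$) such that the following holds for all real $T>1$ and all $a,b,c>0$ with $$a<b<1,\qquad c<\tfrac12,\qquad a\ge(\ln T)^{-\theta},\qquad \zeta\, b\le c^2 .$$ Let $\Omega=\Omega_{[1,T)}^{(a,b],c}$. (i) If $(c\ln T)^{-\eta}\le b\le(c\ln T)^{-\eta/(3-\eta)}$, then $$\Big||Q_\Omega(\underline{x})|-\mathrm{Vol}_3(\Omega)\Big|\le C\left(c^{-1}b^{1-1/\eta}\,(\ln\ln T)^{6+\varepsilon}\,\ln T+1\right).$$ (ii) If $b\ge(c\ln T)^{-\eta/(3-\eta)}$, then $$\Big||Q_\Omega(\underline{x})|-\mathrm{Vol}_3(\Omega)\Big|\le C\left(b^{2/\eta}\,(\ln\ln T)^{6+\varepsilon}\,(\ln T)^2+1\right).$$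
   Context: For $z\in\mathbb{R}$, $\|z\|$ denotes the distance from $z$ to the closest integer; $\mathrm{Vol}_3$ is Lebesgue measure on $\mathbb{R}^3$; $|\cdot|$ of a finite set is its cardinality; $\mathbb{N}=\{1,2,\dots\}$. Define $$\Omega_{[1,T)}^{(a,b],c}:=\{(\underline{u},y)\in\mathbb{R}^2\times[1,T):\ \max(|u_1|,|u_2|)\le c,\ a<|u_1u_2|\cdot y\le b\},$$ and for $\underline{x}=(x_1,x_2)\in\mathbb{R}^2$ and $\Omega=\Omega_{[1,T)}^{(a,b],c}$, $$Q_\Omega(\underline{x}):=\{q\in[1,T)\cap\mathbb{N}:\ \max(\|qx_1\|,\|qx_2\|)\le c,\ a<q\cdot\|qx_1\|\cdot\|qx_2\|\le b\}.$$ (Since $a<1$, the hypothesis $a\ge(\ln T)^{-\theta}$ can only hold when $T>e$, so $\ln\ln T>0$.) *)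

theory Defs
  imports "HOL-Analysis.Analysis"
begin

definition dist_int :: "real \<Rightarrow> real"
  where "dist_int z = infdist z \<int>"

definition Omega_set :: "real \<Rightarrow> real \<Rightarrow> real \<Rightarrow> real \<Rightarrow> ((real \<times> real) \<times> real) set"
  where "Omega_set T a b c =
    {((u1, u2), y). 1 \<le> y \<and> y < T \<and> max \<bar>u1\<bar> \<bar>u2\<bar> \<le> c \<and>
                    a < \<bar>u1 * u2\<bar> * y \<and> \<bar>u1 * u2\<bar> * y \<le> b}"

(* The informal notation indexes Q by the set Omega; the parameters defining Omega are passed
   here instead, since they need not be recoverable from the bare set. *)
definition Q_set :: "real \<Rightarrow> real \<Rightarrow> real \<Rightarrow> real \<Rightarrow> real \<times> real \<Rightarrow> nat set"
  where "Q_set T a b c x =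
    {q. 1 \<le> q \<and> real q < T \<and>
        max (dist_int (real q * fst x)) (dist_int (real q * snd x)) \<le> c \<and>
        a < real q * dist_int (real q * fst x) * dist_int (real q * snd x) \<and>
        real q * dist_int (real q * fst x) * dist_int (real q * snd x) \<le> b}"

end

(*
Write F_q for the indicator, in terms of the distances of q x_1 and q x_2 to the integers, of the
hyperbolic cross {|u_1|, |u_2| <= c, |u_1 u_2| <= b / q}.  Counting points of an arithmetic
progression mod 1 in an interval shows that the joint law of (||qx||, ||rx||) on symmetric
rectangles is at most the product law plus gcd(q, r) times the law of (qw, rw), w in R.  Applying
this in both coordinates, the correlation of F_q and F_r (q <= r) exceeds the product of the areas
by O(b (gcd sqrt(r / q) / r^2 + gcd^2 log / r^3)).  Hence the number of hits with q in [2^m1, 2^m2)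
has variance O(b (m2 - m1) L), where L >= m2, with no further logarithm.

For 2^m <= T < 2^(m+1) and m < L = 2^J, dyadic chaining in m (Rademacher-Menshov) costs only powers
of J, which is of order ln ln T.  The parameter b is restricted to multiples of h = b^(2/3) L^(-2/3),
for which the discretisation error h L^2 equals the deviation allowed by a union bound over the
roughly b / h grid values; c only matters up to factors of 2.  For almost every x this bounds the
discrepancy by O(b^(2/3) (ln T)^(4/3) (ln ln T)^3).  Both ranges of the theorem force c ln T >= 1 and
b >= (ln T)^(-2), and there b^(2/3) (ln T)^(4/3) is dominated by the respective right-hand sides,
which agree with it at b = (c ln T)^(-eta/(3-eta)), c = 1.
*)
theory Submission imports Defs begin

section \<open>Pairs of one-dimensional distances\<close>

text \<open>Since both claimed bounds reduce to b^(2/3) (ln T)^(4/3), up to powers of ln ln T, where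
  the two ranges meet at c of order 1, no power of ln T can be given away. Two logarithms threaten
  this. In the mixed correlation term (coincidence in one coordinate, independence in the other) the
  natural factor is ln(r/q), which is bounded on average over q \<le> r; it is relaxed to sqrt(r/q),
  which has the same property and sums easily. The term with coincidence in both coordinates keeps a
  genuine logarithm, but there gcd^2 / r^3 sums to O(1) over a dyadic block, whereas the gcd sum of
  the mixed term gives m. Both contributions are O(L) per block. Rounding b is expensive and
  rounding c is cheap for a geometric reason: raising b by h enlarges a cross by an area that
  carries a logarithm, of total size h L^2, while doubling c only adds pieces of the arms, of area
  O(b / q) without logarithm and of total size b L \<le> h L^2. Hence a fine grid for b and powers
  of 2 for c.\<close>

lemma dist_int_le_iff: "dist_int z \<le> \<alpha> \<longleftrightarrow> (\<exists>n::int. \<bar>z - of_int n\<bar> \<le> \<alpha>)"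
proof
  assume a: "dist_int z \<le> \<alpha>"
  obtain w where "w \<in> \<int>" "infdist z \<int> = dist z w"
    using infdist_attains_inf[of \<int> z] closed_Ints Ints_0 by (metis empty_iff)
  then show "\<exists>n::int. \<bar>z - of_int n\<bar> \<le> \<alpha>"
    using a by (auto simp: dist_int_def dist_real_def elim!: Ints_cases)
next
  assume "\<exists>n::int. \<bar>z - of_int n\<bar> \<le> \<alpha>"
  then obtain n :: int where "\<bar>z - of_int n\<bar> \<le> \<alpha>" by blast
  moreover have "dist_int z \<le> dist z (of_int n)"
    unfolding dist_int_def by (rule infdist_le) auto
  ultimately show "dist_int z \<le> \<alpha>" by (simp add: dist_real_def)
qed

lemma dist_int_nonneg: "0 \<le> dist_int z"
  by (simp add: dist_int_def infdist_nonneg)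

lemma dist_int_add_int: "dist_int (z + of_int n) = dist_int z"
proof -
  have *: "dist_int (z + of_int n) \<le> dist_int z" for z n
  proof -
    obtain m :: int where "\<bar>z - of_int m\<bar> \<le> dist_int z"
      using dist_int_le_iff by blast
    then show ?thesis
      unfolding dist_int_le_iff by (intro exI[of _ "m + n"]) simp
  qed
  show ?thesis
    using *[of z n] *[of "z + of_int n" "- n"] by simp
qed

lemma borel_measurable_dist_int [measurable]: "dist_int \<in> borel_measurable borel"
  unfolding dist_int_def [abs_def]
  by (intro borel_measurable_continuous_onI continuous_on_infdist continuous_on_id)

text \<open>With g = gcd q r, the residues q k mod r are multiples of g, each taken by at most g
  values k < r, and an interval of length 2 \<rho> meets a translate of gZ in at most 2 \<rho> / g +
  1 points. The summand g is the source of every gcd below.\<close>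

lemma card_residues_near:
  fixes q r :: nat and y \<rho> :: real
  assumes r: "r > 0" and \<rho>: "\<rho> \<ge> 0"
  shows "real (card {k. k < r \<and> (\<exists>n::int. \<bar>y + real q * real k - of_int n * real r\<bar> \<le> \<rho>)})
         \<le> 2 * \<rho> + real (gcd q r)"
proof -
  define g where "g = gcd q r"
  have g: "g > 0" using r by (simp add: g_def)
  define r' where "r' = r div g"
  define q' where "q' = q div g"
  have rg: "r = g * r'" and qg: "q = g * q'" by (simp_all add: r'_def q'_def g_def)
  have r': "r' > 0" using rg r by (cases r') auto
  have cop: "coprime q' r'"
    using r unfolding q'_def r'_def g_def by (intro div_gcd_coprime) auto
  define V where "V = {v::int. \<bar>y + real g * of_int v\<bar> \<le> \<rho>}"
  define lo where "lo = (- \<rho> - y) / g"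
  define hi where "hi = (\<rho> - y) / g"
  have V: "V = {\<lceil>lo\<rceil>..\<lfloor>hi\<rfloor>}"
  proof -
    have "v \<in> V \<longleftrightarrow> lo \<le> of_int v \<and> of_int v \<le> hi" for v
      using g unfolding V_def lo_def hi_def by (auto simp: field_simps abs_le_iff)
    then show ?thesis by (intro set_eqI) (simp only: atLeastAtMost_iff ceiling_le_iff le_floor_iff)
  qed
  have finV: "finite V" by (simp add: V)
  have "lo \<le> hi" using g \<rho> by (simp add: lo_def hi_def divide_right_mono)
  then have cardV: "real (card V) \<le> hi - lo + 1"
    unfolding V using of_int_floor_le[of hi] le_of_int_ceiling[of lo]
    by (cases "\<lfloor>hi\<rfloor> - \<lceil>lo\<rceil> + 1 \<ge> 0") (auto simp: of_nat_nat, linarith)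
  define S where "S v = {k. k < r \<and> (\<exists>n::int. int q * int k - n * int r = int g * v)}" for v
  have cardS: "card (S v) \<le> g" for v
  proof (cases "S v = {}")
    case False
    then obtain k0 where k0: "k0 \<in> S v" by blast
    \<comment> \<open>\<open>S v\<close> collects the k with q k congruent to g v mod r. Any two of
      them agree mod \<open>r'\<close>, because \<open>q'\<close> is a unit there, which leaves g
      candidates below r = g \<open>r'\<close>.\<close>
    have "S v \<subseteq> (\<lambda>i. k0 mod r' + i * r') ` {..<g}"
    proof
      fix k assume k: "k \<in> S v"
      obtain n n0 where n: "int q * int k - n * int r = int g * v"
        and n0: "int q * int k0 - n0 * int r = int g * v"
        using k k0 by (auto simp: S_def)
      have "int q * (int k - int k0) = (n - n0) * int r"
        using n n0 by (simp add: algebra_simps)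
      then have "int g * (int q' * (int k - int k0)) = int g * ((n - n0) * int r')"
        by (simp add: rg qg algebra_simps)
      then have "int q' * (int k - int k0) = (n - n0) * int r'" using g by simp
      then have "int r' dvd int q' * (int k - int k0)" by simp
      moreover have "coprime (int r') (int q')" using cop by (simp add: coprime_commute)
      ultimately have "int r' dvd int k - int k0" by (simp add: coprime_dvd_mult_right_iff)
      then have "int k mod int r' = int k0 mod int r'" by (simp add: mod_eq_dvd_iff)
      then have "k mod r' = k0 mod r'" by (metis of_nat_eq_iff of_nat_mod)
      moreover have "k div r' < g"
        using k rg by (simp add: S_def less_mult_imp_div_less)
      moreover have "k = k mod r' + (k div r') * r'" by simp
      ultimately show "k \<in> (\<lambda>i. k0 mod r' + i * r') ` {..<g}"
        by (metis imageI lessThan_iff)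
    qed
    then have "card (S v) \<le> card ((\<lambda>i. k0 mod r' + i * r') ` {..<g})"
      by (intro card_mono) auto
    also have "\<dots> \<le> g" using card_image_le[of "{..<g}"] by simp
    finally show ?thesis .
  qed simp
  have "{k. k < r \<and> (\<exists>n::int. \<bar>y + real q * real k - of_int n * real r\<bar> \<le> \<rho>)} \<subseteq> (\<Union>v\<in>V. S v)"
  proof clarify
    fix k n assume k: "k < r" and n: "\<bar>y + real q * real k - of_int n * real r\<bar> \<le> \<rho>"
    define v where "v = int q' * int k - n * int r'"
    have v: "int q * int k - n * int r = int g * v"
      by (simp add: v_def rg qg algebra_simps)
    then have "real_of_int (int q * int k - n * int r) = real_of_int (int g * v)" by simp
    then have "v \<in> V" using n by (simp add: V_def algebra_simps)
    moreover have "k \<in> S v" using v k by (auto simp: S_def)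
    ultimately show "k \<in> (\<Union>v\<in>V. S v)" by blast
  qed
  then have "card {k. k < r \<and> (\<exists>n::int. \<bar>y + real q * real k - of_int n * real r\<bar> \<le> \<rho>)}
     \<le> card (\<Union>v\<in>V. S v)"
    using finV by (intro card_mono) (auto simp: S_def)
  also have "\<dots> \<le> (\<Sum>v\<in>V. card (S v))" by (rule card_UN_le[OF finV])
  also have "\<dots> \<le> card V * g" using sum_bounded_above[of V "\<lambda>v. card (S v)" g] cardS by simp
  finally have "real (card {k. k < r \<and> (\<exists>n::int. \<bar>y + real q * real k - of_int n * real r\<bar> \<le> \<rho>)})
     \<le> real (card V) * real g" unfolding of_nat_mult[symmetric] of_nat_le_iff .
  also have "\<dots> \<le> (hi - lo + 1) * real g" using cardV by (intro mult_right_mono) auto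
  also have "\<dots> = 2 * \<rho> + real g" using g by (simp add: hi_def lo_def field_simps)
  finally show ?thesis by (simp add: g_def)
qed

text \<open>Folds the unit interval onto [0, 1/r), a fundamental domain for the translations by 1/r
  under which the distance of r x to the integers is periodic.\<close>

lemma nn_integral_unit_interval_split:
  fixes f :: "real \<Rightarrow> ennreal" and r :: nat
  assumes [measurable]: "f \<in> borel_measurable borel" and r: "r > 0"
  shows "(\<integral>\<^sup>+x. f x * indicator {0..<1} x \<partial>lborel) =
         (\<integral>\<^sup>+x. (\<Sum>k<r. f (x + real k / real r)) * indicator {0..<1 / real r} x \<partial>lborel)"
proof -
  define I where "I k = {real k / real r..<(real k + 1) / real r}" for k
  have ind: "indicator {0..<1} x = (\<Sum>k<r. indicator (I k) x :: ennreal)" for x :: real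
  proof -
    have *: "x \<in> I k \<longleftrightarrow> real k \<le> r * x \<and> r * x < real k + 1" for k
      using r by (auto simp: I_def field_simps)
    show ?thesis
    proof (cases "0 \<le> x \<and> x < 1")
      case True
      define k0 where "k0 = nat \<lfloor>real r * x\<rfloor>"
      have k0: "real k0 \<le> r * x" "r * x < real k0 + 1"
        using True by (auto simp: k0_def of_nat_nat)
      have "real r * x < real r" using True r by simp
      then have "k0 < r" using k0 by linarith
      moreover have "x \<in> I k \<longleftrightarrow> k = k0" for k
        unfolding * using k0 by auto
      ultimately have "(\<Sum>k<r. indicator (I k) x :: ennreal) = (\<Sum>k<r. if k = k0 then 1 else 0)"
        by (intro sum.cong) (auto simp: indicator_def)
      also have "\<dots> = 1" using \<open>k0 < r\<close> by simp
      finally show ?thesis using True by simp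
    next
      case False
      have "x \<notin> I k" if "k < r" for k
      proof
        assume "x \<in> I k"
        then have "0 \<le> x" "x < (real k + 1) / real r" by (auto simp: I_def intro: order_trans[rotated])
        moreover have "(real k + 1) / real r \<le> 1" using that r by simp
        ultimately show False using False by linarith
      qed
      then show ?thesis using False by (auto simp: indicator_def)
    qed
  qed
  have "(\<integral>\<^sup>+x. f x * indicator {0..<1} x \<partial>lborel) = (\<integral>\<^sup>+x. (\<Sum>k<r. f x * indicator (I k) x) \<partial>lborel)"
    by (simp add: ind sum_distrib_left)
  also have "\<dots> = (\<Sum>k<r. \<integral>\<^sup>+x. f x * indicator (I k) x \<partial>lborel)"
    by (intro nn_integral_sum) (auto simp: I_def)
  also have "\<dots> = (\<Sum>k<r. \<integral>\<^sup>+x. f (x + real k / real r) * indicator {0..<1 / real r} x \<partial>lborel)"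
  proof (rule sum.cong[OF refl])
    fix k
    have "(\<integral>\<^sup>+x. f x * indicator (I k) x \<partial>lborel) =
          (\<integral>\<^sup>+x. f (real k / real r + 1 * x) * indicator (I k) (real k / real r + 1 * x) \<partial>lborel)"
      by (subst nn_integral_real_affine[where c=1 and t="real k / real r"]) (auto simp: I_def)
    also have "\<dots> = (\<integral>\<^sup>+x. f (x + real k / real r) * indicator {0..<1 / real r} x \<partial>lborel)"
      using r by (intro nn_integral_cong) (auto simp: I_def indicator_def add.commute field_simps zero_le_mult_iff)
    finally show "(\<integral>\<^sup>+x. f x * indicator (I k) x \<partial>lborel) =
      (\<integral>\<^sup>+x. f (x + real k / real r) * indicator {0..<1 / real r} x \<partial>lborel)" .
  qed
  also have "\<dots> = (\<integral>\<^sup>+x. (\<Sum>k<r. f (x + real k / real r)) * indicator {0..<1 / real r} x \<partial>lborel)"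
    by (subst nn_integral_sum[symmetric]) (auto simp: sum_distrib_right)
  finally show ?thesis .
qed

lemma emeasure_dist_int_le:
  fixes r :: nat
  assumes r: "r > 0" and \<beta>: "0 \<le> \<beta>" "\<beta> \<le> 1 / 2"
  shows "emeasure lborel {x \<in> {0..<1 / real r}. dist_int (real r * x) \<le> \<beta>} = ennreal (2 * \<beta> / r)"
proof -
  let ?A = "{0..\<beta> / r}" and ?B = "{(1 - \<beta>) / r..<1 / r}"
  have eq: "{x \<in> {0..<1 / real r}. dist_int (real r * x) \<le> \<beta>} = {x\<in>?A. x < 1 / r} \<union> ?B" (is "?L = ?R")
  proof (rule set_eqI)
    fix x
    show "x \<in> ?L \<longleftrightarrow> x \<in> ?R"
    proof
      assume x: "x \<in> ?L"
      then obtain n :: int where n: "\<bar>real r * x - of_int n\<bar> \<le> \<beta>" by (auto simp: dist_int_le_iff)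
      have x2: "0 \<le> real r * x" "real r * x < 1" using x r by (auto simp: field_simps)
      then have "of_int n < (2::real)" "of_int n > (-1::real)" using n \<beta> by linarith+
      then have "n = 0 \<or> n = 1" by linarith
      then have "real r * x \<le> \<beta> \<or> 1 - \<beta> \<le> real r * x" using n by auto
      then show "x \<in> ?R" using x r by (auto simp: field_simps)
    next
      assume x: "x \<in> ?R"
      have "0 \<le> (1 - \<beta>) / r" using \<beta> by simp
      then have "0 \<le> x" using x by auto
      moreover have "\<bar>real r * x - of_int 0\<bar> \<le> \<beta> \<or> \<bar>real r * x - of_int 1\<bar> \<le> \<beta>"
        using x r calculation by (auto simp: field_simps)
      then have "\<exists>n::int. \<bar>real r * x - of_int n\<bar> \<le> \<beta>" by blast
      ultimately show "x \<in> ?L" using x unfolding dist_int_le_iff by auto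
    qed
  qed
  have br: "\<beta> / r < 1 / r" using \<beta> r by (simp add: divide_strict_right_mono)
  then have A: "{x\<in>?A. x < 1 / r} = ?A" by auto
  show ?thesis
  proof (cases "\<beta> < 1 / 2")
    case True
    then have "\<beta> / r < (1 - \<beta>) / r" using r by (simp add: divide_strict_right_mono)
    then have "?A \<inter> ?B = {}" by auto
    then have "emeasure lborel (?A \<union> ?B) = emeasure lborel ?A + emeasure lborel ?B"
      by (intro plus_emeasure[symmetric]) auto
    also have "\<dots> = ennreal (\<beta> / r) + ennreal (1 / r - (1 - \<beta>) / r)"
      using \<beta> r by (simp add: divide_right_mono)
    also have "\<dots> = ennreal (2 * \<beta> / r)"
      using \<beta> r by (subst ennreal_plus[symmetric]) (auto simp: field_simps intro!: arg_cong[of _ _ ennreal])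
    finally show ?thesis unfolding eq A .
  next
    \<comment> \<open>At \<beta> = 1/2 the two pieces share the midpoint, so the measure is read off
      from their union, the whole interval.\<close>
    case False
    then have b: "\<beta> = 1 / 2" using \<beta> by simp
    have pos: "0 \<le> (1 - \<beta>) / r" using \<beta> by simp
    have "\<beta> / r = (1 - \<beta>) / r" using b by simp
    then have "?A \<union> ?B = {0..<1 / r}"
      using br pos by (intro set_eqI) (metis (no_types, lifting) Un_iff atLeastAtMost_iff atLeastLessThan_iff linear order.trans order_le_less_trans)
    then show ?thesis unfolding eq A by (simp add: b)
  qed
qed

text \<open>
  The factor \<open>\<parallel>r x\<parallel>\<close> is invariant under \<open>x \<mapsto> x + k / r\<close>, so the other factor may be averaged over these
  translates.
\<close>
lemma nn_integral_dist_int_le_mult: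
  fixes q r :: nat
  assumes r: "r > 0" and \<beta>: "0 \<le> \<beta>" "\<beta> \<le> 1 / 2" and [measurable]: "f \<in> borel_measurable borel"
    and f: "\<And>x. (\<Sum>k<r. f (x + real k / real r)) \<le> ennreal a" and a: "0 \<le> a"
  shows "(\<integral>\<^sup>+x. f x * indicator {x. dist_int (real r * x) \<le> \<beta>} x * indicator {0..<1} x \<partial>lborel) \<le>
         ennreal (a * (2 * \<beta> / r))"
proof -
  have per: "dist_int (real r * (x + real k / real r)) = dist_int (real r * x)" for x k
    using dist_int_add_int[of "real r * x" "int k"] r by (simp add: algebra_simps)
  have "(\<integral>\<^sup>+x. f x * indicator {x. dist_int (real r * x) \<le> \<beta>} x * indicator {0..<1} x \<partial>lborel)
    = (\<integral>\<^sup>+x. (\<Sum>k<r. f (x + real k / real r) * indicator {x. dist_int (real r * x) \<le> \<beta>} (x + real k / real r))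
           * indicator {0..<1 / real r} x \<partial>lborel)"
    using r by (intro nn_integral_unit_interval_split) auto
  also have "\<dots> = (\<integral>\<^sup>+x. (\<Sum>k<r. f (x + real k / real r)) *
         indicator {x \<in> {0..<1 / real r}. dist_int (real r * x) \<le> \<beta>} x \<partial>lborel)"
    by (intro nn_integral_cong) (auto simp: indicator_def per)
  also have "\<dots> \<le> (\<integral>\<^sup>+x. ennreal a * indicator {x \<in> {0..<1 / real r}. dist_int (real r * x) \<le> \<beta>} x \<partial>lborel)"
    by (intro nn_integral_mono mult_right_mono f) auto
  also have "\<dots> = ennreal a * emeasure lborel {x \<in> {0..<1 / real r}. dist_int (real r * x) \<le> \<beta>}"
    by (intro nn_integral_cmult_indicator) auto
  also have "\<dots> = ennreal (a * (2 * \<beta> / r))"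
    using a \<beta> by (subst emeasure_dist_int_le[OF r \<beta>]) (simp add: ennreal_mult[symmetric])
  finally show ?thesis .
qed

lemma dist_int_pair_le1:
  fixes q r :: nat
  assumes r: "r > 0" and \<alpha>: "0 \<le> \<alpha>" and \<beta>: "0 \<le> \<beta>" "\<beta> \<le> 1 / 2"
  shows "(\<integral>\<^sup>+x. indicator {x. dist_int (real q * x) \<le> \<alpha>} x * indicator {x. dist_int (real r * x) \<le> \<beta>} x
           * indicator {0..<1} x \<partial>lborel) \<le> ennreal (4 * \<alpha> * \<beta> + 2 * gcd q r * (\<beta> / r))"
proof -
  have "(\<Sum>k<r. indicator {x. dist_int (real q * x) \<le> \<alpha>} (x + real k / real r)) \<le> ennreal (2 * \<alpha> * r + gcd q r)" for x
  proof -
    have iff: "dist_int (real q * (x + real k / real r)) \<le> \<alpha> \<longleftrightarrow>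
          (\<exists>n::int. \<bar>real r * (real q * x) + real q * real k - of_int n * real r\<bar> \<le> \<alpha> * r)" for k
    proof -
      have "\<bar>real q * (x + real k / real r) - of_int n\<bar> \<le> \<alpha> \<longleftrightarrow>
        \<bar>real r * (real q * x) + real q * real k - of_int n * real r\<bar> \<le> \<alpha> * r" for n :: int
      proof -
        have "real r * (real q * x) + real q * real k - of_int n * real r =
          (real q * (x + real k / real r) - of_int n) * r" using r by (simp add: field_simps)
        then show ?thesis using r by (simp add: abs_mult)
      qed
      then show ?thesis unfolding dist_int_le_iff by simp
    qed
    have "(\<Sum>k<r. indicator {x. dist_int (real q * x) \<le> \<alpha>} (x + real k / real r) :: ennreal) =
      (\<Sum>k<r. if dist_int (real q * (x + real k / real r)) \<le> \<alpha> then 1 else 0)"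
      by (intro sum.cong) (auto simp: indicator_def)
    also have "\<dots> = of_nat (card {k\<in>{..<r}. dist_int (real q * (x + real k / real r)) \<le> \<alpha>})"
      by (simp add: sum.If_cases Int_def)
    also have "\<dots> = ennreal (real (card {k\<in>{..<r}. dist_int (real q * (x + real k / real r)) \<le> \<alpha>}))"
      by (simp add: ennreal_of_nat_eq_real_of_nat)
    also have "\<dots> \<le> ennreal (2 * (\<alpha> * r) + gcd q r)"
      unfolding iff using card_residues_near[OF r, of "\<alpha> * r" "real r * (real q * x)" q] \<alpha>
      by (intro ennreal_leI) simp
    finally show ?thesis by (simp add: mult.assoc)
  qed
  then have "(\<integral>\<^sup>+x. indicator {x. dist_int (real q * x) \<le> \<alpha>} x * indicator {x. dist_int (real r * x) \<le> \<beta>} x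
           * indicator {0..<1} x \<partial>lborel) \<le> ennreal ((2 * \<alpha> * r + gcd q r) * (2 * \<beta> / r))"
    using \<alpha> by (intro nn_integral_dist_int_le_mult r \<beta>) auto
  also have "(2 * \<alpha> * r + gcd q r) * (2 * \<beta> / r) = 4 * \<alpha> * \<beta> + 2 * gcd q r * (\<beta> / r)"
    using r by (simp add: field_simps)
  finally show ?thesis .
qed

text \<open>The one-sided estimate averages the first factor over the period of the second; used in
  both orders it gives the smaller of the two errors. The minimum matters because 2 min(\<alpha>/q,
  \<beta>/r) is the length of the set of w with |q w| \<le> \<alpha> and |r w| \<le> \<beta>, the
  coincidence law.\<close>

lemma dist_int_pair_le:
  fixes q r :: nat
  assumes q: "q > 0" and r: "r > 0" and \<alpha>: "0 \<le> \<alpha>" "\<alpha> \<le> 1 / 2" and \<beta>: "0 \<le> \<beta>" "\<beta> \<le> 1 / 2"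
  shows "(\<integral>\<^sup>+x. indicator {x. dist_int (real q * x) \<le> \<alpha>} x * indicator {x. dist_int (real r * x) \<le> \<beta>} x
           * indicator {0..<1} x \<partial>lborel) \<le> ennreal (4 * \<alpha> * \<beta> + 2 * gcd q r * min (\<alpha> / q) (\<beta> / r))"
proof (cases "\<alpha> / q \<le> \<beta> / r")
  case True
  have "4 * \<beta> * \<alpha> + 2 * gcd r q * (\<alpha> / q) = 4 * \<alpha> * \<beta> + 2 * gcd q r * min (\<alpha> / q) (\<beta> / r)"
    using True by (simp add: min_absorb1 gcd.commute)
  then show ?thesis
    using dist_int_pair_le1[OF q \<beta>(1) \<alpha>, of r] by (simp only: mult.commute[of "indicator {x. dist_int (real r * x) \<le> \<beta>} _"
         "indicator {x. dist_int (real q * x) \<le> \<alpha>} _"])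
next
  case False
  then have "min (\<alpha> / q) (\<beta> / r) = \<beta> / r" by simp
  then show ?thesis
    using dist_int_pair_le1[OF r \<alpha>(1) \<beta>, of q] by (simp only:)
qed

lemma emeasure_dist_int_le_unit:
  fixes q :: nat
  assumes q: "q > 0" and \<alpha>: "0 \<le> \<alpha>" "\<alpha> \<le> 1 / 2"
  shows "(\<integral>\<^sup>+x. indicator {x. dist_int (real q * x) \<le> \<alpha>} x * indicator {0..<1} x \<partial>lborel) = ennreal (2 * \<alpha>)"
proof -
  have per: "dist_int (real q * (x + real k / real q)) = dist_int (real q * x)" for x k
    using dist_int_add_int[of "real q * x" "int k"] q by (simp add: algebra_simps)
  have "(\<integral>\<^sup>+x. indicator {x. dist_int (real q * x) \<le> \<alpha>} x * indicator {0..<1} x \<partial>lborel)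
    = (\<integral>\<^sup>+x. (\<Sum>k<q. indicator {x. dist_int (real q * x) \<le> \<alpha>} (x + real k / real q))
           * indicator {0..<1 / real q} x \<partial>lborel)"
    using q by (intro nn_integral_unit_interval_split) auto
  also have "\<dots> = (\<integral>\<^sup>+x. of_nat q * indicator {x \<in> {0..<1 / real q}. dist_int (real q * x) \<le> \<alpha>} x \<partial>lborel)"
    by (intro nn_integral_cong) (auto simp: indicator_def per)
  also have "\<dots> = of_nat q * emeasure lborel {x \<in> {0..<1 / real q}. dist_int (real q * x) \<le> \<alpha>}"
    by (intro nn_integral_cmult_indicator) auto
  also have "\<dots> = ennreal (2 * \<alpha>)"
    using q \<alpha>(1)
    by (subst emeasure_dist_int_le[OF q \<alpha>]) (simp add: ennreal_of_nat_eq_real_of_nat ennreal_mult[symmetric])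
  finally show ?thesis .
qed

section \<open>Hyperbolic crosses and pair correlations\<close>

definition star_reg :: "real \<Rightarrow> real \<Rightarrow> (real \<times> real) set"
  where "star_reg \<delta> c = {(t, s). \<bar>t\<bar> \<le> c \<and> \<bar>s\<bar> \<le> c \<and> \<bar>t * s\<bar> \<le> \<delta>}"

definition star_ind :: "real \<Rightarrow> real \<Rightarrow> real \<Rightarrow> real \<Rightarrow> ennreal"
  where "star_ind \<delta> c t s = indicator (star_reg \<delta> c) (t, s)"

lemma closed_star_reg: "closed (star_reg \<delta> c)"
  unfolding star_reg_def case_prod_beta
  by (intro closed_Collect_conj closed_Collect_le continuous_intros)

lemma sets_star_reg [measurable]: "star_reg \<delta> c \<in> sets borel"
  using closed_star_reg by (rule borel_closed)

lemma star_ind_measurable [measurable]: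
  assumes [measurable]: "f \<in> borel_measurable M" "g \<in> borel_measurable M"
  shows "(\<lambda>x. star_ind \<delta> c (f x) (g x)) \<in> borel_measurable M"
  unfolding star_ind_def by measurable

lemma star_ind_commute: "star_ind \<delta> c t s = star_ind \<delta> c s t"
  by (auto simp: star_ind_def star_reg_def indicator_def mult.commute)

lemma star_ind_le_1: "star_ind \<delta> c t s \<le> 1"
  by (auto simp: star_ind_def indicator_def)

lemma star_ind_eq_0: "c < \<bar>t\<bar> \<Longrightarrow> star_ind \<delta> c t s = 0"
  by (auto simp: star_ind_def star_reg_def)

text \<open>The half-length is min(c, \<delta> / |t|). The product form and the disjunction, which
  records maximality, avoid a division at t = 0.\<close>

lemma star_ind_slice:
  assumes "0 \<le> \<delta>" "0 \<le> c" "\<bar>t\<bar> \<le> c"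
  obtains \<alpha> where "0 \<le> \<alpha>" "\<alpha> \<le> c" "\<alpha> * \<bar>t\<bar> \<le> \<delta>" "\<alpha> = c \<or> t \<noteq> 0 \<and> \<alpha> * \<bar>t\<bar> = \<delta>" "\<And>s. star_ind \<delta> c t s = indicator {-\<alpha>..\<alpha>} s"
proof (cases "\<bar>t\<bar> * c \<le> \<delta>")
  case True
  have "\<bar>t * s\<bar> \<le> \<delta>" if "\<bar>s\<bar> \<le> c" for s
    using mult_left_mono[OF that, of "\<bar>t\<bar>"] True by (simp add: abs_mult)
  then have "star_ind \<delta> c t s = indicator {-c..c} s" for s
    using assms by (auto simp: star_ind_def star_reg_def indicator_def abs_le_iff)
  then show thesis using True assms by (intro that[of c]) (auto simp: mult.commute)
next
  case False
  then have t: "\<bar>t\<bar> > 0" using assms by (cases "t = 0") auto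
  have c: "\<delta> / \<bar>t\<bar> < c" using False t by (simp add: field_simps)
  have "\<bar>t * s\<bar> \<le> \<delta> \<longleftrightarrow> \<bar>s\<bar> \<le> \<delta> / \<bar>t\<bar>" for s
    using t by (simp add: field_simps abs_mult)
  then have "star_ind \<delta> c t s = indicator {-(\<delta> / \<bar>t\<bar>)..\<delta> / \<bar>t\<bar>} s" for s
    using assms c by (auto simp: star_ind_def star_reg_def indicator_def abs_le_iff)
  then show thesis using c t assms by (intro that[of "\<delta> / \<bar>t\<bar>"]) auto
qed

lemma nn_integral_symmetric_interval:
  "0 \<le> \<alpha> \<Longrightarrow> (\<integral>\<^sup>+s. indicator {-\<alpha>..\<alpha>} s \<partial>lborel) = ennreal (2 * \<alpha>)"
  by simp

text \<open>The estimate for symmetric intervals, rewritten through integrals of the kernels: in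
  this form the half-lengths have disappeared and the inequality can be integrated over t and
  t'.\<close>

lemma dist_int_star_ind_pair_le:
  fixes q r :: nat
  assumes q: "q > 0" and r: "r > 0" and c: "0 \<le> c" "c \<le> 1 / 2" and \<delta>: "0 \<le> \<delta>" and \<delta>': "0 \<le> \<delta>'"
  shows "(\<integral>\<^sup>+x. star_ind \<delta> c t (dist_int (real q * x)) * star_ind \<delta>' c t' (dist_int (real r * x))
           * indicator {0..<1} x \<partial>lborel)
     \<le> (\<integral>\<^sup>+s. star_ind \<delta> c t s \<partial>lborel) * (\<integral>\<^sup>+s. star_ind \<delta>' c t' s \<partial>lborel)
        + of_nat (gcd q r) * (\<integral>\<^sup>+w. star_ind \<delta> c t (real q * w) * star_ind \<delta>' c t' (real r * w) \<partial>lborel)"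
proof (cases "\<bar>t\<bar> \<le> c \<and> \<bar>t'\<bar> \<le> c")
  case False
  then show ?thesis by (auto simp: star_ind_eq_0)
next
  case True
  obtain \<alpha> where \<alpha>: "0 \<le> \<alpha>" "\<alpha> \<le> c" "\<And>s. star_ind \<delta> c t s = indicator {-\<alpha>..\<alpha>} s"
    using star_ind_slice[of \<delta> c t] \<delta> c True by metis
  obtain \<beta> where \<beta>: "0 \<le> \<beta>" "\<beta> \<le> c" "\<And>s. star_ind \<delta>' c t' s = indicator {-\<beta>..\<beta>} s"
    using star_ind_slice[of \<delta>' c t'] \<delta>' c True by metis
  define m where "m = min (\<alpha> / q) (\<beta> / r)"
  have m: "0 \<le> m" using \<alpha> \<beta> by (simp add: m_def)
  have "indicator {-\<alpha>..\<alpha>} (real q * w) * indicator {-\<beta>..\<beta>} (real r * w) = (indicator {-m..m} w :: ennreal)" for w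
  proof -
    have "real q * w \<in> {-\<alpha>..\<alpha>} \<longleftrightarrow> w \<in> {-(\<alpha> / q)..\<alpha> / q}" "real r * w \<in> {-\<beta>..\<beta>} \<longleftrightarrow> w \<in> {-(\<beta> / r)..\<beta> / r}"
      using q r by (auto simp: field_simps)
    then show ?thesis unfolding m_def by (auto simp: indicator_def min_def split: if_splits)
  qed
  then have w: "(\<integral>\<^sup>+w. star_ind \<delta> c t (real q * w) * star_ind \<delta>' c t' (real r * w) \<partial>lborel) = ennreal (2 * m)"
    using nn_integral_symmetric_interval[OF m] by (simp only: \<alpha> \<beta>)
  have ind: "indicator {-a..a} (dist_int z) = (indicator {x. dist_int x \<le> a} z :: ennreal)" if "a \<ge> 0" for a z
    using dist_int_nonneg[of z] that by (auto simp: indicator_def)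
  have "(\<integral>\<^sup>+x. star_ind \<delta> c t (dist_int (real q * x)) * star_ind \<delta>' c t' (dist_int (real r * x))
           * indicator {0..<1} x \<partial>lborel) =
     (\<integral>\<^sup>+x. indicator {x. dist_int (real q * x) \<le> \<alpha>} x * indicator {x. dist_int (real r * x) \<le> \<beta>} x
           * indicator {0..<1} x \<partial>lborel)"
    unfolding \<alpha>(3) \<beta>(3) ind[OF \<alpha>(1)] ind[OF \<beta>(1)]
    by (intro nn_integral_cong) (auto simp: indicator_def)
  also have "\<dots> \<le> ennreal (4 * \<alpha> * \<beta> + 2 * gcd q r * min (\<alpha> / q) (\<beta> / r))"
    using \<alpha> \<beta> c by (intro dist_int_pair_le q r) auto
  also have "\<dots> = ennreal ((2 * \<alpha>) * (2 * \<beta>) + real (gcd q r) * (2 * m))"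
    by (simp add: m_def algebra_simps)
  also have "\<dots> = ennreal (2 * \<alpha>) * ennreal (2 * \<beta>) + of_nat (gcd q r) * ennreal (2 * m)"
    using \<alpha>(1) \<beta>(1) m
    by (simp only: ennreal_plus ennreal_mult ennreal_of_nat_eq_real_of_nat mult_nonneg_nonneg of_nat_0_le_iff zero_le_numeral)
  finally show ?thesis
    unfolding w unfolding \<alpha>(3) \<beta>(3) nn_integral_symmetric_interval[OF \<alpha>(1)] nn_integral_symmetric_interval[OF \<beta>(1)] .
qed

text \<open>Kept as an iterated integral because the coordinates are replaced one at a time;
  \<open>emeasure_star_reg\<close> identifies it with the area of the cross.\<close>

definition star_mass :: "real \<Rightarrow> real \<Rightarrow> ennreal"
  where "star_mass \<delta> c = (\<integral>\<^sup>+t. \<integral>\<^sup>+s. star_ind \<delta> c t s \<partial>lborel \<partial>lborel)"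

definition hit :: "real \<Rightarrow> real \<Rightarrow> nat \<Rightarrow> real \<Rightarrow> real \<Rightarrow> ennreal"
  where "hit \<delta> c q x y = star_ind \<delta> c (dist_int (real q * x)) (dist_int (real q * y))"

lemma nn_integral_swap_lborel:
  fixes f :: "real \<Rightarrow> real \<Rightarrow> ennreal"
  assumes "(\<lambda>(x, y). f x y) \<in> borel_measurable (lborel \<Otimes>\<^sub>M lborel)"
  shows "(\<integral>\<^sup>+x. \<integral>\<^sup>+y. f x y \<partial>lborel \<partial>lborel) = (\<integral>\<^sup>+y. \<integral>\<^sup>+x. f x y \<partial>lborel \<partial>lborel)"
  using lborel_pair.Fubini'[OF assms] by simp

text \<open>
  One coordinate at a time is replaced, using Fubini, by the product law plus the law of
  \<open>(q w, r w)\<close>; this works because every slice of a hyperbolic cross is a symmetric interval.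
\<close>
lemma hit_pair_le:
  fixes q r :: nat
  assumes q: "q > 0" and r: "r > 0" and c: "0 \<le> c" "c \<le> 1 / 2" and \<delta>: "0 \<le> \<delta>" and \<delta>': "0 \<le> \<delta>'"
  defines "g \<equiv> of_nat (gcd q r) :: ennreal"
  shows "(\<integral>\<^sup>+x. (\<integral>\<^sup>+y. hit \<delta> c q x y * hit \<delta>' c r x y * indicator {0..<1} y \<partial>lborel) * indicator {0..<1} x \<partial>lborel)
    \<le> star_mass \<delta> c * star_mass \<delta>' c
      + 2 * g * (\<integral>\<^sup>+w. (\<integral>\<^sup>+s. star_ind \<delta> c s (real q * w) \<partial>lborel) * (\<integral>\<^sup>+s. star_ind \<delta>' c s (real r * w) \<partial>lborel) \<partial>lborel)
      + g * g * (\<integral>\<^sup>+w. \<integral>\<^sup>+v. star_ind \<delta> c (real q * w) (real q * v) * star_ind \<delta>' c (real r * w) (real r * v) \<partial>lborel \<partial>lborel)"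
proof -
  let ?K = "star_ind \<delta> c" and ?K' = "star_ind \<delta>' c" and ?U = "indicator {0..<1} :: real \<Rightarrow> ennreal"
  let ?d = "\<lambda>q x. dist_int (real q * x)"
  \<comment> \<open>The mixed term: coincidence in one coordinate, independence in the other. It
    arises once from each coordinate, which explains the factor 2 in the statement;
    \<open>J'\<close> is the same integral with the coordinates exchanged.\<close>
  define J where "J = (\<integral>\<^sup>+w. (\<integral>\<^sup>+s. ?K s (real q * w) \<partial>lborel) * (\<integral>\<^sup>+s. ?K' s (real r * w) \<partial>lborel) \<partial>lborel)"
  have J': "J = (\<integral>\<^sup>+w. (\<integral>\<^sup>+u. ?K (real q * w) u \<partial>lborel) * (\<integral>\<^sup>+u. ?K' (real r * w) u \<partial>lborel) \<partial>lborel)"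
    by (simp only: J_def star_ind_commute[of _ _ _ "real q * _"] star_ind_commute[of _ _ _ "real r * _"])
  note base = dist_int_star_ind_pair_le[OF q r c \<delta> \<delta>', folded g_def]
  have "(\<integral>\<^sup>+x. (\<integral>\<^sup>+y. hit \<delta> c q x y * hit \<delta>' c r x y * ?U y \<partial>lborel) * ?U x \<partial>lborel)
    \<le> (\<integral>\<^sup>+x. ((\<integral>\<^sup>+s. ?K (?d q x) s \<partial>lborel) * (\<integral>\<^sup>+s. ?K' (?d r x) s \<partial>lborel)
        + g * (\<integral>\<^sup>+w. ?K (?d q x) (real q * w) * ?K' (?d r x) (real r * w) \<partial>lborel)) * ?U x \<partial>lborel)"
    unfolding hit_def by (intro nn_integral_mono mult_right_mono base) auto
  also have "\<dots> = (\<integral>\<^sup>+x. (\<integral>\<^sup>+s. ?K (?d q x) s \<partial>lborel) * (\<integral>\<^sup>+s. ?K' (?d r x) s \<partial>lborel) * ?U x \<partial>lborel)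
     + g * (\<integral>\<^sup>+x. (\<integral>\<^sup>+w. ?K (?d q x) (real q * w) * ?K' (?d r x) (real r * w) \<partial>lborel) * ?U x \<partial>lborel)"
    unfolding distrib_right mult.assoc[of g]
    by (subst nn_integral_add) (auto intro!: arg_cong2[of _ _ _ _ "(+)"] nn_integral_cmult)
  finally have split: "(\<integral>\<^sup>+x. (\<integral>\<^sup>+y. hit \<delta> c q x y * hit \<delta>' c r x y * ?U y \<partial>lborel) * ?U x \<partial>lborel)
    \<le> (\<integral>\<^sup>+x. (\<integral>\<^sup>+s. ?K (?d q x) s \<partial>lborel) * (\<integral>\<^sup>+s. ?K' (?d r x) s \<partial>lborel) * ?U x \<partial>lborel)
     + g * (\<integral>\<^sup>+x. (\<integral>\<^sup>+w. ?K (?d q x) (real q * w) * ?K' (?d r x) (real r * w) \<partial>lborel) * ?U x \<partial>lborel)" .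
  have "(\<integral>\<^sup>+x. (\<integral>\<^sup>+s. ?K (?d q x) s \<partial>lborel) * (\<integral>\<^sup>+s. ?K' (?d r x) s \<partial>lborel) * ?U x \<partial>lborel)
    = (\<integral>\<^sup>+x. \<integral>\<^sup>+s. \<integral>\<^sup>+s'. ?K (?d q x) s * ?K' (?d r x) s' * ?U x \<partial>lborel \<partial>lborel \<partial>lborel)"
    by (simp add: nn_integral_multc nn_integral_cmult)
  also have "\<dots> = (\<integral>\<^sup>+s. \<integral>\<^sup>+x. \<integral>\<^sup>+s'. ?K (?d q x) s * ?K' (?d r x) s' * ?U x \<partial>lborel \<partial>lborel \<partial>lborel)"
    by (intro nn_integral_swap_lborel) measurable
  also have "\<dots> = (\<integral>\<^sup>+s. \<integral>\<^sup>+s'. \<integral>\<^sup>+x. ?K (?d q x) s * ?K' (?d r x) s' * ?U x \<partial>lborel \<partial>lborel \<partial>lborel)"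
    by (intro nn_integral_cong nn_integral_swap_lborel) measurable
  also have "\<dots> = (\<integral>\<^sup>+s. \<integral>\<^sup>+s'. \<integral>\<^sup>+x. ?K s (?d q x) * ?K' s' (?d r x) * ?U x \<partial>lborel \<partial>lborel \<partial>lborel)"
    by (simp only: star_ind_commute[of _ _ "?d _ _"])
  also have "\<dots> \<le> (\<integral>\<^sup>+s. \<integral>\<^sup>+s'. (\<integral>\<^sup>+u. ?K s u \<partial>lborel) * (\<integral>\<^sup>+u. ?K' s' u \<partial>lborel)
       + g * (\<integral>\<^sup>+w. ?K s (real q * w) * ?K' s' (real r * w) \<partial>lborel) \<partial>lborel \<partial>lborel)"
    by (intro nn_integral_mono base)
  also have "\<dots> = star_mass \<delta> c * star_mass \<delta>' c
       + g * (\<integral>\<^sup>+s. \<integral>\<^sup>+s'. \<integral>\<^sup>+w. ?K s (real q * w) * ?K' s' (real r * w) \<partial>lborel \<partial>lborel \<partial>lborel)"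
    by (simp add: nn_integral_add nn_integral_cmult nn_integral_multc star_mass_def)
  also have "(\<integral>\<^sup>+s. \<integral>\<^sup>+s'. \<integral>\<^sup>+w. ?K s (real q * w) * ?K' s' (real r * w) \<partial>lborel \<partial>lborel \<partial>lborel)
     = (\<integral>\<^sup>+s. \<integral>\<^sup>+w. \<integral>\<^sup>+s'. ?K s (real q * w) * ?K' s' (real r * w) \<partial>lborel \<partial>lborel \<partial>lborel)"
    by (intro nn_integral_cong nn_integral_swap_lborel) measurable
  also have "\<dots> = (\<integral>\<^sup>+w. \<integral>\<^sup>+s. \<integral>\<^sup>+s'. ?K s (real q * w) * ?K' s' (real r * w) \<partial>lborel \<partial>lborel \<partial>lborel)"
    by (intro nn_integral_swap_lborel) measurable
  also have "\<dots> = J"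
    by (simp add: J_def nn_integral_cmult nn_integral_multc)
  finally have one: "(\<integral>\<^sup>+x. (\<integral>\<^sup>+s. ?K (?d q x) s \<partial>lborel) * (\<integral>\<^sup>+s. ?K' (?d r x) s \<partial>lborel) * ?U x \<partial>lborel)
     \<le> star_mass \<delta> c * star_mass \<delta>' c + g * J" .
  have "(\<integral>\<^sup>+x. (\<integral>\<^sup>+w. ?K (?d q x) (real q * w) * ?K' (?d r x) (real r * w) \<partial>lborel) * ?U x \<partial>lborel)
    = (\<integral>\<^sup>+x. \<integral>\<^sup>+w. ?K (?d q x) (real q * w) * ?K' (?d r x) (real r * w) * ?U x \<partial>lborel \<partial>lborel)"
    by (simp add: nn_integral_multc)
  also have "\<dots> = (\<integral>\<^sup>+w. \<integral>\<^sup>+x. ?K (?d q x) (real q * w) * ?K' (?d r x) (real r * w) * ?U x \<partial>lborel \<partial>lborel)"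
    by (intro nn_integral_swap_lborel) measurable
  also have "\<dots> = (\<integral>\<^sup>+w. \<integral>\<^sup>+x. ?K (real q * w) (?d q x) * ?K' (real r * w) (?d r x) * ?U x \<partial>lborel \<partial>lborel)"
    by (simp only: star_ind_commute[of _ _ "?d _ _"])
  also have "\<dots> \<le> (\<integral>\<^sup>+w. (\<integral>\<^sup>+u. ?K (real q * w) u \<partial>lborel) * (\<integral>\<^sup>+u. ?K' (real r * w) u \<partial>lborel)
       + g * (\<integral>\<^sup>+v. ?K (real q * w) (real q * v) * ?K' (real r * w) (real r * v) \<partial>lborel) \<partial>lborel)"
    by (intro nn_integral_mono base)
  also have "\<dots> = J + g * (\<integral>\<^sup>+w. \<integral>\<^sup>+v. ?K (real q * w) (real q * v) * ?K' (real r * w) (real r * v) \<partial>lborel \<partial>lborel)"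
    unfolding J' by (simp add: nn_integral_add nn_integral_cmult)
  finally have two: "(\<integral>\<^sup>+x. (\<integral>\<^sup>+w. ?K (?d q x) (real q * w) * ?K' (?d r x) (real r * w) \<partial>lborel) * ?U x \<partial>lborel)
    \<le> J + g * (\<integral>\<^sup>+w. \<integral>\<^sup>+v. ?K (real q * w) (real q * v) * ?K' (real r * w) (real r * v) \<partial>lborel \<partial>lborel)" .
  have main: "(\<integral>\<^sup>+x. (\<integral>\<^sup>+y. hit \<delta> c q x y * hit \<delta>' c r x y * ?U y \<partial>lborel) * ?U x \<partial>lborel)
    \<le> star_mass \<delta> c * star_mass \<delta>' c + g * J + g * (J + g * 
      (\<integral>\<^sup>+w. \<integral>\<^sup>+v. ?K (real q * w) (real q * v) * ?K' (real r * w) (real r * v) \<partial>lborel \<partial>lborel))"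
    by (rule order_trans[OF split add_mono[OF one mult_left_mono[OF two]]]) simp
  then show ?thesis
    unfolding J_def[symmetric] by (simp add: distrib_left mult_2 distrib_right add.assoc mult.assoc)
qed

section \<open>Estimates for the area and the coincidence integral\<close>

lemma nn_integral_abs_le:
  fixes f :: "real \<Rightarrow> ennreal"
  assumes [measurable]: "f \<in> borel_measurable borel"
  shows "(\<integral>\<^sup>+w. f \<bar>w\<bar> \<partial>lborel) \<le> 2 * (\<integral>\<^sup>+w. f w * indicator {0..} w \<partial>lborel)"
proof -
  have "(\<integral>\<^sup>+w. f \<bar>w\<bar> \<partial>lborel) \<le> (\<integral>\<^sup>+w. f w * indicator {0..} w + f (-w) * indicator {0..} (-w) \<partial>lborel)"
    by (intro nn_integral_mono) (auto simp: indicator_def abs_real_def)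
  also have "\<dots> = (\<integral>\<^sup>+w. f w * indicator {0..} w \<partial>lborel) + (\<integral>\<^sup>+w. f (-w) * indicator {0..} (-w) \<partial>lborel)"
    by (intro nn_integral_add) auto
  also have "(\<integral>\<^sup>+w. f (-w) * indicator {0..} (-w) \<partial>lborel) = (\<integral>\<^sup>+w. f w * indicator {0..} w \<partial>lborel)"
    using nn_integral_real_affine[of "\<lambda>w. f w * indicator {0..} w" "-1" 0] by simp
  finally show ?thesis by (simp add: mult_2)
qed

definition slice :: "real \<Rightarrow> real \<Rightarrow> real \<Rightarrow> ennreal"
  where "slice \<delta> c t = (\<integral>\<^sup>+s. star_ind \<delta> c t s \<partial>lborel)"

lemma slice_measurable [measurable]: "slice \<delta> c \<in> borel_measurable borel"
  unfolding slice_def by measurable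

lemma slice_bounds:
  assumes "0 \<le> \<delta>" "0 \<le> c" "c \<le> 1 / 2"
  obtains a where "slice \<delta> c t = ennreal a" "0 \<le> a" "a \<le> 1" "a * \<bar>t\<bar> \<le> 2 * \<delta>"
proof (cases "\<bar>t\<bar> \<le> c")
  case True
  obtain \<alpha> where \<alpha>: "0 \<le> \<alpha>" "\<alpha> \<le> c" "\<alpha> * \<bar>t\<bar> \<le> \<delta>" "\<And>s. star_ind \<delta> c t s = indicator {-\<alpha>..\<alpha>} s"
    using star_ind_slice[of \<delta> c t] assms True by metis
  then show thesis
    using assms by (intro that[of "2 * \<alpha>"]) (auto simp: slice_def nn_integral_symmetric_interval)
next
  case False
  then show thesis
    using assms by (intro that[of 0]) (auto simp: slice_def star_ind_eq_0)
qed

text \<open>The half-length min(c, \<delta> / |t|) is subadditive in \<delta>. This is what bounds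
  the area gained in one step of the grid for b by the area of a cross whose parameter is the mesh
  itself.\<close>

lemma slice_add_le:
  assumes "0 \<le> \<delta>" "0 \<le> \<epsilon>" "0 \<le> c"
  shows "slice (\<delta> + \<epsilon>) c t \<le> slice \<delta> c t + slice \<epsilon> c t"
proof (cases "\<bar>t\<bar> \<le> c")
  case True
  obtain \<alpha> where \<alpha>: "0 \<le> \<alpha>" "\<alpha> \<le> c" "\<alpha> = c \<or> t \<noteq> 0 \<and> \<alpha> * \<bar>t\<bar> = \<delta>" "\<And>s. star_ind \<delta> c t s = indicator {-\<alpha>..\<alpha>} s"
    using star_ind_slice[of \<delta> c t] assms True by metis
  obtain \<beta> where \<beta>: "0 \<le> \<beta>" "\<beta> \<le> c" "\<beta> = c \<or> t \<noteq> 0 \<and> \<beta> * \<bar>t\<bar> = \<epsilon>" "\<And>s. star_ind \<epsilon> c t s = indicator {-\<beta>..\<beta>} s"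
    using star_ind_slice[of \<epsilon> c t] assms True by metis
  obtain \<gamma> where \<gamma>: "0 \<le> \<gamma>" "\<gamma> \<le> c" "\<gamma> * \<bar>t\<bar> \<le> \<delta> + \<epsilon>" "\<And>s. star_ind (\<delta> + \<epsilon>) c t s = indicator {-\<gamma>..\<gamma>} s"
    using star_ind_slice[of "\<delta> + \<epsilon>" c t] assms True by (metis add_nonneg_nonneg)
  have "\<gamma> \<le> \<alpha> + \<beta>"
  proof (cases "\<alpha> = c \<or> \<beta> = c")
    case True
    then show ?thesis using \<alpha> \<beta> \<gamma> by auto
  next
    case False
    then have "t \<noteq> 0" "\<gamma> * \<bar>t\<bar> \<le> (\<alpha> + \<beta>) * \<bar>t\<bar>"
      using \<alpha>(3) \<beta>(3) \<gamma>(3) by (auto simp: distrib_right)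
    then show ?thesis by simp
  qed
  then have "ennreal (2 * \<gamma>) \<le> ennreal (2 * \<alpha> + 2 * \<beta>)"
    by (intro ennreal_leI) simp
  also have "\<dots> = ennreal (2 * \<alpha>) + ennreal (2 * \<beta>)"
    using \<alpha>(1) \<beta>(1) by (intro ennreal_plus) auto
  finally have "ennreal (2 * \<gamma>) \<le> ennreal (2 * \<alpha>) + ennreal (2 * \<beta>)" .
  then show ?thesis
    unfolding slice_def \<alpha>(4) \<beta>(4) \<gamma>(4) nn_integral_symmetric_interval[OF \<alpha>(1)]
      nn_integral_symmetric_interval[OF \<beta>(1)] nn_integral_symmetric_interval[OF \<gamma>(1)] .
next
  case False
  then show ?thesis by (simp add: slice_def star_ind_eq_0)
qed

lemma star_mass_slice: "star_mass \<delta> c = (\<integral>\<^sup>+t. slice \<delta> c t \<partial>lborel)"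
  by (simp add: star_mass_def slice_def)

lemma star_mass_add_le:
  assumes "0 \<le> \<delta>" "0 \<le> \<epsilon>" "0 \<le> c"
  shows "star_mass (\<delta> + \<epsilon>) c \<le> star_mass \<delta> c + star_mass \<epsilon> c"
  unfolding star_mass_slice
  using slice_add_le[OF assms] by (subst nn_integral_add[symmetric]) (auto intro: nn_integral_mono)

lemma star_ind_mono:
  assumes "\<delta> \<le> \<delta>'" "c \<le> c'"
  shows "star_ind \<delta> c t s \<le> star_ind \<delta>' c' t s"
  using assms by (auto simp: star_ind_def star_reg_def indicator_def)

lemma star_mass_mono:
  assumes "\<delta> \<le> \<delta>'" "c \<le> c'"
  shows "star_mass \<delta> c \<le> star_mass \<delta>' c'"
  unfolding star_mass_def by (intro nn_integral_mono star_ind_mono assms)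

lemma star_mass_le_1:
  assumes "0 \<le> c" "c \<le> 1 / 2"
  shows "star_mass \<delta> c \<le> 1"
proof -
  have "star_mass \<delta> c \<le> (\<integral>\<^sup>+t. \<integral>\<^sup>+s. indicator {-c..c} t * indicator {-c..c} s \<partial>lborel \<partial>lborel)"
    unfolding star_mass_def
    by (intro nn_integral_mono) (auto simp: star_ind_def star_reg_def indicator_def)
  also have "\<dots> = ennreal (2 * c) * ennreal (2 * c)"
    using assms by (simp add: nn_integral_cmult nn_integral_multc)
  also have "\<dots> = ennreal (2 * c * (2 * c))"
    using assms by (intro ennreal_mult[symmetric]) auto
  also have "\<dots> \<le> ennreal 1"
    using assms mult_le_one[of "2 * c" "2 * c"] by (intro ennreal_leI) simp
  finally show ?thesis by simp
qed

text \<open>A point gained by doubling c has one coordinate above c, hence the other at most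
  \<delta> / c. The gain lies in two rectangles of area 4c times 2 \<delta> / c, and no logarithm
  appears.\<close>

lemma star_mass_double_le:
  assumes "0 < c" "0 \<le> \<delta>"
  shows "star_mass \<delta> (2 * c) \<le> star_mass \<delta> c + ennreal (16 * \<delta>)"
proof -
  let ?I = "\<lambda>t. indicator {-(2 * c)..2 * c} t :: ennreal" and ?D = "\<lambda>t. indicator {-(\<delta> / c)..\<delta> / c} t :: ennreal"
  have *: "star_ind \<delta> (2 * c) t s \<le> star_ind \<delta> c t s + (?I t * ?D s + ?D t * ?I s)" for t s
  proof (cases "(t, s) \<in> star_reg \<delta> (2 * c) \<and> (t, s) \<notin> star_reg \<delta> c")
    case False
    then show ?thesis by (auto simp: star_ind_def indicator_def)
  next
    case True
    then have h: "\<bar>t\<bar> \<le> 2 * c" "\<bar>s\<bar> \<le> 2 * c" "\<bar>t\<bar> * \<bar>s\<bar> \<le> \<delta>" "c < \<bar>t\<bar> \<or> c < \<bar>s\<bar>"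
      by (auto simp: star_reg_def abs_mult)
    have "\<bar>s\<bar> \<le> \<delta> / c" if "c < \<bar>t\<bar>"
    proof -
      have "c * \<bar>s\<bar> \<le> \<bar>t\<bar> * \<bar>s\<bar>" using that by (intro mult_right_mono) auto
      then show ?thesis using h assms by (simp add: field_simps)
    qed
    moreover have "\<bar>t\<bar> \<le> \<delta> / c" if "c < \<bar>s\<bar>"
    proof -
      have "\<bar>t\<bar> * c \<le> \<bar>t\<bar> * \<bar>s\<bar>" using that by (intro mult_left_mono) auto
      then show ?thesis using h assms by (simp add: field_simps)
    qed
    ultimately have "1 \<le> ?I t * ?D s \<or> 1 \<le> ?D t * ?I s"
      using h by (auto simp: indicator_def abs_le_iff)
    then have "1 \<le> ?I t * ?D s + ?D t * ?I s"
      by (elim disjE) (auto intro: add_increasing add_increasing2)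
    then show ?thesis
      by (rule add_increasing[OF zero_le order_trans[OF star_ind_le_1]])
  qed
  have "star_mass \<delta> (2 * c) \<le> (\<integral>\<^sup>+t. \<integral>\<^sup>+s. star_ind \<delta> c t s + (?I t * ?D s + ?D t * ?I s) \<partial>lborel \<partial>lborel)"
    unfolding star_mass_def by (intro nn_integral_mono *)
  also have "\<dots> = star_mass \<delta> c + (ennreal (4 * c) * ennreal (2 * (\<delta> / c)) + ennreal (2 * (\<delta> / c)) * ennreal (4 * c))"
    using assms by (simp add: nn_integral_add nn_integral_cmult nn_integral_multc star_mass_def)
  also have "ennreal (4 * c) * ennreal (2 * (\<delta> / c)) = ennreal (8 * \<delta>)"
    using assms by (subst ennreal_mult[symmetric]) auto
  also have "ennreal (2 * (\<delta> / c)) * ennreal (4 * c) = ennreal (8 * \<delta>)"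
    using assms by (subst ennreal_mult[symmetric]) auto
  also have "ennreal (8 * \<delta>) + ennreal (8 * \<delta>) = ennreal (16 * \<delta>)"
    using assms by (subst ennreal_plus[symmetric]) auto
  finally show ?thesis .
qed

lemma star_mass_le:
  assumes \<delta>: "0 < \<delta>" and c: "0 \<le> c" "c \<le> 1 / 2"
  shows "star_mass \<delta> c \<le> ennreal (4 * \<delta> * (1 + ln (1 + 1 / \<delta>)))"
proof -
  \<comment> \<open>The slice is at most 1 near the axis and at most 2 \<delta> / |t| away from it.
    The endpoint 1 + \<delta> lies beyond c, keeps the interval nonempty for every \<delta>, and
    makes the logarithm come out as ln(1 + 1/\<delta>).\<close>
  define f :: "real \<Rightarrow> ennreal" where
    "f w = indicator {0..\<delta>} w + ennreal (2 * \<delta>) * (ennreal (1 / w) * indicator {\<delta>..1 + \<delta>} w)" for w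
  have [measurable]: "f \<in> borel_measurable borel" unfolding f_def by measurable
  have *: "slice \<delta> c t \<le> f \<bar>t\<bar>" for t
  proof (cases "\<bar>t\<bar> \<le> c")
    case False
    then show ?thesis by (simp add: slice_def star_ind_eq_0)
  next
    case True
    obtain a where a: "slice \<delta> c t = ennreal a" "0 \<le> a" "a \<le> 1" "a * \<bar>t\<bar> \<le> 2 * \<delta>"
      using slice_bounds[of \<delta> c t] \<delta> c by auto
    show ?thesis
    proof (cases "\<bar>t\<bar> \<le> \<delta>")
      case True
      then have "f \<bar>t\<bar> \<ge> 1" by (simp add: f_def)
      moreover have "ennreal a \<le> 1" using a by simp
      ultimately show ?thesis using a(1) by (metis order.trans)
    next
      case False
      then have "a \<le> 2 * \<delta> * (1 / \<bar>t\<bar>)" using a \<delta> by (simp add: field_simps)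
      then have "ennreal a \<le> ennreal (2 * \<delta>) * ennreal (1 / \<bar>t\<bar>)"
        using \<delta> by (subst ennreal_mult[symmetric]) (auto intro: ennreal_leI)
      moreover have "\<bar>t\<bar> \<in> {\<delta>..1 + \<delta>}" using False True c \<delta> by auto
      ultimately show ?thesis by (simp add: f_def a(1) False)
    qed
  qed
  have "star_mass \<delta> c \<le> (\<integral>\<^sup>+t. f \<bar>t\<bar> \<partial>lborel)"
    unfolding star_mass_slice by (intro nn_integral_mono *)
  also have "\<dots> \<le> 2 * (\<integral>\<^sup>+w. f w * indicator {0..} w \<partial>lborel)"
    by (rule nn_integral_abs_le) measurable
  also have "(\<integral>\<^sup>+w. f w * indicator {0..} w \<partial>lborel) \<le> (\<integral>\<^sup>+w. f w \<partial>lborel)"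
    by (intro nn_integral_mono) (auto simp: indicator_def)
  also have "(\<integral>\<^sup>+w. f w \<partial>lborel) = ennreal \<delta> + ennreal (2 * \<delta>) * (\<integral>\<^sup>+w. ennreal (1 / w) * indicator {\<delta>..1 + \<delta>} w \<partial>lborel)"
    unfolding f_def using \<delta> by (simp add: nn_integral_add nn_integral_cmult)
  also have "(\<integral>\<^sup>+w. ennreal (1 / w) * indicator {\<delta>..1 + \<delta>} w \<partial>lborel) = ennreal (ln (1 + \<delta>) - ln \<delta>)"
    using \<delta> by (intro nn_integral_FTC_Icc) (auto intro!: derivative_eq_intros simp: divide_inverse has_real_derivative_iff_has_vector_derivative[symmetric])
  also have "ln (1 + \<delta>) - ln \<delta> = ln (1 + 1 / \<delta>)"
    using \<delta> ln_div[of "1 + \<delta>" \<delta>] by (simp add: add_divide_distrib add.commute)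
  also have "2 * (ennreal \<delta> + ennreal (2 * \<delta>) * ennreal (ln (1 + 1 / \<delta>))) = ennreal (2 * (\<delta> + 2 * \<delta> * ln (1 + 1 / \<delta>)))"
    using \<delta> by (simp only: ennreal_mult ennreal_plus ln_ge_zero le_add_same_cancel1 zero_le_divide_iff
        mult_nonneg_nonneg add_nonneg_nonneg zero_le_numeral zero_le_one order_less_imp_le ennreal_numeral simp_thms)
  also have "\<dots> \<le> ennreal (4 * \<delta> * (1 + ln (1 + 1 / \<delta>)))"
    using \<delta> by (intro ennreal_leI) (simp add: algebra_simps)
  finally show ?thesis by (simp add: mult_left_mono)
qed

text \<open>With u = 2 b / r^2 and \<rho> = r / q the integrand is at most min(1, u \<rho>^2 / |w|)
  min(1, u / |w|), whose integral is of order u (1 + ln \<rho>). Interpolating the first factor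
  trades the logarithm for sqrt \<rho>.\<close>

lemma coincidence_integral_le:
  fixes q r :: nat
  assumes q: "0 < q" and qr: "q \<le> r" and b: "0 < b" and c: "0 \<le> c" "c \<le> 1 / 2"
  shows "(\<integral>\<^sup>+w. slice (b / q) c (real q * w) * slice (b / r) c (real r * w) \<partial>lborel)
     \<le> ennreal (20 * b / (real r)\<^sup>2 * sqrt (r / q))"
proof -
  define \<rho> where "\<rho> = real r / q"
  define u where "u = 2 * b / (real r)\<^sup>2"
  have r: "0 < r" using q qr by simp
  have \<rho>: "1 \<le> \<rho>" using q qr by (simp add: \<rho>_def)
  have u: "0 < u" using b r by (simp add: u_def)
  have sq: "1 \<le> sqrt \<rho>" using \<rho> by simp
  define f :: "real \<Rightarrow> ennreal" where
    "f w = ennreal (sqrt \<rho>) * (indicator {0..u} w + ennreal ((u / w) powr (5 / 4)) * indicator {u..} w)" for w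
  have [measurable]: "f \<in> borel_measurable borel" unfolding f_def by measurable
  have *: "slice (b / q) c (real q * w) * slice (b / r) c (real r * w) \<le> f \<bar>w\<bar>" for w
  proof -
    obtain x where x: "slice (b / q) c (real q * w) = ennreal x" "0 \<le> x" "x \<le> 1" "x * \<bar>real q * w\<bar> \<le> 2 * (b / q)"
      using slice_bounds[of "b / q" c "real q * w"] b c by auto
    obtain y where y: "slice (b / r) c (real r * w) = ennreal y" "0 \<le> y" "y \<le> 1" "y * \<bar>real r * w\<bar> \<le> 2 * (b / r)"
      using slice_bounds[of "b / r" c "real r * w"] b c by auto
    have xy: "slice (b / q) c (real q * w) * slice (b / r) c (real r * w) = ennreal (x * y)"
      using x y by (simp add: ennreal_mult)
    show ?thesis
    proof (cases "\<bar>w\<bar> \<le> u")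
      case True
      have "x * y \<le> 1" using x y by (intro mult_le_one) auto
      then have "ennreal (x * y) \<le> ennreal (sqrt \<rho>) * 1"
        using sq order_trans[of "x * y" 1 "sqrt \<rho>"] by (auto intro: ennreal_leI)
      also have "\<dots> \<le> f \<bar>w\<bar>"
        unfolding f_def using True by (intro mult_left_mono) auto
      finally show ?thesis using xy by simp
    next
      case False
      then have w: "0 < \<bar>w\<bar>" using u by linarith
      have y2: "y \<le> u / \<bar>w\<bar>"
        using y(4) w r by (simp add: u_def field_simps abs_mult power2_eq_square)
      have x2: "x \<le> u * \<rho>\<^sup>2 / \<bar>w\<bar>"
        using x(4) w r q by (simp add: u_def \<rho>_def field_simps abs_mult power2_eq_square)
      \<comment> \<open>Legitimate since x \<le> 1. The exponent has to be positive to make the tail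
        in w integrable, and below 1/2 to keep the resulting power of r / q bounded on average over
        q \<le> r.\<close>
      have "x \<le> x powr (1 / 4)"
        using x powr_mono'[of "1 / 4" 1 x] by simp
      also have "\<dots> \<le> (\<rho>\<^sup>2 * (u / \<bar>w\<bar>)) powr (1 / 4)"
        using x x2 by (intro powr_mono2) (auto simp: mult.commute)
      also have "\<dots> = (\<rho> powr 2) powr (1 / 4) * (u / \<bar>w\<bar>) powr (1 / 4)"
        using \<rho> u w by (subst powr_mult) (auto simp: powr_numeral)
      also have "(\<rho> powr 2) powr (1 / 4) = sqrt \<rho>"
        using \<rho> by (subst powr_powr) (simp add: powr_half_sqrt)
      finally have "x * y \<le> (sqrt \<rho> * (u / \<bar>w\<bar>) powr (1 / 4)) * (u / \<bar>w\<bar>)"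
        using x y y2 \<rho> by (intro mult_mono) auto
      also have "\<dots> = sqrt \<rho> * ((u / \<bar>w\<bar>) powr (1 / 4) * (u / \<bar>w\<bar>) powr 1)"
        using u w by (simp add: powr_one)
      also have "\<dots> = sqrt \<rho> * (u / \<bar>w\<bar>) powr (5 / 4)"
        by (subst powr_add[symmetric]) simp
      finally have "ennreal (x * y) \<le> ennreal (sqrt \<rho>) * ennreal ((u / \<bar>w\<bar>) powr (5 / 4))"
        using \<rho> by (subst ennreal_mult[symmetric]) (auto intro: ennreal_leI)
      then show ?thesis using False xy by (simp add: f_def)
    qed
  qed
  have "(\<integral>\<^sup>+w. slice (b / q) c (real q * w) * slice (b / r) c (real r * w) \<partial>lborel) \<le> (\<integral>\<^sup>+t. f \<bar>t\<bar> \<partial>lborel)"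
    by (intro nn_integral_mono *)
  also have "\<dots> \<le> 2 * (\<integral>\<^sup>+w. f w * indicator {0..} w \<partial>lborel)"
    by (rule nn_integral_abs_le) measurable
  also have "(\<integral>\<^sup>+w. f w * indicator {0..} w \<partial>lborel) \<le> (\<integral>\<^sup>+w. f w \<partial>lborel)"
    by (intro nn_integral_mono) (auto simp: indicator_def)
  also have "(\<integral>\<^sup>+w. f w \<partial>lborel) = ennreal (sqrt \<rho>) * (ennreal u + (\<integral>\<^sup>+w. ennreal ((u / w) powr (5 / 4)) * indicator {u..} w \<partial>lborel))"
    unfolding f_def using u by (simp add: nn_integral_add nn_integral_cmult)
  also have "(\<integral>\<^sup>+w. ennreal ((u / w) powr (5 / 4)) * indicator {u..} w \<partial>lborel) = ennreal (0 - (- 4 * u * (u / u) powr (1 / 4)))"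
  proof (rule nn_integral_FTC_atLeast[where F = "\<lambda>x. - 4 * u * (u / x) powr (1 / 4)"])
    fix x assume x: "u \<le> x"
    then have x0: "0 < x" using u by simp
    have eq: "(u / y) powr a = u powr a * y powr (- a)" if "0 < y" for y a
      using that u by (simp add: powr_divide powr_minus field_simps)
    have D: "((\<lambda>x. - 4 * u * (u powr (1 / 4) * x powr (- (1 / 4)))) has_real_derivative u * u powr (1 / 4) * x powr (- (1 / 4) - 1)) (at x)"
      using x0 by (auto intro!: derivative_eq_intros)
    have V: "u * u powr (1 / 4) * x powr (- (1 / 4) - 1) = (u / x) powr (5 / 4)"
      using powr_add[of u 1 "1 / 4"] u eq[OF x0, of "5 / 4"] by simp
    have Ev: "eventually (\<lambda>x. - 4 * u * (u powr (1 / 4) * x powr (- (1 / 4))) = - 4 * u * (u / x) powr (1 / 4)) (nhds x)"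
      by (rule eventually_mono[OF eventually_nhds_in_open[OF open_greaterThan[of 0], of x]]) (use x0 in \<open>simp_all add: eq\<close>)
    show "((\<lambda>x. - 4 * u * (u / x) powr (1 / 4)) has_real_derivative (u / x) powr (5 / 4)) (at x)"
      by (rule iffD1[OF DERIV_cong_ev[OF refl Ev V] D])
  next
    have "((\<lambda>x. u / x) \<longlongrightarrow> 0) at_top"
      by (intro tendsto_divide_0[OF tendsto_const] filterlim_at_top_imp_at_infinity filterlim_ident)
    then have "((\<lambda>x. (u / x) powr (1 / 4)) \<longlongrightarrow> 0 powr (1 / 4)) at_top"
      using u by (intro tendsto_powr2 tendsto_const eventually_mono[OF eventually_gt_at_top[of 0]]) auto
    then show "((\<lambda>x. - 4 * u * (u / x) powr (1 / 4)) \<longlongrightarrow> 0) at_top"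
      using tendsto_mult_left[of _ 0 at_top "- 4 * u"] by simp
  qed auto
  also have "0 - (- 4 * u * (u / u) powr (1 / 4)) = 4 * u" using u by simp
  also have "2 * (ennreal (sqrt \<rho>) * (ennreal u + ennreal (4 * u))) = ennreal (2 * (sqrt \<rho> * (u + 4 * u)))"
    using u \<rho> sq by (simp only: ennreal_mult ennreal_plus mult_nonneg_nonneg add_nonneg_nonneg zero_le_numeral
        real_sqrt_ge_zero order_less_imp_le ennreal_numeral zero_le_one order_trans[OF zero_le_one])
  also have "2 * (sqrt \<rho> * (u + 4 * u)) = 20 * b / (real r)\<^sup>2 * sqrt (r / q)"
    by (simp add: u_def \<rho>_def)
  finally show ?thesis by (simp add: mult_left_mono)
qed

lemma star_mass_scale:
  assumes r: "0 < (r::real)"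
  shows "(\<integral>\<^sup>+w. \<integral>\<^sup>+v. star_ind \<delta> c (r * w) (r * v) \<partial>lborel \<partial>lborel) = ennreal (1 / r\<^sup>2) * star_mass \<delta> c"
proof -
  have scale: "(\<integral>\<^sup>+v. f (r * v) \<partial>lborel) = ennreal (1 / r) * (\<integral>\<^sup>+v. f v \<partial>lborel)"
    if [measurable]: "f \<in> borel_measurable borel" for f :: "real \<Rightarrow> ennreal"
  proof -
    have "(\<integral>\<^sup>+v. f v \<partial>lborel) = ennreal r * (\<integral>\<^sup>+v. f (r * v) \<partial>lborel)"
      using nn_integral_real_affine[of f r 0] r by simp
    then have "ennreal (1 / r) * (\<integral>\<^sup>+v. f v \<partial>lborel) = (ennreal (1 / r) * ennreal r) * (\<integral>\<^sup>+v. f (r * v) \<partial>lborel)"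
      by (simp add: mult.assoc)
    also have "ennreal (1 / r) * ennreal r = 1"
      using r by (subst ennreal_mult[symmetric]) auto
    finally show ?thesis by simp
  qed
  have "(\<integral>\<^sup>+w. \<integral>\<^sup>+v. star_ind \<delta> c (r * w) (r * v) \<partial>lborel \<partial>lborel)
     = (\<integral>\<^sup>+w. ennreal (1 / r) * slice \<delta> c (r * w) \<partial>lborel)"
    unfolding slice_def by (intro nn_integral_cong scale) measurable
  also have "\<dots> = ennreal (1 / r) * (ennreal (1 / r) * star_mass \<delta> c)"
    by (simp add: nn_integral_cmult scale star_mass_slice)
  also have "\<dots> = ennreal (1 / r\<^sup>2) * star_mass \<delta> c"
    using r by (simp add: mult.assoc[symmetric] ennreal_mult[symmetric] power2_eq_square)
  finally show ?thesis .
qed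

lemma nn_integral_star_ind_dist_int:
  fixes q :: nat
  assumes q: "q > 0" and c: "0 \<le> c" "c \<le> 1 / 2" and \<delta>: "0 \<le> \<delta>"
  shows "(\<integral>\<^sup>+y. star_ind \<delta> c t (dist_int (real q * y)) * indicator {0..<1} y \<partial>lborel) = slice \<delta> c t"
proof (cases "\<bar>t\<bar> \<le> c")
  case False
  then show ?thesis by (simp add: slice_def star_ind_eq_0)
next
  case True
  obtain \<alpha> where \<alpha>: "0 \<le> \<alpha>" "\<alpha> \<le> c" "\<And>s. star_ind \<delta> c t s = indicator {-\<alpha>..\<alpha>} s"
    using star_ind_slice[of \<delta> c t] \<delta> c True by metis
  have ind: "indicator {-\<alpha>..\<alpha>} (dist_int (real q * y)) = (indicator {y. dist_int (real q * y) \<le> \<alpha>} y :: ennreal)" for y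
    using dist_int_nonneg[of "real q * y"] \<alpha>(1) by (auto simp: indicator_def)
  show ?thesis
    unfolding slice_def \<alpha>(3) ind nn_integral_symmetric_interval[OF \<alpha>(1)]
    using \<alpha> c by (intro emeasure_dist_int_le_unit q) auto
qed

text \<open>A single q produces no error: for \<alpha> \<le> 1/2 the distance of q x to the integers
  is at most \<alpha> with probability exactly 2 \<alpha>, the length of the corresponding
  slice.\<close>

lemma nn_integral_hit:
  fixes q :: nat
  assumes q: "q > 0" and c: "0 \<le> c" "c \<le> 1 / 2" and \<delta>: "0 \<le> \<delta>"
  shows "(\<integral>\<^sup>+x. (\<integral>\<^sup>+y. hit \<delta> c q x y * indicator {0..<1} y \<partial>lborel) * indicator {0..<1} x \<partial>lborel) = star_mass \<delta> c"
proof -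
  let ?U = "indicator {0..<1} :: real \<Rightarrow> ennreal"
  have "(\<integral>\<^sup>+x. (\<integral>\<^sup>+y. hit \<delta> c q x y * ?U y \<partial>lborel) * ?U x \<partial>lborel)
    = (\<integral>\<^sup>+x. \<integral>\<^sup>+s. star_ind \<delta> c (dist_int (real q * x)) s * ?U x \<partial>lborel \<partial>lborel)"
    unfolding hit_def nn_integral_star_ind_dist_int[OF assms] slice_def by (simp add: nn_integral_multc)
  also have "\<dots> = (\<integral>\<^sup>+s. \<integral>\<^sup>+x. star_ind \<delta> c (dist_int (real q * x)) s * ?U x \<partial>lborel \<partial>lborel)"
    by (intro nn_integral_swap_lborel) measurable
  also have "\<dots> = (\<integral>\<^sup>+s. \<integral>\<^sup>+x. star_ind \<delta> c s (dist_int (real q * x)) * ?U x \<partial>lborel \<partial>lborel)"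
    by (simp only: star_ind_commute[of _ _ "dist_int _"])
  also have "\<dots> = star_mass \<delta> c"
    unfolding nn_integral_star_ind_dist_int[OF assms] star_mass_slice ..
  finally show ?thesis .
qed

section \<open>Gcd sums over dyadic blocks\<close>

lemma sum_inverse_sqrt_le: "(\<Sum>k=1..n. 1 / sqrt (real k)) \<le> 2 * sqrt (real n)"
proof (induction n)
  case (Suc n)
  have s: "sqrt (real n) * sqrt (real n) = real n" "sqrt (real (Suc n)) * sqrt (real (Suc n)) = real n + 1"
    by auto
  have "2 * (sqrt (real n) * sqrt (real (Suc n))) \<le> sqrt (real n) * sqrt (real n) + sqrt (real (Suc n)) * sqrt (real (Suc n))"
    using zero_le_power2[of "sqrt (real n) - sqrt (real (Suc n))"] by (simp add: power2_eq_square algebra_simps)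
  then have "2 * sqrt (real n) * sqrt (real (Suc n)) + 1 \<le> 2 * sqrt (real (Suc n)) * sqrt (real (Suc n))"
    using s by linarith
  then have "(2 * sqrt (real n) + 1 / sqrt (real (Suc n))) * sqrt (real (Suc n)) \<le> 2 * sqrt (real (Suc n)) * sqrt (real (Suc n))"
    by (simp add: distrib_right)
  then have "2 * sqrt (real n) + 1 / sqrt (real (Suc n)) \<le> 2 * sqrt (real (Suc n))"
    by (rule mult_right_le_imp_le) simp
  then show ?case using Suc by simp
qed simp

lemma sum_inverse_le_dyadic: "(\<Sum>k=1..2 ^ n. 1 / real k) \<le> real n + 1"
proof (induction n)
  case (Suc n)
  have "{1..2 ^ Suc n} = {1..2 ^ n} \<union> {2 ^ n + 1..2 ^ Suc n :: nat}" by auto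
  then have "(\<Sum>k=1..2 ^ Suc n. 1 / real k) = (\<Sum>k=1..2 ^ n. 1 / real k) + (\<Sum>k=2 ^ n + 1..2 ^ Suc n. 1 / real k)"
    by (simp add: sum.union_disjoint)
  also have "(\<Sum>k=2 ^ n + 1..2 ^ Suc n. 1 / real k) \<le> (\<Sum>k=2 ^ n + 1..2 ^ Suc n::nat. 1 / 2 ^ n)"
  proof (rule sum_mono)
    fix k :: nat assume "k \<in> {2 ^ n + 1..2 ^ Suc n}"
    then have "2 ^ n \<le> k" by simp
    then have "(2::real) ^ n \<le> real k" by (metis of_nat_le_iff of_nat_numeral of_nat_power)
    moreover from this have "0 < real k" by (rule less_le_trans[rotated]) simp
    ultimately show "1 / real k \<le> 1 / 2 ^ n" by (intro divide_left_mono) auto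
  qed
  also have "\<dots> = 1" by simp
  finally show ?case using Suc by simp
qed simp

lemma multiples_eq_image:
  fixes d n :: nat
  assumes "0 < d"
  shows "{q \<in> {1..n}. d dvd q} = (\<lambda>k. d * k) ` {1..n div d}"
proof (intro set_eqI iffI)
  fix q assume "q \<in> {q \<in> {1..n}. d dvd q}"
  then obtain k where k: "q = d * k" "1 \<le> q" "q \<le> n" by auto
  then have "1 \<le> k" "k \<le> n div d" using assms by (auto simp: less_eq_div_iff_mult_less_eq mult.commute Suc_le_eq)
  then show "q \<in> (\<lambda>k. d * k) ` {1..n div d}" using k by auto
next
  fix q assume "q \<in> (\<lambda>k. d * k) ` {1..n div d}"
  then show "q \<in> {q \<in> {1..n}. d dvd q}"
    using assms by (auto simp: less_eq_div_iff_mult_less_eq mult.commute Suc_le_eq)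
qed

lemma card_multiples_le:
  fixes d n :: nat
  assumes "0 < d"
  shows "real (card {q \<in> {1..n}. d dvd q}) \<le> real n / real d"
proof -
  have "card {q \<in> {1..n}. d dvd q} = n div d"
    unfolding multiples_eq_image[OF assms] using assms by (subst card_image) (auto simp: inj_on_def)
  then show ?thesis by (simp add: of_nat_div_le_of_nat)
qed

lemma sum_multiples_sqrt_le:
  fixes d r :: nat
  assumes d: "0 < d"
  shows "(\<Sum>q\<in>{q \<in> {1..r}. d dvd q}. sqrt (real r / real q)) \<le> 2 * real r / real d"
proof -
  have "(\<Sum>q\<in>{q \<in> {1..r}. d dvd q}. sqrt (real r / real q)) = (\<Sum>k=1..r div d. sqrt (real r / real (d * k)))"
    unfolding multiples_eq_image[OF d] using d by (subst sum.reindex) (auto simp: inj_on_def)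
  also have "\<dots> = sqrt (real r / real d) * (\<Sum>k=1..r div d. 1 / sqrt (real k))"
    by (simp add: sum_distrib_left real_sqrt_divide real_sqrt_mult)
  also have "\<dots> \<le> sqrt (real r / real d) * (2 * sqrt (real (r div d)))"
    by (intro mult_left_mono sum_inverse_sqrt_le) auto
  also have "\<dots> \<le> sqrt (real r / real d) * (2 * sqrt (real r / real d))"
    by (intro mult_left_mono real_sqrt_le_mono of_nat_div_le_of_nat) auto
  also have "\<dots> = 2 * (sqrt (real r / real d) * sqrt (real r / real d))" by (simp only: mult.left_commute)
  also have "\<dots> = 2 * real r / real d" by (subst real_sqrt_mult_self) simp
  finally show ?thesis .
qed

text \<open>The gcd is one of the common divisors, so its power is at most the sum of d^p over all
  common divisors d. Summing over d last lets q and r run freely over multiples of d.\<close>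

lemma sum_gcd_le:
  fixes h :: "nat \<Rightarrow> nat \<Rightarrow> real" and p N :: nat
  assumes R: "R \<subseteq> {1..N}" and h: "\<And>q r. 0 \<le> h q r"
  shows "(\<Sum>r\<in>R. \<Sum>q=1..r. real (gcd q r) ^ p * h q r)
     \<le> (\<Sum>d=1..N. real d ^ p * (\<Sum>r\<in>{r\<in>R. d dvd r}. \<Sum>q\<in>{q\<in>{1..r}. d dvd q}. h q r))"
proof -
  have fin: "finite R" using R finite_subset by blast
  have "real (gcd q r) ^ p * h q r \<le> (\<Sum>d=1..N. if d dvd q \<and> d dvd r then real d ^ p * h q r else 0)"
    if "r \<in> R" "q \<in> {1..r}" for q r
  proof -
    have "gcd q r \<in> {1..N}"
    proof -
      have "gcd q r \<le> r" using that by (intro gcd_le2_nat) auto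
      moreover have "r \<le> N" using that R by auto
      moreover have "gcd q r \<noteq> 0" using that by auto
      ultimately show ?thesis unfolding atLeastAtMost_iff by linarith
    qed
    then have "(if gcd q r dvd q \<and> gcd q r dvd r then real (gcd q r) ^ p * h q r else 0)
      \<le> (\<Sum>d=1..N. if d dvd q \<and> d dvd r then real d ^ p * h q r else 0)"
      by (intro member_le_sum) (auto simp: h)
    then show ?thesis by simp
  qed
  then have "(\<Sum>r\<in>R. \<Sum>q=1..r. real (gcd q r) ^ p * h q r)
    \<le> (\<Sum>r\<in>R. \<Sum>q=1..r. \<Sum>d=1..N. if d dvd q \<and> d dvd r then real d ^ p * h q r else 0)"
    by (intro sum_mono) auto
  also have "\<dots> = (\<Sum>r\<in>R. \<Sum>d=1..N. \<Sum>q=1..r. if d dvd q \<and> d dvd r then real d ^ p * h q r else 0)"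
    by (intro sum.cong refl sum.swap)
  also have "\<dots> = (\<Sum>d=1..N. \<Sum>r\<in>R. \<Sum>q=1..r. if d dvd q \<and> d dvd r then real d ^ p * h q r else 0)"
    by (rule sum.swap)
  also have "\<dots> = (\<Sum>d=1..N. real d ^ p * (\<Sum>r\<in>{r\<in>R. d dvd r}. \<Sum>q\<in>{q\<in>{1..r}. d dvd q}. h q r))"
  proof (intro sum.cong refl)
    fix d
    have "(\<Sum>q=1..r. if d dvd q \<and> d dvd r then real d ^ p * h q r else 0)
      = (if d dvd r then real d ^ p * (\<Sum>q\<in>{q\<in>{1..r}. d dvd q}. h q r) else 0)" for r
      unfolding sum_distrib_left
      by (subst sum.inter_filter) (auto intro!: sum.cong)
    then show "(\<Sum>r\<in>R. \<Sum>q=1..r. if d dvd q \<and> d dvd r then real d ^ p * h q r else 0)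
      = real d ^ p * (\<Sum>r\<in>{r\<in>R. d dvd r}. \<Sum>q\<in>{q\<in>{1..r}. d dvd q}. h q r)"
      unfolding sum_distrib_left[of _ _ "{r\<in>R. d dvd r}"]
      using fin by (subst sum.inter_filter) (auto intro!: sum.cong)
  qed
  finally show ?thesis .
qed

lemma dyadic_block_subset: "{2 ^ m..<2 ^ Suc m} \<subseteq> {1..2 ^ Suc m :: nat}"
  by (auto simp: Suc_le_eq intro: less_le_trans[of 0 "2 ^ m"])

lemma dyadic_block_card_multiples_le:
  assumes "0 < d"
  shows "real (card {r\<in>{2 ^ m..<2 ^ Suc m}. d dvd r}) \<le> 2 ^ Suc m / real d"
proof -
  have "card {r\<in>{2 ^ m..<2 ^ Suc m}. d dvd r} \<le> card {r\<in>{1..2 ^ Suc m}. d dvd r}"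
    using dyadic_block_subset[of m] by (intro card_mono) auto
  then show ?thesis using card_multiples_le[OF assms, of "2 ^ Suc m"] by simp
qed

lemma dyadic_block_ge: "r \<in> {2 ^ m..<2 ^ Suc m :: nat} \<Longrightarrow> 2 ^ m \<le> real r"
  by (metis atLeastLessThan_iff of_nat_le_iff of_nat_numeral of_nat_power)

text \<open>For fixed d the sum over q is at most 2 / (d 2^m) and at most 2^(m+1) / d values r
  occur, so with the factor d each divisor contributes 4 / d. The harmonic sum over d is the only
  source of m.\<close>

lemma sum_gcd_sqrt_le:
  "(\<Sum>r=2 ^ m..<2 ^ Suc m. \<Sum>q=1..r. real (gcd q r) * (sqrt (real r / real q) / (real r)\<^sup>2)) \<le> 4 * (real m + 2)"
proof -
  let ?R = "{2 ^ m..<2 ^ Suc m :: nat}"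
  have "(\<Sum>r\<in>?R. \<Sum>q=1..r. real (gcd q r) ^ 1 * (sqrt (real r / real q) / (real r)\<^sup>2))
     \<le> (\<Sum>d=1..2 ^ Suc m. real d ^ 1 * (\<Sum>r\<in>{r\<in>?R. d dvd r}. \<Sum>q\<in>{q\<in>{1..r}. d dvd q}. sqrt (real r / real q) / (real r)\<^sup>2))"
    by (intro sum_gcd_le dyadic_block_subset) auto
  also have "\<dots> \<le> (\<Sum>d=1..2 ^ Suc m. 4 * (1 / real d))"
  proof (intro sum_mono)
    fix d :: nat assume "d \<in> {1..2 ^ Suc m}"
    then have d: "0 < d" by simp
    have "(\<Sum>q\<in>{q\<in>{1..r}. d dvd q}. sqrt (real r / real q) / (real r)\<^sup>2) \<le> 2 / (d * 2 ^ m)" if "r \<in> ?R" for r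
    proof -
      have r: "2 ^ m \<le> real r" using dyadic_block_ge[OF that] .
      then have r0: "0 < real r" by (rule less_le_trans[rotated]) simp
      have "(\<Sum>q\<in>{q\<in>{1..r}. d dvd q}. sqrt (real r / real q) / (real r)\<^sup>2) \<le> (2 * real r / real d) / (real r)\<^sup>2"
        unfolding sum_divide_distrib[symmetric] by (intro divide_right_mono sum_multiples_sqrt_le d) auto
      also have "\<dots> = 2 / (d * real r)" using r0 by (simp add: power2_eq_square)
      also have "\<dots> \<le> 2 / (d * 2 ^ m)" using r r0 d by (intro divide_left_mono mult_left_mono) auto
      finally show ?thesis .
    qed
    then have "(\<Sum>r\<in>{r\<in>?R. d dvd r}. \<Sum>q\<in>{q\<in>{1..r}. d dvd q}. sqrt (real r / real q) / (real r)\<^sup>2)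
       \<le> real (card {r\<in>?R. d dvd r}) * (2 / (d * 2 ^ m))"
      by (intro sum_bounded_above) auto
    also have "\<dots> \<le> (2 ^ Suc m / d) * (2 / (d * 2 ^ m))"
      by (intro mult_right_mono dyadic_block_card_multiples_le d) auto
    finally have "real d ^ 1 * (\<Sum>r\<in>{r\<in>?R. d dvd r}. \<Sum>q\<in>{q\<in>{1..r}. d dvd q}. sqrt (real r / real q) / (real r)\<^sup>2)
       \<le> real d * ((2 ^ Suc m / d) * (2 / (d * 2 ^ m)))"
      unfolding power_one_right by (rule mult_left_mono) simp
    also have "\<dots> = 4 * (1 / real d)" using d by simp
    finally show "real d ^ 1 * (\<Sum>r\<in>{r\<in>?R. d dvd r}. \<Sum>q\<in>{q\<in>{1..r}. d dvd q}. sqrt (real r / real q) / (real r)\<^sup>2)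
       \<le> 4 * (1 / real d)" .
  qed
  also have "\<dots> \<le> 4 * (real (Suc m) + 1)"
    unfolding sum_distrib_left[symmetric] by (intro mult_left_mono sum_inverse_le_dyadic) auto
  finally show ?thesis by simp
qed

text \<open>Each d contributes d^2 times 2^(m+1) / d times 1 / (d 4^m), that is 2 / 2^m, and there
  are 2^(m+1) of them. That this stays bounded pays for the logarithm \<Lambda> multiplying it in
  \<open>pair_err\<close>.\<close>

lemma sum_gcd_square_le:
  "(\<Sum>r=2 ^ m..<2 ^ Suc m. \<Sum>q=1..r. (real (gcd q r))\<^sup>2 * (1 / real r ^ 3)) \<le> 4"
proof -
  let ?R = "{2 ^ m..<2 ^ Suc m :: nat}"
  have "(\<Sum>r\<in>?R. \<Sum>q=1..r. (real (gcd q r))\<^sup>2 * (1 / real r ^ 3))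
     \<le> (\<Sum>d=1..2 ^ Suc m. (real d)\<^sup>2 * (\<Sum>r\<in>{r\<in>?R. d dvd r}. \<Sum>q\<in>{q\<in>{1..r}. d dvd q}. 1 / real r ^ 3))"
    by (intro sum_gcd_le dyadic_block_subset) auto
  also have "\<dots> \<le> (\<Sum>d=1..2 ^ Suc m::nat. 2 / 2 ^ m)"
  proof (intro sum_mono)
    fix d :: nat assume "d \<in> {1..2 ^ Suc m}"
    then have d: "0 < d" by simp
    have "(\<Sum>q\<in>{q\<in>{1..r}. d dvd q}. 1 / real r ^ 3) \<le> 1 / (d * (2 ^ m)\<^sup>2)" if "r \<in> ?R" for r
    proof -
      have r: "2 ^ m \<le> real r" using dyadic_block_ge[OF that] .
      then have r0: "0 < real r" by (rule less_le_trans[rotated]) simp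
      have "(\<Sum>q\<in>{q\<in>{1..r}. d dvd q}. 1 / real r ^ 3) = real (card {q\<in>{1..r}. d dvd q}) * (1 / real r ^ 3)" by simp
      also have "\<dots> \<le> (real r / d) * (1 / real r ^ 3)"
        by (intro mult_right_mono card_multiples_le d) auto
      also have "\<dots> = 1 / (d * (real r)\<^sup>2)" using r0 by (simp add: power2_eq_square power3_eq_cube)
      also have "\<dots> \<le> 1 / (d * (2 ^ m)\<^sup>2)"
        using r r0 d by (intro divide_left_mono mult_left_mono power_mono) auto
      finally show ?thesis .
    qed
    then have "(\<Sum>r\<in>{r\<in>?R. d dvd r}. \<Sum>q\<in>{q\<in>{1..r}. d dvd q}. 1 / real r ^ 3)
       \<le> real (card {r\<in>?R. d dvd r}) * (1 / (d * (2 ^ m)\<^sup>2))"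
      by (intro sum_bounded_above) auto
    also have "\<dots> \<le> (2 ^ Suc m / d) * (1 / (d * (2 ^ m)\<^sup>2))"
      by (intro mult_right_mono dyadic_block_card_multiples_le d) auto
    finally have "(real d)\<^sup>2 * (\<Sum>r\<in>{r\<in>?R. d dvd r}. \<Sum>q\<in>{q\<in>{1..r}. d dvd q}. 1 / real r ^ 3)
       \<le> (real d)\<^sup>2 * ((2 ^ Suc m / d) * (1 / (d * (2 ^ m)\<^sup>2)))" by (intro mult_left_mono) auto
    also have "\<dots> = 2 / 2 ^ m" using d by (simp add: power2_eq_square)
    finally show "(real d)\<^sup>2 * (\<Sum>r\<in>{r\<in>?R. d dvd r}. \<Sum>q\<in>{q\<in>{1..r}. d dvd q}. 1 / real r ^ 3)
       \<le> 2 / 2 ^ m" .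
  qed
  also have "\<dots> = 4" by simp
  finally show ?thesis .
qed

section \<open>The variance over dyadic ranges\<close>

definition is_hit :: "real \<Rightarrow> real \<Rightarrow> real \<times> real \<Rightarrow> nat \<Rightarrow> real"
  where "is_hit b c z q = of_bool (dist_int (real q * fst z) \<le> c \<and> dist_int (real q * snd z) \<le> c \<and>
     real q * dist_int (real q * fst z) * dist_int (real q * snd z) \<le> b)"

text \<open>The conversion to a real is faithful for 0 \<le> c \<le> 1/2, where the mass is at most
  1; see \<open>star_mass_eq_mu\<close>.\<close>

definition mu :: "real \<Rightarrow> real \<Rightarrow> nat \<Rightarrow> real"
  where "mu b c q = enn2real (star_mass (b / real q) c)"

definition dev :: "real \<Rightarrow> real \<Rightarrow> nat set \<Rightarrow> real \<times> real \<Rightarrow> real"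
  where "dev b c I z = (\<Sum>q\<in>I. is_hit b c z q - mu b c q)"

lemma is_hit_nonneg: "0 \<le> is_hit b c z q"
  by (simp add: is_hit_def)

lemma mu_nonneg: "0 \<le> mu b c q"
  by (simp add: mu_def)

lemma is_hit_measurable [measurable]: "(\<lambda>z. is_hit b c z q) \<in> borel_measurable borel"
proof -
  have "(\<lambda>z. is_hit b c z q) \<in> borel_measurable (borel \<Otimes>\<^sub>M borel)"
    unfolding is_hit_def by measurable
  then show ?thesis by (simp add: borel_prod)
qed

lemma dev_measurable [measurable]: "(\<lambda>z. dev b c I z) \<in> borel_measurable borel"
  unfolding dev_def by measurable

lemma hit_eq_is_hit:
  assumes "0 < q"
  shows "hit (b / real q) c q (fst z) (snd z) = ennreal (is_hit b c z q)"
proof -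
  have "\<bar>dist_int u * dist_int v\<bar> \<le> b / real q \<longleftrightarrow> real q * dist_int u * dist_int v \<le> b" for u v
    using assms by (simp add: abs_mult dist_int_nonneg field_simps)
  then show ?thesis
    by (simp add: hit_def star_ind_def star_reg_def is_hit_def indicator_def dist_int_nonneg)
qed

lemma star_mass_eq_mu:
  assumes "0 \<le> c" "c \<le> 1 / 2"
  shows "star_mass (b / real q) c = ennreal (mu b c q)"
proof -
  have "star_mass (b / real q) c < top"
    using star_mass_le_1[OF assms] by (rule le_less_trans) simp
  then show ?thesis by (simp add: mu_def)
qed

abbreviation unit_square :: "(real \<times> real) set"
  where "unit_square \<equiv> {0..<1} \<times> {0..<1}"

lemma sets_unit_square [measurable]: "unit_square \<in> sets borel"
  by (simp add: borel_prod[symmetric])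

lemma nn_integral_unit_square:
  assumes [measurable]: "f \<in> borel_measurable (borel :: (real \<times> real) measure)"
  shows "(\<integral>\<^sup>+z. f z * indicator unit_square z \<partial>lborel) =
    (\<integral>\<^sup>+x. (\<integral>\<^sup>+y. f (x, y) * indicator {0..<1} y \<partial>lborel) * indicator {0..<1} x \<partial>lborel)"
proof -
  have [measurable]: "f \<in> borel_measurable (lborel \<Otimes>\<^sub>M lborel)" by (simp add: lborel_prod)
  have "(\<integral>\<^sup>+z. f z * indicator unit_square z \<partial>lborel) = (\<integral>\<^sup>+z. f z * indicator unit_square z \<partial>(lborel \<Otimes>\<^sub>M lborel))"
    by (simp add: lborel_prod)
  also have "\<dots> = (\<integral>\<^sup>+x. \<integral>\<^sup>+y. f (x, y) * indicator unit_square (x, y) \<partial>lborel \<partial>lborel)"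
    by (intro lborel.nn_integral_fst[symmetric]) measurable
  also have "\<dots> = (\<integral>\<^sup>+x. \<integral>\<^sup>+y. f (x, y) * indicator {0..<1} y * indicator {0..<1} x \<partial>lborel \<partial>lborel)"
    by (intro nn_integral_cong) (auto simp: indicator_def)
  also have "\<dots> = (\<integral>\<^sup>+x. (\<integral>\<^sup>+y. f (x, y) * indicator {0..<1} y \<partial>lborel) * indicator {0..<1} x \<partial>lborel)"
    by (intro nn_integral_cong nn_integral_multc) measurable
  finally show ?thesis .
qed

lemma nn_integral_is_hit:
  assumes "0 < q" "0 \<le> c" "c \<le> 1 / 2" "0 \<le> b"
  shows "(\<integral>\<^sup>+z. ennreal (is_hit b c z q) * indicator unit_square z \<partial>lborel) = ennreal (mu b c q)"
proof -
  have "(\<integral>\<^sup>+z. ennreal (is_hit b c z q) * indicator unit_square z \<partial>lborel) =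
     (\<integral>\<^sup>+x. (\<integral>\<^sup>+y. hit (b / real q) c q x y * indicator {0..<1} y \<partial>lborel) * indicator {0..<1} x \<partial>lborel)"
    using hit_eq_is_hit[OF assms(1), of b c "(_, _)"] by (subst nn_integral_unit_square) simp_all
  also have "\<dots> = ennreal (mu b c q)"
    using assms by (subst nn_integral_hit) (auto simp: star_mass_eq_mu)
  finally show ?thesis .
qed

text \<open>The factor 40 is the 2 of the mixed term in \<open>hit_pair_le\<close> times the 20 of
  \<open>coincidence_integral_le\<close>; 4 \<Lambda> comes from \<open>star_mass_le\<close>. The
  grouping matches the two gcd sums above.\<close>

definition pair_err :: "real \<Rightarrow> real \<Rightarrow> nat \<Rightarrow> nat \<Rightarrow> real" where
  "pair_err b \<Lambda> q r = b * (40 * (real (gcd q r) * (sqrt (real r / real q) / (real r)\<^sup>2))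
     + 4 * \<Lambda> * ((real (gcd q r))\<^sup>2 * (1 / real r ^ 3)))"

lemma nn_integral_is_hit_pair_le:
  assumes q: "0 < q" and qr: "q \<le> r" and c: "0 \<le> c" "c \<le> 1 / 2" and b: "0 < b"
    and \<Lambda>: "1 + ln (1 + real r / b) \<le> \<Lambda>"
  shows "(\<integral>\<^sup>+z. ennreal (is_hit b c z q * is_hit b c z r) * indicator unit_square z \<partial>lborel)
    \<le> ennreal (mu b c q * mu b c r + pair_err b \<Lambda> q r)"
proof -
  have r: "0 < r" using q qr by simp
  have "0 \<le> ln (1 + real r / b)" using b by (intro ln_ge_zero) simp
  then have L0: "0 \<le> \<Lambda>" using \<Lambda> by linarith
  let ?g = "of_nat (gcd q r) :: ennreal"
  let ?W = "\<integral>\<^sup>+w. \<integral>\<^sup>+v. star_ind (b / q) c (real q * w) (real q * v) * star_ind (b / r) c (real r * w) (real r * v) \<partial>lborel \<partial>lborel"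
  have "(\<integral>\<^sup>+z. ennreal (is_hit b c z q * is_hit b c z r) * indicator unit_square z \<partial>lborel) =
     (\<integral>\<^sup>+x. (\<integral>\<^sup>+y. hit (b / real q) c q x y * hit (b / real r) c r x y * indicator {0..<1} y \<partial>lborel) * indicator {0..<1} x \<partial>lborel)"
    using hit_eq_is_hit[OF q, of b c "(_, _)"] hit_eq_is_hit[OF r, of b c "(_, _)"]
    by (subst nn_integral_unit_square) (simp_all add: ennreal_mult is_hit_nonneg)
  also have "\<dots> \<le> star_mass (b / q) c * star_mass (b / r) c
      + 2 * ?g * (\<integral>\<^sup>+w. (\<integral>\<^sup>+s. star_ind (b / q) c s (real q * w) \<partial>lborel) * (\<integral>\<^sup>+s. star_ind (b / r) c s (real r * w) \<partial>lborel) \<partial>lborel)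
      + ?g * ?g * ?W"
    using b by (intro hit_pair_le q r c) auto
  also have "(\<integral>\<^sup>+w. (\<integral>\<^sup>+s. star_ind (b / q) c s (real q * w) \<partial>lborel) * (\<integral>\<^sup>+s. star_ind (b / r) c s (real r * w) \<partial>lborel) \<partial>lborel)
      = (\<integral>\<^sup>+w. slice (b / q) c (real q * w) * slice (b / r) c (real r * w) \<partial>lborel)"
    unfolding slice_def by (simp only: star_ind_commute[of _ _ _ "real q * _"] star_ind_commute[of _ _ _ "real r * _"])
  also have "star_mass (b / q) c * star_mass (b / r) c + 2 * ?g * (\<integral>\<^sup>+w. slice (b / q) c (real q * w) * slice (b / r) c (real r * w) \<partial>lborel) + ?g * ?g * ?W
    \<le> ennreal (mu b c q) * ennreal (mu b c r) + 2 * ?g * ennreal (20 * b / (real r)\<^sup>2 * sqrt (r / q))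
       + ?g * ?g * ennreal (1 / (real r)\<^sup>2 * (4 * (b / r) * \<Lambda>))"
  proof (intro add_mono mult_left_mono)
    show "star_mass (b / q) c * star_mass (b / r) c \<le> ennreal (mu b c q) * ennreal (mu b c r)"
      using c by (simp add: star_mass_eq_mu)
    show "(\<integral>\<^sup>+w. slice (b / q) c (real q * w) * slice (b / r) c (real r * w) \<partial>lborel) \<le> ennreal (20 * b / (real r)\<^sup>2 * sqrt (r / q))"
      by (intro coincidence_integral_le q qr b c)
    \<comment> \<open>The cross of q is simply dropped. What remains is the cross of r scaled by
      1/r, whose logarithm is affordable because gcd^2 / r^3 sums to O(1) over a block.\<close>
    have "?W \<le> (\<integral>\<^sup>+w. \<integral>\<^sup>+v. 1 * star_ind (b / r) c (real r * w) (real r * v) \<partial>lborel \<partial>lborel)"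
      by (intro nn_integral_mono mult_right_mono star_ind_le_1) simp
    also have "\<dots> = ennreal (1 / (real r)\<^sup>2) * star_mass (b / r) c"
      using r by (simp add: star_mass_scale)
    also have "\<dots> \<le> ennreal (1 / (real r)\<^sup>2) * ennreal (4 * (b / r) * \<Lambda>)"
    proof (intro mult_left_mono)
      have "star_mass (b / r) c \<le> ennreal (4 * (b / r) * (1 + ln (1 + 1 / (b / r))))"
        using b r c by (intro star_mass_le) auto
      also have "\<dots> \<le> ennreal (4 * (b / r) * \<Lambda>)"
        using b \<Lambda> by (intro ennreal_leI mult_left_mono) auto
      finally show "star_mass (b / r) c \<le> ennreal (4 * (b / r) * \<Lambda>)" .
    qed simp
    also have "\<dots> = ennreal (1 / (real r)\<^sup>2 * (4 * (b / r) * \<Lambda>))"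
      using b L0 by (intro ennreal_mult[symmetric]) auto
    finally show "?W \<le> ennreal (1 / (real r)\<^sup>2 * (4 * (b / r) * \<Lambda>))" .
  qed auto
  also have "\<dots> = ennreal (mu b c q * mu b c r + 2 * real (gcd q r) * (20 * b / (real r)\<^sup>2 * sqrt (r / q))
       + real (gcd q r) * real (gcd q r) * (1 / (real r)\<^sup>2 * (4 * (b / r) * \<Lambda>)))"
    using b L0 mu_nonneg
    by (simp only: ennreal_mult[symmetric] ennreal_plus[symmetric] ennreal_of_nat_eq_real_of_nat ennreal_numeral[symmetric]
       mult_nonneg_nonneg add_nonneg_nonneg zero_le_numeral divide_nonneg_nonneg of_nat_0_le_iff real_sqrt_ge_zero zero_le_power2 order_less_imp_le zero_le_one)
  also have "\<dots> = ennreal (mu b c q * mu b c r + pair_err b \<Lambda> q r)"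
    unfolding pair_err_def using r by (intro arg_cong[of _ _ ennreal]) (simp add: field_simps power2_eq_square power3_eq_cube)
  finally show ?thesis .
qed

lemma sum_dyadic_blocks:
  fixes f :: "nat \<Rightarrow> real"
  assumes "m1 \<le> m2"
  shows "(\<Sum>r=2 ^ m1..<2 ^ m2. f r) = (\<Sum>m=m1..<m2. \<Sum>r=2 ^ m..<2 ^ Suc m. f r)"
  using assms
proof (induction m2 rule: dec_induct)
  case (step n)
  have "(\<Sum>r=2 ^ m1..<2 ^ Suc n. f r) = (\<Sum>r=2 ^ m1..<2 ^ n. f r) + (\<Sum>r=2 ^ n..<2 ^ Suc n. f r)"
    using step(1) by (intro sum.atLeastLessThan_concat[symmetric]) (auto intro: power_increasing)
  then show ?case using step by simp
qed simp

lemma sum_pair_err_le: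
  assumes "0 < b" "0 \<le> \<Lambda>"
  shows "(\<Sum>r=2 ^ m..<2 ^ Suc m. \<Sum>q=1..r. pair_err b \<Lambda> q r) \<le> b * (160 * (real m + 2) + 16 * \<Lambda>)"
proof -
  let ?A = "\<lambda>q r. real (gcd q r) * (sqrt (real r / real q) / (real r)\<^sup>2)"
  let ?B = "\<lambda>q r. (real (gcd q r))\<^sup>2 * (1 / real r ^ 3)"
  have "(\<Sum>r=2 ^ m..<2 ^ Suc m. \<Sum>q=1..r. pair_err b \<Lambda> q r)
    = b * (40 * (\<Sum>r=2 ^ m..<2 ^ Suc m. \<Sum>q=1..r. ?A q r) + 4 * \<Lambda> * (\<Sum>r=2 ^ m..<2 ^ Suc m. \<Sum>q=1..r. ?B q r))"
    unfolding pair_err_def sum_distrib_left sum.distrib[symmetric] ..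
  also have "\<dots> \<le> b * (40 * (4 * (real m + 2)) + 4 * \<Lambda> * 4)"
    using assms by (intro mult_left_mono add_mono sum_gcd_sqrt_le sum_gcd_square_le) auto
  finally show ?thesis by (simp add: algebra_simps)
qed

text \<open>The squared means cancel and only pair errors survive. Because the bound is a sum over
  the blocks m, bounds for adjacent ranges add up; the chaining relies on this at every
  level.\<close>

lemma variance_le:
  assumes c: "0 \<le> c" "c \<le> 1 / 2" and b: "0 < b" and m: "m1 \<le> m2"
    and \<Lambda>: "1 + ln (1 + 2 ^ m2 / b) \<le> \<Lambda>"
  shows "(\<integral>\<^sup>+z. ennreal ((dev b c {2 ^ m1..<2 ^ m2} z)\<^sup>2) * indicator unit_square z \<partial>lborel)
    \<le> ennreal (\<Sum>m=m1..<m2. b * (320 * (real m + 2) + 32 * \<Lambda>))"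
proof -
  let ?I = "{2 ^ m1..<2 ^ m2 :: nat}"
  let ?U = "indicator unit_square :: real \<times> real \<Rightarrow> ennreal"
  have "0 \<le> ln (1 + 2 ^ m2 / b)" using b by (intro ln_ge_zero) simp
  then have L0: "0 \<le> \<Lambda>" using \<Lambda> by linarith
  have pos: "0 < q" if "q \<in> ?I" for q
    using that by (auto intro: less_le_trans[of 0 "2 ^ m1"])
  \<comment> \<open>The pair error is attached to ordered pairs, so that adding \<open>e q r\<close>
    and \<open>e r q\<close> covers both orders. The diagonal is charged twice, which only weakens
    the bound; the doubling turns 160 and 16 into 320 and 32.\<close>
  define e where "e q r = (if q \<le> r then pair_err b \<Lambda> q r else 0)" for q r
  have e0: "0 \<le> e q r" for q r
    using b L0 by (simp add: e_def pair_err_def)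
  have Lr: "1 + ln (1 + real r / b) \<le> \<Lambda>" if "r \<in> ?I" for r
  proof -
    have "real r \<le> 2 ^ m2" using that by (metis atLeastLessThan_iff less_imp_le of_nat_le_iff of_nat_numeral of_nat_power)
    then have "1 + real r / b \<le> 1 + 2 ^ m2 / b" using b by (simp add: divide_right_mono)
    moreover have "0 < 1 + real r / b" using b by (simp add: add_pos_nonneg)
    ultimately show ?thesis using \<Lambda> by (smt (verit) ln_le_cancel_iff)
  qed
  have pair: "(\<integral>\<^sup>+z. ennreal (is_hit b c z q * is_hit b c z r) * ?U z \<partial>lborel) \<le> ennreal (mu b c q * mu b c r + e q r + e r q)"
    if "q \<in> ?I" "r \<in> ?I" for q r
  proof (cases "q \<le> r")
    case True
    have "(\<integral>\<^sup>+z. ennreal (is_hit b c z q * is_hit b c z r) * ?U z \<partial>lborel) \<le> ennreal (mu b c q * mu b c r + pair_err b \<Lambda> q r)"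
      using True by (intro nn_integral_is_hit_pair_le pos that c b Lr)
    also have "\<dots> \<le> ennreal (mu b c q * mu b c r + e q r + e r q)"
      using True e0[of r q] by (intro ennreal_leI) (simp add: e_def)
    finally show ?thesis .
  next
    case False
    then have rq: "r \<le> q" by simp
    have "(\<integral>\<^sup>+z. ennreal (is_hit b c z r * is_hit b c z q) * ?U z \<partial>lborel) \<le> ennreal (mu b c r * mu b c q + pair_err b \<Lambda> r q)"
      using rq by (intro nn_integral_is_hit_pair_le pos that c b Lr)
    also have "\<dots> \<le> ennreal (mu b c q * mu b c r + e q r + e r q)"
      using rq e0[of q r] by (intro ennreal_leI) (simp add: e_def mult.commute)
    finally show ?thesis by (simp add: mult.commute)
  qed
  define N where "N z = (\<Sum>q\<in>?I. is_hit b c z q)" for z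
  define M where "M = (\<Sum>q\<in>?I. mu b c q)"
  define V where "V = (\<Sum>m=m1..<m2. b * (320 * (real m + 2) + 32 * \<Lambda>))"
  have [measurable]: "N \<in> borel_measurable borel" unfolding N_def by measurable
  have N0: "0 \<le> N z" for z unfolding N_def by (intro sum_nonneg is_hit_nonneg)
  have M0: "0 \<le> M" unfolding M_def by (intro sum_nonneg mu_nonneg)
  have V0: "0 \<le> V" unfolding V_def using b L0 by (intro sum_nonneg) auto
  have dev: "dev b c ?I z = N z - M" for z
    by (simp add: dev_def N_def M_def sum_subtractf)
  have sum_e: "(\<Sum>r\<in>?I. \<Sum>q\<in>?I. e q r) \<le> V / 2"
  proof -
    have "(\<Sum>r\<in>?I. \<Sum>q\<in>?I. e q r) \<le> (\<Sum>r\<in>?I. \<Sum>q=1..r. pair_err b \<Lambda> q r)"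
    proof (rule sum_mono)
      fix r assume "r \<in> ?I"
      have "(\<Sum>q\<in>?I. e q r) = (\<Sum>q\<in>{q\<in>?I. q \<le> r}. pair_err b \<Lambda> q r)"
        unfolding e_def by (subst sum.inter_filter) auto
      also have "\<dots> \<le> (\<Sum>q=1..r. pair_err b \<Lambda> q r)"
        using pos b L0 by (intro sum_mono2) (auto simp: Suc_le_eq pair_err_def)
      finally show "(\<Sum>q\<in>?I. e q r) \<le> (\<Sum>q=1..r. pair_err b \<Lambda> q r)" .
    qed
    also have "\<dots> = (\<Sum>m=m1..<m2. \<Sum>r=2 ^ m..<2 ^ Suc m. \<Sum>q=1..r. pair_err b \<Lambda> q r)"
      by (rule sum_dyadic_blocks[OF m])
    also have "\<dots> \<le> (\<Sum>m=m1..<m2. b * (160 * (real m + 2) + 16 * \<Lambda>))"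
      by (intro sum_mono sum_pair_err_le b L0)
    also have "\<dots> = V / 2"
      unfolding V_def sum_divide_distrib by (intro sum.cong) (auto simp: algebra_simps)
    finally show ?thesis .
  qed
  have N2: "(\<integral>\<^sup>+z. ennreal ((N z)\<^sup>2) * ?U z \<partial>lborel) \<le> ennreal (M\<^sup>2 + V)"
  proof -
    have "(\<integral>\<^sup>+z. ennreal ((N z)\<^sup>2) * ?U z \<partial>lborel) = (\<integral>\<^sup>+z. (\<Sum>q\<in>?I. \<Sum>r\<in>?I. ennreal (is_hit b c z q * is_hit b c z r) * ?U z) \<partial>lborel)"
      by (intro nn_integral_cong) (simp add: N_def power2_eq_square sum_product sum_ennreal is_hit_nonneg sum_nonneg flip: sum_distrib_right)
    also have "\<dots> = (\<Sum>q\<in>?I. \<Sum>r\<in>?I. \<integral>\<^sup>+z. ennreal (is_hit b c z q * is_hit b c z r) * ?U z \<partial>lborel)"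
      by (subst nn_integral_sum, measurable) (intro sum.cong refl nn_integral_sum, measurable)
    also have "\<dots> \<le> (\<Sum>q\<in>?I. \<Sum>r\<in>?I. ennreal (mu b c q * mu b c r + e q r + e r q))"
      by (intro sum_mono pair)
    also have "\<dots> = ennreal (\<Sum>q\<in>?I. \<Sum>r\<in>?I. mu b c q * mu b c r + e q r + e r q)"
      by (simp add: sum_ennreal e0 mu_nonneg sum_nonneg del: ennreal_plus)
    also have "(\<Sum>q\<in>?I. \<Sum>r\<in>?I. mu b c q * mu b c r + e q r + e r q) =
        M\<^sup>2 + (\<Sum>q\<in>?I. \<Sum>r\<in>?I. e q r) + (\<Sum>q\<in>?I. \<Sum>r\<in>?I. e r q)"
      by (simp add: sum.distrib M_def power2_eq_square sum_product)
    also have "(\<Sum>q\<in>?I. \<Sum>r\<in>?I. e q r) = (\<Sum>r\<in>?I. \<Sum>q\<in>?I. e q r)"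
      by (rule sum.swap)
    finally show ?thesis
      using sum_e by (elim order_trans) (intro ennreal_leI, linarith)
  qed
  have N1: "(\<integral>\<^sup>+z. ennreal (N z) * ?U z \<partial>lborel) = ennreal M"
  proof -
    have "(\<integral>\<^sup>+z. ennreal (N z) * ?U z \<partial>lborel) = (\<integral>\<^sup>+z. (\<Sum>q\<in>?I. ennreal (is_hit b c z q) * ?U z) \<partial>lborel)"
      by (intro nn_integral_cong) (simp add: N_def sum_ennreal is_hit_nonneg flip: sum_distrib_right)
    also have "\<dots> = (\<Sum>q\<in>?I. ennreal (mu b c q))"
      using b c by (subst nn_integral_sum) (auto intro!: sum.cong nn_integral_is_hit pos)
    finally show ?thesis by (simp add: M_def sum_ennreal mu_nonneg)
  qed
  have U1: "(\<integral>\<^sup>+z. ?U z \<partial>lborel) = 1"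
  proof -
    have "(\<integral>\<^sup>+z. 1 * ?U z \<partial>lborel) = (1::ennreal)"
      by (subst nn_integral_unit_square) auto
    then show ?thesis by simp
  qed
  let ?D = "\<integral>\<^sup>+z. ennreal ((dev b c ?I z)\<^sup>2) * ?U z \<partial>lborel"
  \<comment> \<open>Expansion of the square with the cross term moved to the left, since extended
    nonnegative reals do not admit the subtraction. The cross term is finite and is cancelled at the
    end.\<close>
  have "?D + ennreal (2 * M) * (\<integral>\<^sup>+z. ennreal (N z) * ?U z \<partial>lborel)
    = (\<integral>\<^sup>+z. ennreal ((N z)\<^sup>2) * ?U z \<partial>lborel) + ennreal (M\<^sup>2) * (\<integral>\<^sup>+z. ?U z \<partial>lborel)"
  proof -
    have "ennreal ((dev b c ?I z)\<^sup>2) + ennreal (2 * M) * ennreal (N z) = ennreal ((N z)\<^sup>2) + ennreal (M\<^sup>2)" for z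
    proof -
      have "ennreal ((dev b c ?I z)\<^sup>2) + ennreal (2 * M) * ennreal (N z) = ennreal ((dev b c ?I z)\<^sup>2 + 2 * M * N z)"
        using M0 N0[of z] by (simp only: ennreal_mult[symmetric] ennreal_plus[symmetric] zero_le_power2 mult_nonneg_nonneg zero_le_numeral)
      also have "(dev b c ?I z)\<^sup>2 + 2 * M * N z = (N z)\<^sup>2 + M\<^sup>2"
        by (simp add: dev power2_eq_square algebra_simps)
      finally show ?thesis by simp
    qed
    then have "ennreal ((dev b c ?I z)\<^sup>2) * ?U z + ennreal (2 * M) * (ennreal (N z) * ?U z) = ennreal ((N z)\<^sup>2) * ?U z + ennreal (M\<^sup>2) * ?U z" for z
      by (simp only: distrib_right[symmetric] mult.assoc[symmetric])
    then have "(\<integral>\<^sup>+z. ennreal ((dev b c ?I z)\<^sup>2) * ?U z + ennreal (2 * M) * (ennreal (N z) * ?U z) \<partial>lborel)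
       = (\<integral>\<^sup>+z. ennreal ((N z)\<^sup>2) * ?U z + ennreal (M\<^sup>2) * ?U z \<partial>lborel)" by (simp only:)
    then show ?thesis by (simp add: nn_integral_add nn_integral_cmult)
  qed
  also have "\<dots> \<le> ennreal (M\<^sup>2 + V) + ennreal (M\<^sup>2) * 1"
    unfolding U1 by (intro add_mono N2 order.refl)
  also have "\<dots> = ennreal V + ennreal (2 * M) * ennreal M"
    using M0 V0 by (simp add: ennreal_plus[symmetric] ennreal_mult[symmetric] power2_eq_square algebra_simps del: ennreal_plus)
  finally have "?D + ennreal (2 * M) * ennreal M \<le> ennreal V + ennreal (2 * M) * ennreal M"
    unfolding N1 .
  then have "ennreal (2 * M) * ennreal M + ?D \<le> ennreal (2 * M) * ennreal M + ennreal V"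
    unfolding add.commute[of "ennreal (2 * M) * ennreal M"] .
  then have "?D \<le> ennreal V"
    unfolding ennreal_add_left_cancel_le by (auto simp: ennreal_mult_eq_top_iff)
  then show ?thesis unfolding V_def .
qed

section \<open>Chaining and almost everywhere convergence\<close>

text \<open>Deleting the binary digits of n one by one, from the lowest, gives the points
  \<open>p s\<close>; consecutive ones differ by one dyadic interval of length 2^s or coincide.
  Cauchy-Schwarz over these J differences costs the factor J, and each squared difference is bounded
  by the sum over all intervals of its level.\<close>

lemma dyadic_chaining_square_le:
  fixes S :: "nat \<Rightarrow> real"
  assumes S0: "S 0 = 0" and n: "n < 2 ^ J"
  shows "(S n)\<^sup>2 \<le> real J * (\<Sum>s<J. \<Sum>t<2 ^ (J - s). (S ((t + 1) * 2 ^ s) - S (t * 2 ^ s))\<^sup>2)"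
proof -
  define p where "p s = (n div 2 ^ s) * 2 ^ s" for s
  define d where "d s = S (p s) - S (p (Suc s))" for s
  have pJ: "p J = 0" using n by (simp add: p_def)
  have p0: "p 0 = n" by (simp add: p_def)
  have "(\<Sum>s<J. d s) = S (p 0) - S (p J)"
    unfolding d_def by (rule sum_lessThan_telescope')
  then have tel: "S n = (\<Sum>s<J. d s)" by (simp add: pJ p0 S0)
  have d: "(d s)\<^sup>2 \<le> (\<Sum>t<2 ^ (J - s). (S ((t + 1) * 2 ^ s) - S (t * 2 ^ s))\<^sup>2)" if s: "s < J" for s
  proof -
    define k where "k = n div 2 ^ s"
    have k: "k < 2 ^ (J - s)"
      using n s unfolding k_def by (intro less_mult_imp_div_less) (simp add: power_add[symmetric])
    have ps: "p s = k * 2 ^ s" by (simp add: p_def k_def)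
    have pSs: "p (Suc s) = (k div 2) * 2 * 2 ^ s"
      by (simp add: p_def k_def div_mult2_eq[symmetric] mult.commute)
    show ?thesis
    proof (cases "even k")
      case True
      then have "d s = 0" by (simp add: d_def ps pSs)
      then show ?thesis by (simp add: sum_nonneg)
    next
      case False
      then obtain l where l: "k = 2 * l + 1" by (elim oddE)
      have "d s = S ((2 * l + 1) * 2 ^ s) - S ((2 * l) * 2 ^ s)"
        by (simp add: d_def ps pSs l mult.commute)
      then have "(d s)\<^sup>2 = (\<lambda>t. (S ((t + 1) * 2 ^ s) - S (t * 2 ^ s))\<^sup>2) (2 * l)" by simp
      also have "\<dots> \<le> (\<Sum>t<2 ^ (J - s). (S ((t + 1) * 2 ^ s) - S (t * 2 ^ s))\<^sup>2)"
        using k l by (intro member_le_sum) auto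
      finally show ?thesis .
    qed
  qed
  have "(S n)\<^sup>2 \<le> real (card {..<J}) * (\<Sum>s<J. (d s)\<^sup>2)"
    unfolding tel using sum_squared_le_sum_of_squares[of d "{..<J}"] by (simp add: mult.commute)
  also have "\<dots> \<le> real J * (\<Sum>s<J. \<Sum>t<2 ^ (J - s). (S ((t + 1) * 2 ^ s) - S (t * 2 ^ s))\<^sup>2)"
    using d unfolding card_lessThan by (intro mult_left_mono sum_mono) auto
  finally show ?thesis .
qed

text \<open>The majorant of the chaining bound is independent of n, so that one integral controls
  all n < 2^J simultaneously.\<close>

definition chain_sq :: "real \<Rightarrow> real \<Rightarrow> nat \<Rightarrow> real \<times> real \<Rightarrow> real"
  where "chain_sq b c J z = (\<Sum>s<J. \<Sum>t<2 ^ (J - s). (dev b c {2 ^ (t * 2 ^ s)..<2 ^ ((t + 1) * 2 ^ s)} z)\<^sup>2)"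

lemma chain_sq_nonneg: "0 \<le> chain_sq b c J z"
  unfolding chain_sq_def by (intro sum_nonneg) auto

lemma chain_sq_measurable [measurable]: "(\<lambda>z. chain_sq b c J z) \<in> borel_measurable borel"
  unfolding chain_sq_def by measurable

lemma dev_square_le_chain_sq:
  assumes "n < 2 ^ J"
  shows "(dev b c {1..<2 ^ n} z)\<^sup>2 \<le> real J * chain_sq b c J z"
proof -
  define S where "S n = dev b c {1..<2 ^ n} z" for n
  have "S y - S x = dev b c {2 ^ x..<2 ^ y} z" if "x \<le> y" for x y
  proof -
    have "S y = S x + dev b c {2 ^ x..<2 ^ y} z"
      unfolding S_def dev_def using that
      by (intro sum.atLeastLessThan_concat[symmetric]) (auto intro: power_increasing)
    then show ?thesis by simp
  qed
  then have diff: "S ((t + 1) * 2 ^ s) - S (t * 2 ^ s) = dev b c {2 ^ (t * 2 ^ s)..<2 ^ ((t + 1) * 2 ^ s)} z" for t s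
    by simp
  have "S 0 = 0" by (simp add: S_def dev_def)
  from dyadic_chaining_square_le[of S, OF this assms] show ?thesis
    unfolding diff chain_sq_def by (simp add: S_def)
qed

lemma log_ratio_le:
  fixes b :: real
  assumes m: "m \<le> 2 ^ J" and b: "1 / 4 ^ J \<le> b"
  shows "1 + ln (1 + 2 ^ m / b) \<le> 5 * 2 ^ J"
proof -
  have b0: "0 < b" using b by (rule less_le_trans[rotated]) simp
  define L :: real where "L = 2 ^ J"
  have L1: "1 \<le> L" by (simp add: L_def)
  have JL: "real J \<le> L" unfolding L_def using of_nat_less_two_power[of J] by (simp add: less_imp_le)
  have "(2::real) ^ m \<le> 2 ^ (2 ^ J)" using m by (intro power_increasing) auto
  then have "2 ^ m / b \<le> 2 ^ (2 ^ J) / (1 / 4 ^ J)"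
    using b b0 by (intro frac_le) auto
  also have "\<dots> = 2 ^ (2 ^ J + 2 * J)" by (simp add: power_add power_mult)
  finally have "1 + 2 ^ m / b \<le> 2 ^ (2 ^ J + 2 * J) + 2 ^ (2 ^ J + 2 * J)"
    using one_le_power[of "2::real" "2 ^ J + 2 * J"] by linarith
  also have "\<dots> = 2 ^ (2 ^ J + 2 * J + 1)" by simp
  finally have "ln (1 + 2 ^ m / b) \<le> ln (2 ^ (2 ^ J + 2 * J + 1))"
    using b0 by (intro ln_mono) (auto intro: add_pos_nonneg)
  also have "\<dots> = real (2 ^ J + 2 * J + 1) * ln 2" by (rule ln_realpow)
  also have "\<dots> \<le> real (2 ^ J + 2 * J + 1) * 1"
    by (rule mult_left_mono[OF less_imp_le[OF ln_2_less_1] of_nat_0_le_iff])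
  also have "\<dots> = L + 2 * real J + 1" by (simp add: L_def)
  finally show ?thesis using JL L1 unfolding L_def by linarith
qed

text \<open>The ranges of one level tile the blocks below 2^J, so by additivity each of the J levels
  costs no more than the variance bound for the full range.\<close>

lemma chain_sq_integral_le:
  assumes c: "0 \<le> c" "c \<le> 1 / 2" and b: "1 / 4 ^ J \<le> b"
  shows "(\<integral>\<^sup>+z. ennreal (chain_sq b c J z) * indicator unit_square z \<partial>lborel) \<le> ennreal (800 * real J * b * 4 ^ J)"
proof -
  have b0: "0 < b" using b by (rule less_le_trans[rotated]) simp
  define L :: real where "L = 2 ^ J"
  have L1: "1 \<le> L" by (simp add: L_def)
  define \<Lambda> where "\<Lambda> = 5 * L"
  have \<Lambda>: "1 + ln (1 + 2 ^ m / b) \<le> \<Lambda>" if "m \<le> 2 ^ J" for m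
    unfolding \<Lambda>_def L_def using that b by (rule log_ratio_le)
  define v where "v m = b * (320 * (real m + 2) + 32 * \<Lambda>)" for m
  have v0: "0 \<le> v m" for m unfolding v_def \<Lambda>_def using b0 L1 by simp
  have vsum: "(\<Sum>m<2 ^ J. v m) \<le> 800 * b * 4 ^ J"
  proof -
    \<comment> \<open>With L = 2^J, m + 1 \<le> L and 1 \<le> L: 320 (m + 2) + 32 (5 L) \<le> 640 L
      + 160 L.\<close>
    have "v m \<le> b * (800 * L)" if "m < 2 ^ J" for m
    proof -
      have "real m < L" using of_nat_less_iff[of m "2 ^ J", where 'a = real] that by (simp add: L_def)
      moreover have "real m + 1 \<le> L" using of_nat_le_iff[of "Suc m" "2 ^ J", where 'a = real] that by (simp add: L_def)
      ultimately show ?thesis unfolding v_def \<Lambda>_def using b0 L1 by (intro mult_left_mono) auto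
    qed
    then have "(\<Sum>m<2 ^ J. v m) \<le> real (card {..<(2::nat) ^ J}) * (b * (800 * L))"
      by (intro sum_bounded_above) auto
    also have "\<dots> = 800 * b * (L * L)" by (simp add: L_def)
    also have "L * L = 4 ^ J" unfolding L_def by (simp add: power_mult_distrib[symmetric])
    finally show ?thesis .
  qed
  let ?D = "\<lambda>s t z. ennreal ((dev b c {2 ^ (t * 2 ^ s)..<2 ^ ((t + 1) * 2 ^ s)} z)\<^sup>2) * indicator unit_square z"
  have "(\<integral>\<^sup>+z. ennreal (chain_sq b c J z) * indicator unit_square z \<partial>lborel)
    = (\<integral>\<^sup>+z. (\<Sum>s<J. \<Sum>t<2 ^ (J - s). ?D s t z) \<partial>lborel)"
    unfolding sum_distrib_right[symmetric]
    by (intro nn_integral_cong) (simp add: chain_sq_def sum_ennreal sum_nonneg)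
  also have "\<dots> = (\<Sum>s<J. \<Sum>t<2 ^ (J - s). \<integral>\<^sup>+z. ?D s t z \<partial>lborel)"
    by (subst nn_integral_sum, measurable) (intro sum.cong refl nn_integral_sum, measurable)
  also have "\<dots> \<le> (\<Sum>s<J. ennreal (\<Sum>m<2 ^ J. v m))"
  proof (rule sum_mono)
    fix s assume "s \<in> {..<J}"
    then have s: "s < J" by simp
    have "(\<integral>\<^sup>+z. ?D s t z \<partial>lborel) \<le> ennreal (\<Sum>m=t * 2 ^ s..<(t + 1) * 2 ^ s. v m)" if t: "t < 2 ^ (J - s)" for t
      unfolding v_def
    proof (intro variance_le c b0 \<Lambda>)
      have "(t + 1) * 2 ^ s \<le> 2 ^ (J - s) * 2 ^ s" using t by (intro mult_right_mono) auto
      also have "\<dots> = 2 ^ J" using s by (simp add: power_add[symmetric])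
      finally show "(t + 1) * 2 ^ s \<le> 2 ^ J" .
    qed simp
    then have "(\<Sum>t<2 ^ (J - s). \<integral>\<^sup>+z. ?D s t z \<partial>lborel) \<le> (\<Sum>t<2 ^ (J - s). ennreal (\<Sum>m=t * 2 ^ s..<(t + 1) * 2 ^ s. v m))"
      by (intro sum_mono) auto
    also have "\<dots> = ennreal (\<Sum>t<2 ^ (J - s). \<Sum>m=t * 2 ^ s..<(t + 1) * 2 ^ s. v m)"
      by (intro sum_ennreal sum_nonneg v0)
    also have "(\<Sum>t<2 ^ (J - s). \<Sum>m=t * 2 ^ s..<(t + 1) * 2 ^ s. v m) = (\<Sum>m<2 ^ (J - s) * 2 ^ s. v m)"
      using sum.nat_group[of v "2 ^ s" "2 ^ (J - s)"] by (simp add: add.commute)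
    also have "(2::nat) ^ (J - s) * 2 ^ s = 2 ^ J" using s by (simp add: power_add[symmetric])
    finally show "(\<Sum>t<2 ^ (J - s). \<integral>\<^sup>+z. ?D s t z \<partial>lborel) \<le> ennreal (\<Sum>m<2 ^ J. v m)" .
  qed
  also have "\<dots> = ennreal (real J * (\<Sum>m<2 ^ J. v m))"
    by (simp add: ennreal_mult sum_nonneg v0 ennreal_of_nat_eq_real_of_nat)
  also have "\<dots> \<le> ennreal (real J * (800 * b * 4 ^ J))"
    by (intro ennreal_leI mult_left_mono vsum) auto
  finally show ?thesis by (simp add: algebra_simps)
qed

text \<open>
  The grid for \<open>b\<close> at scale \<open>2\<^sup>-\<^sup>l\<close> has mesh \<open>h = (2\<^sup>-\<^sup>l)\<^sup>2\<^sup>/\<^sup>3 (2\<^sup>J)\<^sup>-\<^sup>2\<^sup>/\<^sup>3\<close>: up to powers of \<open>J\<close>, this makes the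
  number of grid values times the variance equal to \<open>(h 4\<^sup>J)\<^sup>2\<close>.
\<close>
definition step :: "nat \<Rightarrow> nat \<Rightarrow> real"
  where "step J l = 2 powr (- (2 / 3) * (real l + real J))"

definition grid_size :: "nat \<Rightarrow> nat \<Rightarrow> nat"
  where "grid_size J l = nat \<lceil>(1 / 2) ^ l / step J l\<rceil>"

lemma step_pos: "0 < step J l"
  by (simp add: step_def)

text \<open>The balance that fixes the mesh, in exact form: after multiplying the number of grid
  values by the normalized variance, precisely this product is left in the denominator in
  \<open>total_sq_integral_le\<close>.\<close>

lemma step_cube: "step J l ^ 3 * 4 ^ J * 4 ^ l = 1"
proof -
  have "step J l ^ 3 * 4 ^ J * 4 ^ l = (2 powr (- (2 / 3) * (real l + real J))) powr 3 * 2 powr (2 * real J) * 2 powr (2 * real l)"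
    by (simp add: step_def powr_numeral powr_powr[symmetric] powr_realpow)
  also have "\<dots> = 2 powr ((- (2 / 3) * (real l + real J)) * 3 + 2 * real J + 2 * real l)"
    by (simp only: powr_powr powr_add)
  also have "(- (2 / 3) * (real l + real J)) * 3 + 2 * real J + 2 * real l = 0" by (simp add: field_simps)
  finally show ?thesis by simp
qed

text \<open>Keeps even the first grid value in the range where \<open>chain_sq_integral_le\<close>
  applies.\<close>

lemma step_ge:
  assumes "l \<le> 2 * J"
  shows "1 / 4 ^ J \<le> step J l"
proof -
  have "(2::real) powr real (2 * J) = 2 ^ (2 * J)" by (rule powr_realpow) simp
  then have "1 / 4 ^ J = 2 powr (- 2 * real J)"
    by (simp add: powr_minus power_mult inverse_eq_divide)
  also have "\<dots> \<le> step J l"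
    unfolding step_def using assms by (intro powr_mono) auto
  finally show ?thesis .
qed

lemma step_le:
  assumes "l \<le> 2 * J"
  shows "step J l \<le> (1 / 2) ^ l"
proof -
  have "step J l \<le> 2 powr (- real l)"
    unfolding step_def using assms by (intro powr_mono) auto
  also have "\<dots> = (1 / 2) ^ l" by (simp add: powr_minus powr_realpow power_one_over inverse_eq_divide)
  finally show ?thesis .
qed

lemma grid_size_le:
  assumes "l \<le> 2 * J"
  shows "real (grid_size J l) * step J l \<le> 2 * (1 / 2) ^ l"
proof -
  have "real (grid_size J l) \<le> (1 / 2) ^ l / step J l + 1"
    unfolding grid_size_def using step_pos[of J l] by (simp add: of_nat_nat)
  then have "real (grid_size J l) * step J l \<le> ((1 / 2) ^ l / step J l + 1) * step J l"
    using step_pos[of J l] by (intro mult_right_mono) auto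
  also have "\<dots> = (1 / 2) ^ l + step J l" using step_pos[of J l] by (simp add: field_simps)
  finally show ?thesis using step_le[OF assms] by simp
qed

text \<open>The index i runs up to J + 1 because the lower comparison rounds c down to the next
  power of 1/2. The constant Z does not depend on the scale J.\<close>

definition good_point :: "real \<Rightarrow> real \<times> real \<Rightarrow> bool" where
  "good_point Z z \<longleftrightarrow> (\<forall>J\<ge>1. \<forall>l\<le>2 * J. \<forall>i\<in>{1..J + 1}. \<forall>k\<in>{1..grid_size J l}. \<forall>n<2 ^ J.
     \<bar>dev (real k * step J l) ((1 / 2) ^ i) {1..<2 ^ n} z\<bar> \<le> Z * real J ^ 3 * (step J l * 4 ^ J))"

text \<open>The weight J^5 absorbs one J from the chaining integral and J^2 from the pairs (l, i),
  leaving the summable 1 / J^2. Together with the J of the chaining inequality it makes the squared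
  deviation of order J^6, whence the J^3 in \<open>good_point\<close>.\<close>

definition total_sq :: "nat \<Rightarrow> real \<times> real \<Rightarrow> real" where
  "total_sq J z = (\<Sum>l\<le>2 * J. \<Sum>i=1..J + 1. \<Sum>k=1..grid_size J l.
     1 / (real J ^ 5 * (step J l * 4 ^ J)\<^sup>2) * chain_sq (real k * step J l) ((1 / 2) ^ i) J z)"

lemma total_sq_measurable [measurable]: "(\<lambda>z. total_sq J z) \<in> borel_measurable borel"
  unfolding total_sq_def by measurable

lemma total_sq_integral_le:
  assumes J: "1 \<le> J"
  shows "(\<integral>\<^sup>+z. ennreal (total_sq J z) * indicator unit_square z \<partial>lborel) \<le> ennreal (20000 / (real J)\<^sup>2)"
proof -
  let ?w = "\<lambda>l. 1 / (real J ^ 5 * (step J l * 4 ^ J)\<^sup>2)"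
  let ?C = "\<lambda>l i k z. ennreal (?w l) * (ennreal (chain_sq (real k * step J l) ((1 / 2) ^ i) J z) * indicator unit_square z)"
  have w0: "0 \<le> ?w l" for l by simp
  have q0: "0 \<le> ?w l * chain_sq (real k * step J l) ((1 / 2) ^ i) J z" for l i k z
    by (intro mult_nonneg_nonneg chain_sq_nonneg w0)
  have inner: "(\<integral>\<^sup>+z. ?C l i k z \<partial>lborel) \<le> ennreal (1600 * (1 / 2) ^ l / (real J ^ 4 * (step J l)\<^sup>2 * 4 ^ J))"
    if l: "l \<le> 2 * J" and i: "i \<in> {1..J + 1}" and k: "k \<in> {1..grid_size J l}" for l i k
  proof -
    have c: "(1 / 2 :: real) ^ i \<le> 1 / 2"
      using i power_decreasing[of 1 i "1 / 2 :: real"] by simp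
    have "step J l \<le> real k * step J l" using k step_pos[of J l] by simp
    then have b: "1 / 4 ^ J \<le> real k * step J l" using step_ge[OF l] by linarith
    have "real k * step J l \<le> real (grid_size J l) * step J l"
      using k step_pos[of J l] by (intro mult_right_mono) auto
    then have kb: "real k * step J l \<le> 2 * (1 / 2) ^ l" using grid_size_le[OF l] by linarith
    have "(\<integral>\<^sup>+z. ?C l i k z \<partial>lborel) = ennreal (?w l) * (\<integral>\<^sup>+z. ennreal (chain_sq (real k * step J l) ((1 / 2) ^ i) J z) * indicator unit_square z \<partial>lborel)"
      by (intro nn_integral_cmult) measurable
    also have "\<dots> \<le> ennreal (?w l) * ennreal (800 * real J * (real k * step J l) * 4 ^ J)"
      by (intro mult_left_mono chain_sq_integral_le b c) auto
    also have "\<dots> = ennreal (?w l * (800 * real J * (real k * step J l) * 4 ^ J))"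
      using step_pos[of J l] by (intro ennreal_mult[symmetric]) auto
    also have "\<dots> \<le> ennreal (?w l * (800 * real J * (2 * (1 / 2) ^ l) * 4 ^ J))"
      by (intro ennreal_leI mult_left_mono mult_right_mono kb) auto
    also have "?w l * (800 * real J * (2 * (1 / 2) ^ l) * 4 ^ J) = 1600 * (1 / 2) ^ l / (real J ^ 4 * (step J l)\<^sup>2 * 4 ^ J)"
      using J step_pos[of J l] by (simp add: field_simps power2_eq_square eval_nat_numeral)
    finally show ?thesis .
  qed
  have mid: "(\<Sum>k=1..grid_size J l. \<integral>\<^sup>+z. ?C l i k z \<partial>lborel) \<le> ennreal (3200 / real J ^ 4)"
    if l: "l \<le> 2 * J" and i: "i \<in> {1..J + 1}" for l i
  proof -
    have "(\<Sum>k=1..grid_size J l. \<integral>\<^sup>+z. ?C l i k z \<partial>lborel)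
       \<le> (\<Sum>k=1..grid_size J l. ennreal (1600 * (1 / 2) ^ l / (real J ^ 4 * (step J l)\<^sup>2 * 4 ^ J)))"
      by (intro sum_mono inner l i)
    also have "\<dots> = ennreal (real (grid_size J l) * (1600 * (1 / 2) ^ l / (real J ^ 4 * (step J l)\<^sup>2 * 4 ^ J)))"
      by (subst ennreal_mult) (auto simp: ennreal_of_nat_eq_real_of_nat)
    also have "\<dots> \<le> ennreal (2 * (1 / 2) ^ l / step J l * (1600 * (1 / 2) ^ l / (real J ^ 4 * (step J l)\<^sup>2 * 4 ^ J)))"
      using grid_size_le[OF l] step_pos[of J l]
      by (intro ennreal_leI mult_right_mono) (auto simp: pos_le_divide_eq)
    also have "2 * (1 / 2) ^ l / step J l * (1600 * (1 / 2) ^ l / (real J ^ 4 * (step J l)\<^sup>2 * 4 ^ J))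
        = 3200 / real J ^ 4 * (1 / (step J l ^ 3 * 4 ^ J * (2 ^ l * 2 ^ l)))"
      using J step_pos[of J l] by (simp add: field_simps power2_eq_square power3_eq_cube power_one_over)
    also have "(2::real) ^ l * 2 ^ l = 4 ^ l" by (simp add: power_mult_distrib[symmetric])
    finally show ?thesis unfolding step_cube by simp
  qed
  have "(\<integral>\<^sup>+z. ennreal (total_sq J z) * indicator unit_square z \<partial>lborel)
    = (\<integral>\<^sup>+z. (\<Sum>l\<le>2 * J. \<Sum>i=1..J + 1. \<Sum>k=1..grid_size J l. ?C l i k z) \<partial>lborel)"
  proof (intro nn_integral_cong)
    fix z
    have "ennreal (total_sq J z) = (\<Sum>l\<le>2 * J. \<Sum>i=1..J + 1. \<Sum>k=1..grid_size J l.
       ennreal (?w l) * ennreal (chain_sq (real k * step J l) ((1 / 2) ^ i) J z))"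
      unfolding total_sq_def
      using q0 by (simp only: ennreal_mult[symmetric, OF w0 chain_sq_nonneg] sum_ennreal sum_nonneg)
    then show "ennreal (total_sq J z) * indicator unit_square z = (\<Sum>l\<le>2 * J. \<Sum>i=1..J + 1. \<Sum>k=1..grid_size J l. ?C l i k z)"
      by (simp only: sum_distrib_right mult.assoc)
  qed
  also have "\<dots> = (\<Sum>l\<le>2 * J. \<Sum>i=1..J + 1. \<Sum>k=1..grid_size J l. \<integral>\<^sup>+z. ?C l i k z \<partial>lborel)"
    by (subst nn_integral_sum, measurable) (intro sum.cong refl, subst nn_integral_sum, measurable, intro sum.cong refl nn_integral_sum, measurable)
  also have "\<dots> \<le> (\<Sum>l\<le>2 * J. \<Sum>i=1..J + 1. ennreal (3200 / real J ^ 4))"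
    by (intro sum_mono mid) auto
  also have "\<dots> = ennreal (\<Sum>l\<le>2 * J. \<Sum>i=1..J + 1. 3200 / real J ^ 4)"
    by (subst sum_ennreal, simp)+ simp
  also have "(\<Sum>l\<le>2 * J. \<Sum>i=1..J + 1. 3200 / real J ^ 4) = real ((2 * J + 1) * (J + 1)) * (3200 / real J ^ 4)"
    by (simp only: sum_constant card_atMost card_atLeastAtMost of_nat_mult mult.assoc) simp
  also have "\<dots> \<le> ennreal (real (6 * J * J) * (3200 / real J ^ 4))"
  proof (intro ennreal_leI mult_right_mono)
    have "(2 * J + 1) * (J + 1) \<le> (3 * J) * (2 * J)" using J by (intro mult_mono) auto
    then show "real ((2 * J + 1) * (J + 1)) \<le> real (6 * J * J)" unfolding of_nat_le_iff by simp
  qed simp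
  also have "real (6 * J * J) * (3200 / real J ^ 4) = 19200 / (real J)\<^sup>2"
    using J by (simp add: power2_eq_square eval_nat_numeral)
  also have "ennreal (19200 / (real J)\<^sup>2) \<le> ennreal (20000 / (real J)\<^sup>2)"
    by (intro ennreal_leI divide_right_mono) auto
  finally show ?thesis .
qed

text \<open>The integrals of \<open>total_sq\<close> are summable over J, so for almost every z the
  whole series is finite. Its value s bounds every \<open>total_sq J z\<close> at once, and Z = sqrt
  s works at all scales. The series starts at \<open>Suc j\<close> because only J \<ge> 1 is
  needed.\<close>

lemma AE_good_point_unit_square: "AE z in lborel. z \<in> unit_square \<longrightarrow> (\<exists>Z\<ge>0. good_point Z z)"
proof -
  let ?f = "\<lambda>j z. ennreal (total_sq (Suc j) z) * indicator unit_square z"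
  have sm: "summable (\<lambda>j. 20000 / (real (Suc j))\<^sup>2)"
    using summable_mult[OF sums_summable[OF inverse_squares_sums], of 20000] by (simp add: add.commute)
  have "(\<integral>\<^sup>+z. (\<Sum>j. ?f j z) \<partial>lborel) = (\<Sum>j. \<integral>\<^sup>+z. ?f j z \<partial>lborel)"
    by (intro nn_integral_suminf) measurable
  also have "\<dots> \<le> (\<Sum>j. ennreal (20000 / (real (Suc j))\<^sup>2))"
    by (intro suminf_le total_sq_integral_le) auto
  also have "\<dots> = ennreal (\<Sum>j. 20000 / (real (Suc j))\<^sup>2)"
    by (intro suminf_ennreal2 sm) auto
  also have "\<dots> < top" by simp
  finally have "(\<integral>\<^sup>+z. (\<Sum>j. ?f j z) \<partial>lborel) \<noteq> \<infinity>" by simp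
  then have "AE z in lborel. (\<Sum>j. ?f j z) \<noteq> \<infinity>"
    by (intro nn_integral_noteq_infinite) measurable
  then show ?thesis
  proof (rule AE_mp, intro AE_I2 impI)
    fix z :: "real \<times> real" assume fin: "(\<Sum>j. ?f j z) \<noteq> \<infinity>" and z: "z \<in> unit_square"
    define s where "s = enn2real (\<Sum>j. ?f j z)"
    have s: "(\<Sum>j. ?f j z) = ennreal s" using fin by (simp add: s_def less_top)
    have s0: "0 \<le> s" by (simp add: s_def)
    have tot: "total_sq J z \<le> s" if J: "1 \<le> J" for J
    proof -
      obtain j where j: "J = Suc j" using J by (cases J) auto
      define F where "F j = ?f j z" for j
      have "F j \<le> suminf F" using sum_le_suminf[of F "{j}"] by simp
      then have "?f j z \<le> (\<Sum>j. ?f j z)" unfolding F_def .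
      then have "ennreal (total_sq J z) \<le> ennreal s" unfolding s using z by (simp add: j)
      then show ?thesis using s0 by simp
    qed
    have "good_point (sqrt s) z"
      unfolding good_point_def
    proof (intro allI impI ballI)
      fix J l i k n assume J: "1 \<le> J" and l: "l \<le> 2 * J" and i: "i \<in> {1..J + 1}"
        and k: "k \<in> {1..grid_size J l}" and n: "n < (2::nat) ^ J"
      let ?E = "step J l * 4 ^ J" and ?Q = "\<lambda>l i k. 1 / (real J ^ 5 * (step J l * 4 ^ J)\<^sup>2) * chain_sq (real k * step J l) ((1 / 2) ^ i) J z"
      have Q0: "0 \<le> ?Q l i k" for l i k by (intro mult_nonneg_nonneg chain_sq_nonneg) auto
      have "?Q l i k \<le> (\<Sum>k=1..grid_size J l. ?Q l i k)"
        using k Q0 by (intro member_le_sum[of k _ "\<lambda>k. ?Q l i k"]) auto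
      also have "\<dots> \<le> (\<Sum>i=1..J + 1. \<Sum>k=1..grid_size J l. ?Q l i k)"
        using i Q0 by (intro member_le_sum[of i _ "\<lambda>i. \<Sum>k=1..grid_size J l. ?Q l i k"] sum_nonneg) auto
      also have "\<dots> \<le> total_sq J z"
        unfolding total_sq_def using l Q0
        by (intro member_le_sum[of l _ "\<lambda>l. \<Sum>i=1..J + 1. \<Sum>k=1..grid_size J l. ?Q l i k"] sum_nonneg) auto
      finally have Qs: "?Q l i k \<le> s" using tot[OF J] by linarith
      have E: "0 < ?E" using step_pos by simp
      have pos: "0 < real J ^ 5 * ?E\<^sup>2" using J step_pos[of J l] by (intro mult_pos_pos zero_less_power) auto
      have Q: "chain_sq (real k * step J l) ((1 / 2) ^ i) J z \<le> s * (real J ^ 5 * ?E\<^sup>2)"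
        using Qs by (intro iffD1[OF pos_divide_le_eq[OF pos]]) (simp only: times_divide_eq_left mult_1)
      have "(dev (real k * step J l) ((1 / 2) ^ i) {1..<2 ^ n} z)\<^sup>2 \<le> real J * chain_sq (real k * step J l) ((1 / 2) ^ i) J z"
        by (rule dev_square_le_chain_sq[OF n])
      also have "\<dots> \<le> real J * (s * (real J ^ 5 * ?E\<^sup>2))"
        using Q by (intro mult_left_mono) auto
      also have "\<dots> = (sqrt s * real J ^ 3 * ?E)\<^sup>2"
        using s0 by (simp add: power_mult_distrib eval_nat_numeral algebra_simps)
      finally have "\<bar>dev (real k * step J l) ((1 / 2) ^ i) {1..<2 ^ n} z\<bar>\<^sup>2 \<le> (sqrt s * real J ^ 3 * ?E)\<^sup>2"
        unfolding power2_abs .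
      moreover have "0 \<le> sqrt s * real J ^ 3 * ?E"
        using step_pos[of J l, THEN less_imp_le] s0 by (intro mult_nonneg_nonneg) auto
      ultimately show "\<bar>dev (real k * step J l) ((1 / 2) ^ i) {1..<2 ^ n} z\<bar> \<le> sqrt s * real J ^ 3 * ?E"
        by (rule power2_le_imp_le)
    qed
    then show "\<exists>Z\<ge>0. good_point Z z" using s0 by (intro exI[of _ "sqrt s"]) auto
  qed
qed

section \<open>Interpolation between grid parameters\<close>

lemma is_hit_mono:
  assumes "b \<le> b'" "c \<le> c'"
  shows "is_hit b c z q \<le> is_hit b' c' z q"
  using assms by (auto simp: is_hit_def of_bool_def)

lemma mu_mono:
  assumes "0 \<le> c" "c \<le> 1 / 2" "b \<le> b'"
  shows "mu b c q \<le> mu b' c q"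
proof -
  have "star_mass (b / q) c \<le> star_mass (b' / q) c"
    using assms by (intro star_mass_mono) (auto intro: divide_right_mono)
  then show ?thesis using assms by (simp add: star_mass_eq_mu mu_nonneg)
qed

lemma mu_add_le:
  assumes "0 \<le> c" "c \<le> 1 / 2" "0 \<le> b" "0 \<le> b'"
  shows "mu (b + b') c q \<le> mu b c q + mu b' c q"
proof -
  have "star_mass ((b + b') / q) c \<le> star_mass (b / q) c + star_mass (b' / q) c"
    unfolding add_divide_distrib using assms by (intro star_mass_add_le) auto
  then have "ennreal (mu (b + b') c q) \<le> ennreal (mu b c q + mu b' c q)"
    using assms by (simp add: star_mass_eq_mu mu_nonneg)
  then show ?thesis by (simp add: mu_nonneg del: ennreal_plus)
qed

lemma mu_double_le:
  assumes "0 < c" "c \<le> c'" "c' \<le> 2 * c" "c' \<le> 1 / 2" "0 \<le> b"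
  shows "mu b c' q \<le> mu b c q + 16 * b / q"
proof -
  have "star_mass (b / q) c' \<le> star_mass (b / q) (2 * c)"
    using assms by (intro star_mass_mono) auto
  also have "\<dots> \<le> star_mass (b / q) c + ennreal (16 * (b / q))"
    using assms by (intro star_mass_double_le) auto
  finally have "ennreal (mu b c' q) \<le> ennreal (mu b c q + 16 * (b / q))"
    using assms by (simp add: star_mass_eq_mu mu_nonneg)
  then have "mu b c' q \<le> mu b c q + 16 * (b / q)"
    using assms mu_nonneg[of b c q] by (simp del: ennreal_plus)
  then show ?thesis by simp
qed

lemma mu_le:
  assumes c: "0 \<le> c" "c \<le> 1 / 2" and b: "1 / 4 ^ J \<le> b" and q: "0 < q" "q \<le> 2 ^ (2 ^ J)"
  shows "mu b c q \<le> 20 * b * 2 ^ J / q"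
proof -
  have b0: "0 < b" using b by (rule less_le_trans[rotated]) simp
  have "star_mass (b / q) c \<le> ennreal (4 * (b / q) * (1 + ln (1 + 1 / (b / q))))"
    using b0 q c by (intro star_mass_le) auto
  also have "\<dots> \<le> ennreal (4 * (b / q) * (5 * 2 ^ J))"
  proof (intro ennreal_leI mult_left_mono)
    have "real q \<le> 2 ^ (2 ^ J)" using of_nat_mono[OF q(2), where 'a = real] by simp
    then have "1 + real q / b \<le> 1 + 2 ^ (2 ^ J) / b" using b0 by (simp add: divide_right_mono)
    then have "ln (1 + real q / b) \<le> ln (1 + 2 ^ (2 ^ J) / b)"
      using b0 by (intro ln_mono) (auto intro: add_pos_nonneg)
    then show "1 + ln (1 + 1 / (b / q)) \<le> 5 * 2 ^ J"
      using log_ratio_le[OF order.refl b] by simp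
  qed (use b0 in auto)
  finally have "ennreal (mu b c q) \<le> ennreal (4 * (b / q) * (5 * 2 ^ J))"
    using c by (simp add: star_mass_eq_mu)
  then show ?thesis using b0 by (simp add: field_simps)
qed

definition counted :: "real \<Rightarrow> nat set"
  where "counted T = {q. 1 \<le> q \<and> real q < T}"

lemma finite_counted [simp]: "finite (counted T)"
proof (rule finite_subset)
  show "counted T \<subseteq> {..nat \<lceil>T\<rceil>}"
    by (auto simp: counted_def) linarith
qed simp

text \<open>The bound m + 1 < 2^J leaves room for rounding T up to 2^(m+1), and i \<le> J for
  rounding c down to 2^-(i+1); both rounded values are then covered by
  \<open>good_point\<close>.\<close>

locale dyadic_scale =
  fixes J l i m :: nat and T b c :: real
  assumes J: "1 \<le> J" and l: "l \<le> 2 * J" and i: "1 \<le> i" "i \<le> J" and m: "m + 1 < 2 ^ J"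
    and T: "2 ^ m \<le> T" "T < 2 ^ (m + 1)"
    and b: "1 / 4 ^ J \<le> b" "b \<le> (1 / 2) ^ l" "(1 / 2) ^ l < 2 * b"
    and c: "(1 / 2) ^ (i + 1) < c" "c \<le> (1 / 2) ^ i"
begin

text \<open>The common scale of random deviation and discretisation error, mesh times L^2 with L =
  2^J.\<close>

definition E :: real where "E = step J l * 4 ^ J"

lemma c_bounds: "0 < c" "c \<le> 1 / 2"
proof -
  have "0 < (1 / 2 :: real) ^ (i + 1)" by simp
  then show "0 < c" using c by linarith
  show "c \<le> 1 / 2" using c i power_decreasing[of 1 i "1 / 2 :: real"] by simp
qed

lemma b_pos: "0 < b" using b(1) by (rule less_le_trans[rotated]) simp

text \<open>Cubing clears the exponents 2/3 and 4/3, so that E can be compared with other quantities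
  through integer powers.\<close>

lemma E_cube: "E ^ 3 = ((1 / 2) ^ l)\<^sup>2 * (2 ^ J) ^ 4"
proof -
  have "E ^ 3 * 4 ^ l = (step J l ^ 3 * 4 ^ J * 4 ^ l) * (4 ^ J) ^ 2"
    by (simp add: E_def power_mult_distrib eval_nat_numeral)
  also have "\<dots> = (4 ^ J)\<^sup>2" by (simp only: step_cube mult_1)
  also have "(4::real) ^ J = (2 ^ J)\<^sup>2" by (simp add: power_mult[symmetric] power_even_eq[symmetric] power2_eq_square power_mult_distrib[symmetric])
  finally have "E ^ 3 * 4 ^ l = (2 ^ J) ^ 4" by (simp add: power_mult[symmetric])
  moreover have "((1 / 2 :: real) ^ l)\<^sup>2 * 4 ^ l = 1"
    by (simp add: power2_eq_square power_mult_distrib[symmetric])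
  ultimately have "E ^ 3 * 4 ^ l = (((1 / 2) ^ l)\<^sup>2 * (2 ^ J) ^ 4) * 4 ^ l"
    by (simp add: algebra_simps)
  then show ?thesis by simp
qed

lemma E_pos: "0 < E" using step_pos by (simp add: E_def)

text \<open>Since b is of size 2^-l \<le> 2^J, the cube of b L is at most b^2 L^4. This absorbs the
  errors of size b L from rounding c and T.\<close>

lemma E_ge: "(1 / 2) ^ l * 2 ^ J \<le> E"
proof -
  have "((1 / 2 :: real) ^ l * 2 ^ J) ^ 3 = ((1 / 2) ^ l)\<^sup>2 * (2 ^ J) ^ 3 * (1 / 2) ^ l"
    by (simp add: power_mult_distrib eval_nat_numeral)
  also have "\<dots> \<le> ((1 / 2) ^ l)\<^sup>2 * (2 ^ J) ^ 3 * 2 ^ J"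
    by (intro mult_left_mono) (auto intro: order_trans[OF power_le_one one_le_power])
  also have "\<dots> = E ^ 3" unfolding E_cube by (simp add: eval_nat_numeral)
  finally show ?thesis using E_pos by (simp add: power_mono_iff)
qed

text \<open>Here l \<le> 2 J, that is b at least of order L^-2, is decisive. The bound absorbs the
  constant lost between the volume and the sum of the \<open>mu\<close>.\<close>

lemma E_ge_1: "1 \<le> E"
proof -
  have "(1 / 2 :: real) ^ (2 * J) \<le> (1 / 2) ^ l" using l by (intro power_decreasing) auto
  then have "(1 / 2 :: real) ^ (2 * J) * (2 ^ J)\<^sup>2 \<le> (1 / 2) ^ l * (2 ^ J)\<^sup>2"
    by (intro mult_right_mono) auto
  also have "(1 / 2 :: real) ^ (2 * J) * (2 ^ J)\<^sup>2 = 1"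
    by (simp add: power_mult[symmetric] mult.commute power_mult_distrib[symmetric])
  finally have "1\<^sup>2 \<le> ((1 / 2 :: real) ^ l * (2 ^ J)\<^sup>2)\<^sup>2" by (intro power_mono) auto
  then have "1 ^ 3 \<le> E ^ 3" unfolding E_cube by (simp add: power_mult_distrib power_mult[symmetric] mult.commute)
  then show ?thesis using E_pos power_mono_iff[of 1 E 3] by simp
qed

lemma m_le: "real m + 2 \<le> 2 * 2 ^ J"
proof -
  have "real (m + 2) \<le> real (2 ^ J + 2 ^ J)" using m by (intro of_nat_mono) simp
  then show ?thesis by simp
qed

lemma sum_inverse_le: "(\<Sum>q=1..<2 ^ (m + 1). 1 / real q) \<le> 2 * 2 ^ J"
proof -
  have "(\<Sum>q=1..<2 ^ (m + 1). 1 / real q) \<le> (\<Sum>q=1..2 ^ (m + 1). 1 / real q)"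
    by (intro sum_mono2) auto
  also have "\<dots> \<le> real (m + 1) + 1" by (rule sum_inverse_le_dyadic)
  finally show ?thesis using m_le by simp
qed

lemma q_le: "q < 2 ^ (m + 1) \<Longrightarrow> q \<le> (2::nat) ^ (2 ^ J)"
  using power_increasing[of "m + 1" "2 ^ J" "2::nat"] m by simp

text \<open>The price of moving b by one grid step: one factor 2^J is the logarithm in the area, the
  other the harmonic sum over q.\<close>

lemma sum_mu_step_le:
  assumes "A \<subseteq> {1..<2 ^ (m + 1)}"
  shows "(\<Sum>q\<in>A. mu (step J l) c q) \<le> 40 * E"
proof -
  have "(\<Sum>q\<in>A. mu (step J l) c q) \<le> (\<Sum>q=1..<2 ^ (m + 1). mu (step J l) c q)"
    using assms by (intro sum_mono2) (auto simp: mu_nonneg)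
  also have "\<dots> \<le> (\<Sum>q=1..<2 ^ (m + 1). 20 * step J l * 2 ^ J * (1 / real q))"
  proof (rule sum_mono)
    fix q :: nat assume "q \<in> {1..<2 ^ (m + 1)}"
    then have "mu (step J l) c q \<le> 20 * step J l * 2 ^ J / q"
      using c_bounds by (intro mu_le step_ge l q_le) auto
    then show "mu (step J l) c q \<le> 20 * step J l * 2 ^ J * (1 / real q)" by simp
  qed
  also have "\<dots> \<le> 20 * step J l * 2 ^ J * (2 * 2 ^ J)"
    unfolding sum_distrib_left[symmetric] using step_pos[of J l, THEN less_imp_le]
    by (intro mult_left_mono sum_inverse_le) auto
  also have "\<dots> = 40 * (step J l * (2 ^ J * 2 ^ J))" by simp
  also have "(2::real) ^ J * 2 ^ J = 4 ^ J" by (simp add: power_mult_distrib[symmetric])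
  finally show ?thesis by (simp add: E_def)
qed

text \<open>The price of rounding c. The allowance 4 b covers the grid value above x, which is below
  x + h < 3 b.\<close>

lemma sum_inverse_b_le:
  assumes "A \<subseteq> {1..<2 ^ (m + 1)}" and x: "0 \<le> x" "x \<le> 4 * b"
  shows "(\<Sum>q\<in>A. 16 * x / real q) \<le> 128 * E"
proof -
  have "(\<Sum>q\<in>A. 16 * x / real q) \<le> (\<Sum>q=1..<2 ^ (m + 1). 16 * x / real q)"
    using assms by (intro sum_mono2) auto
  also have "\<dots> = 16 * x * (\<Sum>q=1..<2 ^ (m + 1). 1 / real q)"
    by (simp add: sum_distrib_left)
  also have "\<dots> \<le> 16 * (4 * b) * (2 * 2 ^ J)"
    using x by (intro mult_mono sum_inverse_le) (auto intro: sum_nonneg)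
  also have "\<dots> = 128 * (b * 2 ^ J)" by simp
  also have "\<dots> \<le> 128 * ((1 / 2) ^ l * 2 ^ J)"
    using b by (intro mult_left_mono mult_right_mono) auto
  also have "\<dots> \<le> 128 * E" using E_ge by simp
  finally show ?thesis .
qed

text \<open>The price of rounding T: the expected number of hits in one dyadic block is O(b L),
  because its 2^m members each contribute O(b L / 2^m).\<close>

lemma sum_mu_block_le:
  assumes A: "A \<subseteq> {2 ^ m..<2 ^ (m + 1)}" and x: "x \<le> b"
  shows "(\<Sum>q\<in>A. mu x c q) \<le> 20 * E"
proof -
  have "(\<Sum>q\<in>A. mu x c q) \<le> (\<Sum>q=2 ^ m..<2 ^ (m + 1). mu x c q)"
    using A by (intro sum_mono2) (auto simp: mu_nonneg)
  also have "\<dots> \<le> (\<Sum>q=2 ^ m..<2 ^ (m + 1)::nat. 20 * b * 2 ^ J / 2 ^ m)"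
  proof (rule sum_mono)
    fix q :: nat assume q: "q \<in> {2 ^ m..<2 ^ (m + 1)}"
    have qm: "2 ^ m \<le> real q" using q by (intro dyadic_block_ge) simp
    then have q0: "0 < real q" by (rule less_le_trans[rotated]) simp
    have "mu x c q \<le> mu b c q" using c_bounds x by (intro mu_mono) auto
    also have "\<dots> \<le> 20 * b * 2 ^ J / q"
      using c_bounds b(1) q q0 by (intro mu_le q_le) auto
    also have "\<dots> \<le> 20 * b * 2 ^ J / 2 ^ m"
      using qm q0 b_pos by (intro divide_left_mono) auto
    finally show "mu x c q \<le> 20 * b * 2 ^ J / 2 ^ m" .
  qed
  also have "\<dots> = 20 * (b * 2 ^ J)" by simp
  also have "\<dots> \<le> 20 * ((1 / 2) ^ l * 2 ^ J)"
    using b by (intro mult_left_mono mult_right_mono) auto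
  also have "\<dots> \<le> 20 * E" using E_ge by simp
  finally show ?thesis .
qed

lemma counted_bounds: "{1..<2 ^ m} \<subseteq> counted T" "counted T \<subseteq> {1..<2 ^ (m + 1)}"
proof -
  have "real q < 2 ^ m" if "q < 2 ^ m" for q
    using of_nat_less_iff[of q "2 ^ m", where 'a = real] that by simp
  from less_le_trans[OF this T(1)] show "{1..<2 ^ m} \<subseteq> counted T" by (auto simp: counted_def)
  have "q < 2 ^ (m + 1)" if "real q < 2 ^ (m + 1)" for q
    using of_nat_less_iff[of q "2 ^ (m + 1)", where 'a = real] that by simp
  then show "counted T \<subseteq> {1..<2 ^ (m + 1)}" using T(2) by (force simp: counted_def)
qed

lemma dev_counted_le:
  assumes good: "good_point Z z" and Z: "0 \<le> Z" and x: "0 < x" "x \<le> b"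
  shows "\<bar>dev x c (counted T) z\<bar> \<le> (Z * real J ^ 3 + 188) * E"
proof -
  define h where "h = step J l"
  define k where "k = nat \<lceil>x / h\<rceil>"
  have h: "0 < h" by (simp add: h_def step_pos)
  have hl: "h \<le> (1 / 2) ^ l" unfolding h_def by (rule step_le[OF l])
  have "0 < \<lceil>x / h\<rceil>" using x h by simp
  then have k1: "1 \<le> k" and rk: "real k = of_int \<lceil>x / h\<rceil>" unfolding k_def by linarith+
  have "x / h \<le> real k" "real k < x / h + 1" unfolding rk by linarith+
  then have kx: "x \<le> real k * h" "real k * h < x + h" using h by (auto simp: field_simps)
  have "x / h \<le> (1 / 2) ^ l / step J l" using x b h unfolding h_def by (intro divide_right_mono) auto
  then have kg: "k \<le> grid_size J l" unfolding k_def grid_size_def h_def by (intro nat_mono ceiling_mono)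
  have E: "h * 4 ^ J = E" by (simp add: E_def h_def)
  have gp: "\<bar>dev (real k * h) ((1 / 2) ^ i) {1..<2 ^ n} z\<bar> \<le> Z * real J ^ 3 * E"
    if "i \<in> {1..J + 1}" "k \<in> {1..grid_size J l}" "n < 2 ^ J" for i k n
    using good J l that unfolding good_point_def h_def E_def by blast
  have dev_split: "dev y d A z = (\<Sum>q\<in>A. is_hit y d z q) - (\<Sum>q\<in>A. mu y d q)" for y d A
    by (simp add: dev_def sum_subtractf)
  have i2: "(1 / 2 :: real) ^ i \<le> 1 / 2" "(1 / 2 :: real) ^ (i + 1) \<le> 1 / 2"
    using i power_decreasing[of 1 i "1 / 2 :: real"] power_decreasing[of 1 "i + 1" "1 / 2 :: real"] by auto
  let ?N = "{1..<2 ^ (m + 1) :: nat}" and ?N' = "{1..<2 ^ m :: nat}"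
  note cb = counted_bounds
  have up: "dev x c (counted T) z \<le> (Z * real J ^ 3 + 188) * E"
  proof -
    have "(\<Sum>q\<in>counted T. is_hit x c z q) \<le> (\<Sum>q\<in>?N. is_hit (real k * h) ((1 / 2) ^ i) z q)"
      using cb kx c by (intro order_trans[OF sum_mono sum_mono2]) (auto intro: is_hit_mono simp: is_hit_nonneg)
    also have "\<dots> = dev (real k * h) ((1 / 2) ^ i) ?N z + (\<Sum>q\<in>?N. mu (real k * h) ((1 / 2) ^ i) q)"
      by (simp add: dev_split)
    also have "dev (real k * h) ((1 / 2) ^ i) ?N z \<le> Z * real J ^ 3 * E"
      using gp[of i k "m + 1"] i k1 kg m by auto
    also have "(\<Sum>q\<in>?N. mu (real k * h) ((1 / 2) ^ i) q) \<le> (\<Sum>q\<in>?N. mu x c q + mu h c q + 16 * (real k * h) / q)"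
    proof (rule sum_mono)
      fix q
      have "mu (real k * h) ((1 / 2) ^ i) q \<le> mu (real k * h) c q + 16 * (real k * h) / q"
        using c c_bounds i2 h by (intro mu_double_le) auto
      also have "mu (real k * h) c q \<le> mu (x + h) c q"
        using c_bounds kx by (intro mu_mono) auto
      also have "mu (x + h) c q \<le> mu x c q + mu h c q"
        using c_bounds x h by (intro mu_add_le) auto
      finally show "mu (real k * h) ((1 / 2) ^ i) q \<le> mu x c q + mu h c q + 16 * (real k * h) / q" by simp
    qed
    also have "\<dots> = (\<Sum>q\<in>?N. mu x c q) + (\<Sum>q\<in>?N. mu h c q) + (\<Sum>q\<in>?N. 16 * (real k * h) / q)"
      by (simp add: sum.distrib)
    also have "(\<Sum>q\<in>?N. mu h c q) \<le> 40 * E"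
      unfolding h_def by (rule sum_mu_step_le) simp
    also have "(\<Sum>q\<in>?N. 16 * (real k * h) / q) \<le> 128 * E"
      using h kx x hl b by (intro sum_inverse_b_le) auto
    also have "(\<Sum>q\<in>?N. mu x c q) = (\<Sum>q\<in>counted T. mu x c q) + (\<Sum>q\<in>?N - counted T. mu x c q)"
      using cb by (intro sum.subset_diff[THEN trans] add.commute) auto
    also have "(\<Sum>q\<in>?N - counted T. mu x c q) \<le> 20 * E"
      using cb x by (intro sum_mu_block_le) (auto simp: subset_iff not_less)
    finally show ?thesis
      by (simp add: dev_split algebra_simps)
  qed
  have low: "- dev x c (counted T) z \<le> (Z * real J ^ 3 + 188) * E"
  \<comment> \<open>For k = 1 rounding x down would give 0, which is not a grid value; but then x
    \<le> h and the whole expected count is already O(E).\<close>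
  proof (cases "k = 1")
    case True
    then have xh: "x \<le> h" using kx by simp
    have "- dev x c (counted T) z \<le> (\<Sum>q\<in>counted T. mu x c q)"
      by (simp add: dev_split sum_nonneg is_hit_nonneg)
    also have "\<dots> \<le> (\<Sum>q\<in>counted T. mu h c q)"
      using xh c_bounds by (intro sum_mono mu_mono) auto
    also have "\<dots> \<le> 40 * E" unfolding h_def by (rule sum_mu_step_le[OF cb(2)])
    also have "\<dots> \<le> (Z * real J ^ 3 + 188) * E" using Z E_pos by (intro mult_right_mono) auto
    finally show ?thesis .
  next
    case False
    define k' where "k' = k - 1"
    have k': "k' \<in> {1..grid_size J l}" using False k1 kg by (auto simp: k'_def)
    have kk: "real k = real k' + 1" using k1 by (simp add: k'_def)
    have kx': "real k' * h \<le> x" "x \<le> real k' * h + h" using kx by (auto simp: kk algebra_simps)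
    let ?d = "(1 / 2 :: real) ^ (i + 1)"
    have "(\<Sum>q\<in>counted T. mu x c q) = (\<Sum>q\<in>?N'. mu x c q) + (\<Sum>q\<in>counted T - ?N'. mu x c q)"
      using cb by (intro sum.subset_diff[THEN trans] add.commute) auto
    also have "(\<Sum>q\<in>counted T - ?N'. mu x c q) \<le> 20 * E"
      using cb x by (intro sum_mu_block_le) (auto simp: subset_iff not_less)
    also have "(\<Sum>q\<in>?N'. mu x c q) \<le> (\<Sum>q\<in>?N'. mu (real k' * h) ?d q + 16 * (real k' * h) / q + mu h c q)"
    proof (rule sum_mono)
      fix q
      have "mu x c q \<le> mu (real k' * h + h) c q"
        using c_bounds kx' by (intro mu_mono) auto
      also have "\<dots> \<le> mu (real k' * h) c q + mu h c q"
        using c_bounds h by (intro mu_add_le) auto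
      also have "mu (real k' * h) c q \<le> mu (real k' * h) ?d q + 16 * (real k' * h) / q"
        using c c_bounds h by (intro mu_double_le) auto
      finally show "mu x c q \<le> mu (real k' * h) ?d q + 16 * (real k' * h) / q + mu h c q" by simp
    qed
    also have "\<dots> = (\<Sum>q\<in>?N'. mu (real k' * h) ?d q) + (\<Sum>q\<in>?N'. 16 * (real k' * h) / q) + (\<Sum>q\<in>?N'. mu h c q)"
      by (simp add: sum.distrib)
    also have "(\<Sum>q\<in>?N'. mu h c q) \<le> 40 * E"
      unfolding h_def using cb by (intro sum_mu_step_le) auto
    also have "(\<Sum>q\<in>?N'. 16 * (real k' * h) / q) \<le> 128 * E"
      using h kx' x cb b_pos by (intro sum_inverse_b_le) auto
    also have "(\<Sum>q\<in>?N'. mu (real k' * h) ?d q) = (\<Sum>q\<in>?N'. is_hit (real k' * h) ?d z q) - dev (real k' * h) ?d ?N' z"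
      by (simp add: dev_split)
    also have "(\<Sum>q\<in>?N'. is_hit (real k' * h) ?d z q) \<le> (\<Sum>q\<in>counted T. is_hit x c z q)"
      using cb kx' c by (intro order_trans[OF sum_mono sum_mono2]) (auto intro: is_hit_mono simp: is_hit_nonneg)
    finally have *: "(\<Sum>q\<in>counted T. mu x c q) \<le> (\<Sum>q\<in>counted T. is_hit x c z q) - dev (real k' * h) ?d ?N' z + 128 * E + 40 * E + 20 * E"
      by simp
    have "- dev (real k' * h) ?d ?N' z \<le> Z * real J ^ 3 * E"
      using gp[of "i + 1" k' m] i k' m by auto
    with * show ?thesis by (simp add: dev_split algebra_simps)
  qed
  show ?thesis using up low by linarith
qed

end

section \<open>Volumes and the counting theorem\<close>

lemma emeasure_star_reg: "emeasure lborel (star_reg \<delta> c) = star_mass \<delta> c"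
proof -
  have "emeasure (lborel \<Otimes>\<^sub>M lborel) (star_reg \<delta> c) = (\<integral>\<^sup>+t. emeasure lborel (Pair t -` star_reg \<delta> c) \<partial>lborel)"
    using sets_star_reg by (intro lborel.emeasure_pair_measure_alt) (simp only: lborel_prod sets_lborel)
  also have "\<dots> = (\<integral>\<^sup>+t. \<integral>\<^sup>+s. indicator (Pair t -` star_reg \<delta> c) s \<partial>lborel \<partial>lborel)"
  proof (intro nn_integral_cong nn_integral_indicator[symmetric])
    fix t
    have "star_reg \<delta> c \<in> sets (lborel \<Otimes>\<^sub>M lborel)"
      using sets_star_reg by (simp only: lborel_prod sets_lborel)
    then show "Pair t -` star_reg \<delta> c \<in> sets lborel" by (rule sets_Pair1)
  qed
  also have "\<dots> = star_mass \<delta> c"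
    unfolding star_mass_def star_ind_def by (intro nn_integral_cong) (auto simp: indicator_def)
  finally show ?thesis by (simp add: lborel_prod)
qed

text \<open>Without the lower bound a the volume is monotone in b, and the original region is the
  difference of two such sets.\<close>

definition Omega_le :: "real \<Rightarrow> real \<Rightarrow> real \<Rightarrow> ((real \<times> real) \<times> real) set"
  where "Omega_le T b c = {p. 1 \<le> snd p \<and> snd p < T \<and> max \<bar>fst (fst p)\<bar> \<bar>snd (fst p)\<bar> \<le> c \<and>
     \<bar>fst (fst p) * snd (fst p)\<bar> * snd p \<le> b}"

lemma sets_Omega_le [measurable]: "Omega_le T b c \<in> sets borel"
proof -
  have "{p \<in> space ((borel \<Otimes>\<^sub>M borel) \<Otimes>\<^sub>M borel). 1 \<le> snd p \<and> snd p < T \<and> max \<bar>fst (fst p)\<bar> \<bar>snd (fst p)\<bar> \<le> c \<and>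
     \<bar>fst (fst p) * snd (fst p)\<bar> * snd p \<le> b} \<in> sets ((borel \<Otimes>\<^sub>M borel) \<Otimes>\<^sub>M (borel :: real measure))"
    by measurable
  then show ?thesis unfolding borel_prod by (simp add: Omega_le_def)
qed

lemma emeasure_Omega_le:
  "emeasure lborel (Omega_le T b c) = (\<integral>\<^sup>+y. star_mass (b / y) c * indicator {1..<T} y \<partial>lborel)"
proof -
  have "emeasure (lborel \<Otimes>\<^sub>M lborel) (Omega_le T b c) = (\<integral>\<^sup>+y. emeasure lborel ((\<lambda>x. (x, y)) -` Omega_le T b c) \<partial>lborel)"
    by (intro lborel_pair.emeasure_pair_measure_alt2) (simp only: lborel_prod sets_lborel sets_Omega_le)
  also have "\<dots> = (\<integral>\<^sup>+y. star_mass (b / y) c * indicator {1..<T} y \<partial>lborel)"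
  proof (intro nn_integral_cong)
    fix y :: real
    show "emeasure lborel ((\<lambda>x. (x, y)) -` Omega_le T b c) = star_mass (b / y) c * indicator {1..<T} y"
    proof (cases "y \<in> {1..<T}")
      case True
      then have "(\<lambda>x. (x, y)) -` Omega_le T b c = star_reg (b / y) c"
        by (auto simp: Omega_le_def star_reg_def field_simps)
      then show ?thesis using True by (simp add: emeasure_star_reg)
    next
      case False
      then have "(\<lambda>x. (x, y)) -` Omega_le T b c = {}" by (auto simp: Omega_le_def)
      then show ?thesis using False by simp
    qed
  qed
  finally show ?thesis by (simp add: lborel_prod)
qed

lemma sum_unit_intervals:
  assumes "1 \<le> n"
  shows "(\<Sum>q=1..<n. indicator {real q..<real q + 1} y) = (indicator {1..<real n} y :: ennreal)"
  using assms
proof (induction n rule: dec_induct)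
  case (step n)
  then show ?case by (auto simp: indicator_def)
qed simp

lemma star_mass_measurable [measurable]:
  assumes [measurable]: "f \<in> borel_measurable M"
  shows "(\<lambda>y. star_mass (f y) c) \<in> borel_measurable M"
  unfolding star_mass_def star_ind_def star_reg_def indicator_def mem_Collect_eq case_prod_conv by measurable

text \<open>The area at height y decreases in y, so sum and integral differ by at most the first
  term, which is at most 1.\<close>

lemma measure_Omega_le_approx:
  assumes T: "1 < T" and b: "0 \<le> b" and c: "0 \<le> c" "c \<le> 1 / 2"
  shows "emeasure lborel (Omega_le T b c) = ennreal (measure lborel (Omega_le T b c))"
    "measure lborel (Omega_le T b c) \<le> (\<Sum>q\<in>counted T. mu b c q)"
    "(\<Sum>q\<in>counted T. mu b c q) \<le> measure lborel (Omega_le T b c) + 1"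
proof -
  let ?V = "emeasure lborel (Omega_le T b c)"
  \<comment> \<open>The largest integer strictly below T; an integral T itself is not
    counted.\<close>
  define n where "n = nat (\<lceil>T\<rceil> - 1)"
  have "1 < \<lceil>T\<rceil>" using T by (simp add: less_ceiling_iff)
  then have n1: "1 \<le> n" and rn: "real n = of_int \<lceil>T\<rceil> - 1" unfolding n_def by linarith+
  have nT: "real n < T" "T \<le> real n + 1" unfolding rn by linarith+
  have cnt: "counted T = {1..n}"
  proof (intro set_eqI)
    fix q
    have "real q < T \<longleftrightarrow> q \<le> n"
    proof
      assume "real q < T"
      then have "real q < real (n + 1)" using nT by simp
      then show "q \<le> n" unfolding of_nat_less_iff by simp
    next
      assume "q \<le> n"
      then have "real q \<le> real n" by simp
      then show "real q < T" using nT by simp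
    qed
    then show "q \<in> counted T \<longleftrightarrow> q \<in> {1..n}" by (auto simp: counted_def)
  qed
  let ?F = "\<lambda>q y. star_mass (b / y) c * indicator {real q..<real q + 1} y"
  have split: "(\<Sum>q=1..<k. \<integral>\<^sup>+y. ?F q y \<partial>lborel) = (\<integral>\<^sup>+y. star_mass (b / y) c * indicator {1..<real k} y \<partial>lborel)"
    if "1 \<le> k" for k
    by (subst nn_integral_sum[symmetric]) (measurable, simp only: sum_distrib_left[symmetric] sum_unit_intervals[OF that])
  have up: "?V \<le> (\<Sum>q=1..n. star_mass (b / q) c)"
  proof -
    have "?V \<le> (\<integral>\<^sup>+y. star_mass (b / y) c * indicator {1..<real (n + 1)} y \<partial>lborel)"
      unfolding emeasure_Omega_le using nT by (intro nn_integral_mono mult_left_mono) (auto simp: indicator_def)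
    also have "\<dots> = (\<Sum>q=1..<n + 1. \<integral>\<^sup>+y. ?F q y \<partial>lborel)" by (intro split[symmetric]) simp
    also have "\<dots> \<le> (\<Sum>q=1..<n + 1. star_mass (b / q) c)"
    proof (rule sum_mono)
      fix q assume q: "q \<in> {1..<n + 1}"
      have "(\<integral>\<^sup>+y. ?F q y \<partial>lborel) \<le> (\<integral>\<^sup>+y. star_mass (b / q) c * indicator {real q..<real q + 1} y \<partial>lborel)"
        using b q by (intro nn_integral_mono) (auto simp: indicator_def intro!: star_mass_mono divide_left_mono)
      also have "\<dots> = star_mass (b / q) c" by (simp add: nn_integral_cmult)
      finally show "(\<integral>\<^sup>+y. ?F q y \<partial>lborel) \<le> star_mass (b / q) c" .
    qed
    also have "{1..<n + 1} = {1..n}" by auto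
    finally show ?thesis .
  qed
  have low: "(\<Sum>q=1..n. star_mass (b / q) c) \<le> ?V + 1"
  proof -
    have "(\<Sum>q=1..n. star_mass (b / q) c) = star_mass (b / real 1) c + (\<Sum>q=1 + 1..<n + 1. star_mass (b / q) c)"
      using n1 by (subst sum.atLeast_Suc_atMost) (auto simp: atLeastLessThanSuc_atLeastAtMost)
    also have "(\<Sum>q=1 + 1..<n + 1. star_mass (b / q) c) = (\<Sum>q=1..<n. star_mass (b / real (q + 1)) c)"
      by (rule sum.shift_bounds_nat_ivl)
    also have "\<dots> \<le> (\<Sum>q=1..<n. \<integral>\<^sup>+y. ?F q y \<partial>lborel)"
    proof (rule sum_mono)
      fix q assume q: "q \<in> {1..<n}"
      have "star_mass (b / real (q + 1)) c = (\<integral>\<^sup>+y. star_mass (b / real (q + 1)) c * indicator {real q..<real q + 1} y \<partial>lborel)"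
        by (simp add: nn_integral_cmult)
      also have "\<dots> \<le> (\<integral>\<^sup>+y. ?F q y \<partial>lborel)"
        using b q by (intro nn_integral_mono) (auto simp: indicator_def intro!: star_mass_mono divide_left_mono)
      finally show "star_mass (b / real (q + 1)) c \<le> (\<integral>\<^sup>+y. ?F q y \<partial>lborel)" .
    qed
    also have "\<dots> = (\<integral>\<^sup>+y. star_mass (b / y) c * indicator {1..<real n} y \<partial>lborel)" by (rule split[OF n1])
    also have "\<dots> \<le> ?V"
      unfolding emeasure_Omega_le using nT by (intro nn_integral_mono mult_left_mono) (auto simp: indicator_def)
    also have "star_mass (b / real 1) c + ?V \<le> ?V + 1"
      using star_mass_le_1[OF c, of b] by (simp add: add.commute add_left_mono)
    finally show ?thesis by (simp add: add_left_mono)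
  qed
  have eq: "(\<Sum>q=1..n. star_mass (b / q) c) = ennreal (\<Sum>q\<in>counted T. mu b c q)"
    unfolding cnt star_mass_eq_mu[OF c] by (simp add: sum_ennreal mu_nonneg)
  have "?V \<noteq> \<infinity>" using up unfolding eq by (auto simp: top_unique)
  then show V: "?V = ennreal (measure lborel (Omega_le T b c))"
    by (intro emeasure_eq_ennreal_measure) auto
  have s0: "0 \<le> (\<Sum>q\<in>counted T. mu b c q)" by (intro sum_nonneg mu_nonneg)
  show "measure lborel (Omega_le T b c) \<le> (\<Sum>q\<in>counted T. mu b c q)"
    using up s0 unfolding eq V by simp
  have "ennreal (\<Sum>q\<in>counted T. mu b c q) \<le> ennreal (measure lborel (Omega_le T b c) + 1)"
    using low unfolding eq V by simp
  then show "(\<Sum>q\<in>counted T. mu b c q) \<le> measure lborel (Omega_le T b c) + 1"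
    by (simp del: ennreal_plus)
qed

lemma measure_Omega_set:
  assumes T: "1 < T" and ab: "0 \<le> a" "a \<le> b" and c: "0 \<le> c" "c \<le> 1 / 2"
  shows "measure lebesgue (Omega_set T a b c) = measure lborel (Omega_le T b c) - measure lborel (Omega_le T a c)"
proof -
  have eq: "Omega_set T a b c = Omega_le T b c - Omega_le T a c"
    by (auto simp: Omega_set_def Omega_le_def)
  have "measure lebesgue (Omega_set T a b c) = measure lborel (Omega_le T b c - Omega_le T a c)"
    unfolding eq by (intro measure_completion sets.Diff) simp_all
  also have "\<dots> = measure lborel (Omega_le T b c) - measure lborel (Omega_le T a c)"
  proof (rule measure_Diff)
    show "emeasure lborel (Omega_le T b c) \<noteq> \<infinity>"
      using measure_Omega_le_approx(1)[OF T _ c, of b] ab by (metis ennreal_neq_top infinity_ennreal_def order_trans)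
    show "Omega_le T a c \<subseteq> Omega_le T b c" using ab by (auto simp: Omega_le_def)
  qed simp_all
  finally show ?thesis .
qed

lemma card_Q_set:
  assumes "a \<le> b"
  shows "real (card (Q_set T a b c z)) = (\<Sum>q\<in>counted T. is_hit b c z q) - (\<Sum>q\<in>counted T. is_hit a c z q)"
proof -
  have sub: "Q_set T a b c z \<subseteq> counted T" by (auto simp: Q_set_def counted_def)
  have "real (card (Q_set T a b c z)) = (\<Sum>q\<in>counted T. if q \<in> Q_set T a b c z then 1 else 0)"
    using sub by (simp add: sum.If_cases Int_absorb1)
  also have "\<dots> = (\<Sum>q\<in>counted T. is_hit b c z q - is_hit a c z q)"
    using assms by (intro sum.cong) (auto simp: Q_set_def counted_def is_hit_def)
  finally show ?thesis by (simp add: sum_subtractf)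
qed

text \<open>Each volume falls short of its sum of \<open>mu\<close> by an amount in [0, 1]; in the
  difference the two shortfalls cost 1 rather than 2.\<close>

lemma discrepancy_le_dev:
  assumes T: "1 < T" and ab: "0 < a" "a \<le> b" and c: "0 \<le> c" "c \<le> 1 / 2"
  shows "\<bar>real (card (Q_set T a b c z)) - measure lebesgue (Omega_set T a b c)\<bar>
    \<le> \<bar>dev b c (counted T) z\<bar> + \<bar>dev a c (counted T) z\<bar> + 1"
proof -
  have dev: "dev x c (counted T) z = (\<Sum>q\<in>counted T. is_hit x c z q) - (\<Sum>q\<in>counted T. mu x c q)" for x
    by (simp add: dev_def sum_subtractf)
  have "0 \<le> b" "0 \<le> a" using ab by auto
  then show ?thesis
    using dev[of a] dev[of b] measure_Omega_le_approx(2,3)[OF T \<open>0 \<le> b\<close> c] measure_Omega_le_approx(2,3)[OF T \<open>0 \<le> a\<close> c]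
      card_Q_set[OF ab(2), of T c z] measure_Omega_set[OF T \<open>0 \<le> a\<close> ab(2) c] by linarith
qed

section \<open>From the unit square to the plane by periodicity\<close>

lemma is_hit_shift: "is_hit b c (x + of_int i, y + of_int j) q = is_hit b c (x, y) q"
proof -
  have "dist_int (real q * (u + of_int k)) = dist_int (real q * u)" for u k
    using dist_int_add_int[of "real q * u" "int q * k"] by (simp add: algebra_simps)
  then show ?thesis by (simp add: is_hit_def)
qed

lemma good_point_shift: "good_point Z (x + of_int i, y + of_int j) \<longleftrightarrow> good_point Z (x, y)"
  by (simp add: good_point_def dev_def is_hit_shift)

text \<open>Goodness, with the same Z, depends only on the point modulo integer vectors. The bad
  points of the plane therefore lie in countably many translates of the bad points of the unit
  square.\<close>

lemma AE_good_point: "AE z in lebesgue. \<exists>Z\<ge>0. good_point Z z"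
proof -
  let ?P = "\<lambda>z. \<exists>Z\<ge>0. good_point Z z"
  define N where "N = {z \<in> unit_square. \<not> ?P z}"
  have "AE z in lebesgue. z \<in> unit_square \<longrightarrow> ?P z"
    using AE_good_point_unit_square by (rule AE_completion)
  then obtain M where M: "M \<in> null_sets lebesgue" "{z \<in> space lebesgue. \<not> (z \<in> unit_square \<longrightarrow> ?P z)} \<subseteq> M"
    unfolding eventually_ae_filter by blast
  then have "negligible M" by (simp add: negligible_iff_null_sets)
  then have N: "negligible N" by (rule negligible_subset) (use M(2) in \<open>auto simp: N_def\<close>)
  have "{z. \<not> ?P z} \<subseteq> (\<Union>k::int \<times> int. (+) (of_int (fst k), of_int (snd k)) ` N)"
  proof
    fix z assume z: "z \<in> {z. \<not> ?P z}"
    obtain x y where xy: "z = (x, y)" by (cases z)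
    let ?w = "(frac x, frac y)"
    have "z = (frac x + of_int \<lfloor>x\<rfloor>, frac y + of_int \<lfloor>y\<rfloor>)" by (simp add: xy frac_def)
    then have "\<not> ?P ?w" using z good_point_shift[of _ "frac x" "\<lfloor>x\<rfloor>" "frac y" "\<lfloor>y\<rfloor>"] by auto
    then have "?w \<in> N" by (auto simp: N_def frac_lt_1)
    then have "(of_int \<lfloor>x\<rfloor>, of_int \<lfloor>y\<rfloor>) + ?w \<in> (+) (of_int \<lfloor>x\<rfloor>, of_int \<lfloor>y\<rfloor>) ` N" by (rule imageI)
    moreover have "(of_int \<lfloor>x\<rfloor>, of_int \<lfloor>y\<rfloor>) + ?w = z" by (simp add: xy frac_def)
    ultimately have "z \<in> (+) (of_int (fst (\<lfloor>x\<rfloor>, \<lfloor>y\<rfloor>)), of_int (snd (\<lfloor>x\<rfloor>, \<lfloor>y\<rfloor>))) ` N"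
      by (simp only: fst_conv snd_conv)
    then show "z \<in> (\<Union>k::int \<times> int. (+) (of_int (fst k), of_int (snd k)) ` N)" by blast
  qed
  moreover have "negligible (\<Union>k::int \<times> int. (+) (of_int (fst k), of_int (snd k)) ` N)"
    using N by (intro negligible_countable_Union) (auto intro: negligible_translation)
  ultimately have "negligible {z. \<not> ?P z}" by (rule negligible_subset[rotated])
  then show ?thesis
    by (intro AE_I'[of "{z. \<not> ?P z}"]) (auto simp: negligible_iff_null_sets)
qed

section \<open>From real parameters to dyadic scales\<close>

lemma ex_dyadic_bracket:
  fixes x :: real
  assumes "1 \<le> x"
  obtains n where "2 ^ n \<le> x" "x < 2 ^ (n + 1)"
proof -
  define n where "n = (LEAST n. x < 2 ^ (n + 1))"
  obtain k where "x < 2 ^ k" using real_arch_pow[of 2 x] by auto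
  then have "x < 2 ^ (k + 1)" by (rule less_le_trans) simp
  then have n: "x < 2 ^ (n + 1)" unfolding n_def by (rule LeastI)
  have "2 ^ n \<le> x"
  proof (cases n)
    case (Suc k)
    then have "\<not> x < 2 ^ (k + 1)" unfolding n_def using not_less_Least[of k "\<lambda>n. x < 2 ^ (n + 1)"] by simp
    then show ?thesis using Suc by simp
  qed (use assms in simp)
  then show thesis using n that by blast
qed

text \<open>\<open>cT\<close> gives 1 / c \<le> ln T < 2^J and \<open>bT\<close> gives 1 / b \<le>
  4^J, which is what keeps the dyadic indices i and l of c and b within the ranges controlled by
  \<open>good_point\<close>.\<close>

lemma discrepancy_le:
  assumes good: "good_point Z z" and Z: "0 \<le> Z" and \<epsilon>: "0 < \<epsilon>"
    and T: "1 < T" and ab: "0 < a" "a < b" "b < 1" and c: "0 < c" "c < 1 / 2"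
    and cT: "1 \<le> c * ln T" and bT: "1 / (ln T)\<^sup>2 \<le> b"
  shows "\<bar>real (card (Q_set T a b c z)) - measure lebesgue (Omega_set T a b c)\<bar>
    \<le> (432 * Z + 377) * 12 * 2 powr (6 + \<epsilon>) * (b powr (2 / 3) * ln T powr (4 / 3) * ln (ln T) powr (6 + \<epsilon>))"
proof -
  \<comment> \<open>Since c < 1/2, the assumption \<open>cT\<close> forces ln T > 2. So ln ln T is
    bounded below and additive constants can be absorbed into its multiples.\<close>
  have "2 * 1 \<le> 2 * (c * ln T)" using cT by simp
  also have "\<dots> < 1 * ln T" using c T by (simp add: mult.assoc[symmetric])
  finally have lnT: "2 < ln T" by simp
  define u where "u = ln (ln T)"
  have "ln 2 \<le> u" unfolding u_def using lnT by (intro ln_mono) auto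
  then have lam: "2 / 3 \<le> u" using ln2_ge_two_thirds by linarith
  obtain m where m: "2 ^ m \<le> T" "T < 2 ^ (m + 1)" using ex_dyadic_bracket[of T] T by auto
  obtain j where j: "2 ^ j \<le> real m + 1" "real m + 1 < 2 ^ (j + 1)" using ex_dyadic_bracket[of "real m + 1"] by auto
  obtain l where l: "2 ^ l \<le> 1 / b" "1 / b < 2 ^ (l + 1)" using ex_dyadic_bracket[of "1 / b"] ab by auto
  obtain i where i: "2 ^ i \<le> 1 / c" "1 / c < 2 ^ (i + 1)" using ex_dyadic_bracket[of "1 / c"] c by auto
  \<comment> \<open>The shift makes m + 1 < 2^J strict while 2^J \<le> 2 (m + 1) stays within 4 ln
    T.\<close>
  define J where "J = j + 1"
  have b0: "0 < b" using ab by simp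
  have "ln T \<le> ln (2 ^ (m + 1))" using m T by (intro ln_mono) auto
  also have "\<dots> = real (m + 1) * ln 2" by (rule ln_realpow)
  also have "\<dots> \<le> real (m + 1) * 1" by (rule mult_left_mono[OF less_imp_le[OF ln_2_less_1] of_nat_0_le_iff])
  finally have lnT_le: "ln T < 2 ^ J" using j unfolding J_def by simp
  have "real m * ln 2 = ln (2 ^ m)" by (rule ln_realpow[symmetric])
  also have "\<dots> \<le> ln T" using m by (intro ln_mono) auto
  finally have mle: "real m * ln 2 \<le> ln T" .
  have "real m * (2 / 3) \<le> real m * ln 2" using ln2_ge_two_thirds by (intro mult_left_mono) auto
  then have "real m + 1 \<le> 2 * ln T" using mle lnT by linarith
  then have L: "2 ^ J \<le> 4 * ln T" using j unfolding J_def by simp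
  have l2: "l \<le> 2 * J"
  proof -
    have "1 / b \<le> (ln T)\<^sup>2" using bT b0 lnT by (simp add: field_simps)
    also have "\<dots> \<le> (2 ^ J)\<^sup>2" using lnT lnT_le by (intro power_mono) auto
    also have "(2 ^ J)\<^sup>2 = (2::real) ^ (2 * J)" by (simp add: power_mult[symmetric] mult.commute)
    finally have "(2::real) ^ l \<le> 2 ^ (2 * J)" by (rule order_trans[OF l(1)])
    then show ?thesis by simp
  qed
  have i2: "1 \<le> i" "i \<le> J"
  proof -
    have "2 ^ 1 < 1 / c" using c by (simp add: field_simps)
    also have "\<dots> < 2 ^ (i + 1)" by (rule i)
    finally show "1 \<le> i" by (cases i) auto
    have "1 / c \<le> ln T" using cT c by (simp add: field_simps)
    then have "(2::real) ^ i < 2 ^ J" using i lnT_le by linarith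
    then show "i \<le> J" by simp
  qed
  interpret dyadic_scale J l i m T b c
  proof
    show "1 \<le> J" by (simp add: J_def)
    have "real (m + 1) < real (2 ^ J)" using j by (simp add: J_def)
    then show "m + 1 < 2 ^ J" unfolding of_nat_less_iff .
    show "1 / 4 ^ J \<le> b"
    proof -
      have "1 / (4::real) ^ J = 1 / (2 ^ J)\<^sup>2" by (simp add: power2_eq_square power_mult_distrib[symmetric])
      also have "\<dots> \<le> 1 / (ln T)\<^sup>2" using lnT lnT_le by (intro divide_left_mono power_mono) auto
      finally show ?thesis using bT by simp
    qed
    show "b \<le> (1 / 2) ^ l" "(1 / 2) ^ l < 2 * b" "(1 / 2) ^ (i + 1) < c" "c \<le> (1 / 2) ^ i"
      using l i b0 c by (simp_all add: power_one_over field_simps)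
  qed (use l2 i2 m in auto)
  define X where "X = b powr (2 / 3) * ln T powr (4 / 3)"
  \<comment> \<open>Doubling u makes the base at least 4/3, so its powers increase with the exponent
    and the cube coming from J^3 fits below w.\<close>
  define w where "w = (2 * u) powr (6 + \<epsilon>)"
  have X0: "0 < X" using b0 lnT by (simp add: X_def)
  have X3: "X ^ 3 = b\<^sup>2 * ln T ^ 4"
  proof -
    have "(b powr (2 / 3)) ^ 3 = b\<^sup>2"
      using b0 by (subst powr_power) auto
    moreover have "(ln T powr (4 / 3)) ^ 3 = ln T ^ 4"
      using lnT by (subst powr_power) auto
    ultimately show ?thesis by (simp add: X_def power_mult_distrib)
  qed
  \<comment> \<open>4 times 4^4 is 1024, which is below 12^3 = 1728.\<close>
  have EX: "E \<le> 12 * X"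
  proof -
    have "E ^ 3 \<le> (2 * b)\<^sup>2 * (4 * ln T) ^ 4"
      unfolding E_cube using b L lnT by (intro mult_mono power_mono) auto
    also have "\<dots> = 1024 * X ^ 3" by (simp add: X3 power_mult_distrib)
    also have "\<dots> \<le> (12 * X) ^ 3" using X0 by (simp add: power_mult_distrib)
    finally have "E ^ 3 \<le> (12 * X) ^ 3" .
    then show ?thesis using X0 E_pos by (intro iffD1[OF power_mono_iff[of E "12 * X" 3]]) auto
  qed
  \<comment> \<open>2 ln 2 < 2 \<le> 3 u, so (2/3) J \<le> 4 u.\<close>
  have JL: "real J \<le> 6 * u"
  proof -
    have "real J * ln 2 = ln (2 ^ J)" by (rule ln_realpow[symmetric])
    also have "\<dots> \<le> ln (4 * ln T)" using L lnT by (intro ln_mono) auto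
    also have "\<dots> = 2 * ln 2 + u"
      using lnT ln_realpow[of 2 2] by (simp add: ln_mult u_def)
    finally have "real J * ln 2 \<le> 2 * ln 2 + u" .
    moreover have "real J * (2 / 3) \<le> real J * ln 2" using ln2_ge_two_thirds by (intro mult_left_mono) auto
    ultimately show ?thesis using ln_2_less_1 lam by linarith
  qed
  have w1: "1 \<le> w" unfolding w_def using lam \<epsilon> by (intro ge_one_powr_ge_zero) auto
  have lw: "u ^ 3 \<le> w"
  proof -
    have "u ^ 3 \<le> (2 * u) ^ 3" using lam by (intro power_mono) auto
    also have "\<dots> = (2 * u) powr 3" using lam by simp
    also have "\<dots> \<le> w" unfolding w_def using lam \<epsilon> by (intro powr_mono) auto
    finally show ?thesis .
  qed
  have "real J ^ 3 \<le> (6 * u) ^ 3" using JL by (intro power_mono) auto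
  also have "\<dots> \<le> 216 * w" using lw by (simp add: power_mult_distrib)
  finally have "Z * real J ^ 3 \<le> Z * (216 * w)" using Z by (intro mult_left_mono)
  \<comment> \<open>432 is 2 times 216, where 216 = 6^3 comes from J \<le> 6 u, and 377 is 2 times
    188 plus 1.\<close>
  then have fac: "2 * (Z * real J ^ 3 + 188) + 1 \<le> (432 * Z + 377) * w"
    using w1 by (simp add: algebra_simps)
  have "\<bar>real (card (Q_set T a b c z)) - measure lebesgue (Omega_set T a b c)\<bar>
    \<le> \<bar>dev b c (counted T) z\<bar> + \<bar>dev a c (counted T) z\<bar> + 1"
    using assms by (intro discrepancy_le_dev) auto
  also have "\<dots> \<le> (Z * real J ^ 3 + 188) * E + (Z * real J ^ 3 + 188) * E + E"
    using ab E_ge_1 by (intro add_mono dev_counted_le good Z) auto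
  also have "\<dots> = (2 * (Z * real J ^ 3 + 188) + 1) * E" by (simp add: algebra_simps)
  also have "\<dots> \<le> ((432 * Z + 377) * w) * (12 * X)"
    using fac EX E_pos Z w1 by (intro mult_mono) auto
  also have "w = 2 powr (6 + \<epsilon>) * u powr (6 + \<epsilon>)"
    unfolding w_def by (rule powr_mult)
  finally show ?thesis unfolding X_def u_def by (simp only: mult_ac)
qed

text \<open>As b < 1, a negative power of v below b forces v \<ge> 1, and then a smaller exponent p
  only strengthens the lower bound on b. With v = c ln T both ranges of the theorem are covered, by
  p = \<eta> and by p = \<eta> / (3 - \<eta>).\<close>

lemma one_le_of_powr_neg_le:
  fixes v b p :: real
  assumes v: "0 < v" and b: "b < 1" and p: "0 < p" "p \<le> 2" and vb: "v powr (- p) \<le> b"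
  shows "1 \<le> v" "1 / v\<^sup>2 \<le> b"
proof -
  show v1: "1 \<le> v"
  proof (rule ccontr)
    assume "\<not> 1 \<le> v"
    then have "1 powr p \<ge> v powr p" using v p by (intro powr_mono2) auto
    then have "1 \<le> v powr (- p)" using v by (simp add: powr_minus one_le_inverse_iff)
    then show False using vb b by simp
  qed
  have "1 / v\<^sup>2 = v powr (- 2)" using v by (simp add: powr_minus inverse_eq_divide)
  also have "\<dots> \<le> v powr (- p)" using v1 p by (intro powr_mono) auto
  finally show "1 / v\<^sup>2 \<le> b" using vb by simp
qed

text \<open>The exponents of b differ by p = (3 - \<eta>) / (3 \<eta>), chosen by the range
  condition: it turns b^p into at most (c L)^(-1/3). This supplies the missing L^(-1/3), and
  c^(-1/3) \<le> 1 / c.\<close>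

lemma main_term_le_case1:
  fixes b c L \<eta> :: real
  assumes b: "0 < b" and c: "0 < c" "c < 1" and L: "0 < L" and \<eta>: "1 < \<eta>" "\<eta> < 2"
    and h: "b \<le> (c * L) powr (- \<eta> / (3 - \<eta>))"
  shows "b powr (2 / 3) * L powr (4 / 3) \<le> inverse c * b powr (1 - 1 / \<eta>) * L"
proof -
  define p where "p = 1 / \<eta> - 1 / 3"
  have p: "0 < p" using \<eta> by (simp add: p_def field_simps)
  have "b powr p \<le> ((c * L) powr (- \<eta> / (3 - \<eta>))) powr p"
    using b h p by (intro powr_mono2) auto
  also have "\<dots> = (c * L) powr (- (1 / 3))"
    unfolding powr_powr using \<eta> by (intro arg_cong[of _ _ "\<lambda>t. (c * L) powr t"]) (simp add: p_def field_simps)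
  also have "\<dots> = c powr (- (1 / 3)) * L powr (- (1 / 3))" by (rule powr_mult)
  also have "\<dots> \<le> c powr (- 1) * L powr (- (1 / 3))"
    using c by (intro mult_right_mono powr_mono') auto
  finally have bp: "b powr p \<le> inverse c * L powr (- (1 / 3))" using c by (simp add: powr_minus)
  have "b powr (2 / 3) * L powr (4 / 3) = b powr (1 - 1 / \<eta>) * b powr p * L powr (4 / 3)"
    unfolding powr_add[symmetric] by (simp add: p_def)
  also have "\<dots> \<le> b powr (1 - 1 / \<eta>) * (inverse c * L powr (- (1 / 3))) * L powr (4 / 3)"
    by (intro mult_right_mono mult_left_mono bp) auto
  also have "\<dots> = inverse c * b powr (1 - 1 / \<eta>) * (L powr (- (1 / 3)) * L powr (4 / 3))" by simp
  also have "L powr (- (1 / 3)) * L powr (4 / 3) = L"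
    unfolding powr_add[symmetric] using L by simp
  finally show ?thesis .
qed

text \<open>Now p = 2 (3 - \<eta>) / (3 \<eta>), so the range condition gives b^p \<ge> (c L)^(-2/3)
  \<ge> L^(-2/3), the last step by c < 1.\<close>

lemma main_term_le_case2:
  fixes b c L \<eta> :: real
  assumes b: "0 < b" and c: "0 < c" "c < 1" and L: "0 < L" and \<eta>: "1 < \<eta>" "\<eta> < 2"
    and h: "(c * L) powr (- \<eta> / (3 - \<eta>)) \<le> b"
  shows "b powr (2 / 3) * L powr (4 / 3) \<le> b powr (2 / \<eta>) * L\<^sup>2"
proof -
  define p where "p = 2 / \<eta> - 2 / 3"
  have p: "0 < p" using \<eta> by (simp add: p_def field_simps)
  have "L powr (- (2 / 3)) \<le> (c * L) powr (- (2 / 3))"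
    using c L by (intro powr_mono2') auto
  also have "\<dots> = ((c * L) powr (- \<eta> / (3 - \<eta>))) powr p"
    unfolding powr_powr using \<eta> by (intro arg_cong[of _ _ "\<lambda>t. (c * L) powr t"]) (simp add: p_def field_simps)
  also have "\<dots> \<le> b powr p" using h p by (intro powr_mono2) auto
  finally have bp: "L powr (- (2 / 3)) \<le> b powr p" .
  have "b powr (2 / 3) * L powr (4 / 3) = b powr (2 / 3) * L powr (- (2 / 3)) * L powr 2"
    unfolding mult.assoc powr_add[symmetric] by simp
  also have "\<dots> \<le> b powr (2 / 3) * b powr p * L powr 2"
    by (intro mult_right_mono mult_left_mono bp) auto
  also have "b powr (2 / 3) * b powr p = b powr (2 / \<eta>)"
    unfolding powr_add[symmetric] by (simp add: p_def)
  finally show ?thesis using L by simp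
qed

theorem theorem1p2:
  fixes \<zeta> \<theta> \<eta> \<epsilon> :: real
  assumes "\<zeta> > 0" and "\<theta> > 0" and "1 < \<eta>" and "\<eta> < 2" and "\<epsilon> > 0"
  shows "AE x in (lebesgue :: (real \<times> real) measure).
    \<exists>C>0. \<forall>T a b c :: real.
      1 < T \<longrightarrow> 0 < a \<longrightarrow> 0 < b \<longrightarrow> 0 < c \<longrightarrow> a < b \<longrightarrow> b < 1 \<longrightarrow> c < 1 / 2 \<longrightarrow>
      a \<ge> ln T powr (- \<theta>) \<longrightarrow> \<zeta> * b \<le> c\<^sup>2 \<longrightarrow>
      ((c * ln T) powr (- \<eta>) \<le> b \<and> b \<le> (c * ln T) powr (- \<eta> / (3 - \<eta>)) \<longrightarrow>
        \<bar>real (card (Q_set T a b c x)) - measure lebesgue (Omega_set T a b c)\<bar>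
          \<le> C * (inverse c * b powr (1 - 1 / \<eta>) * ln (ln T) powr (6 + \<epsilon>) * ln T + 1)) \<and>
      (b \<ge> (c * ln T) powr (- \<eta> / (3 - \<eta>)) \<longrightarrow>
        \<bar>real (card (Q_set T a b c x)) - measure lebesgue (Omega_set T a b c)\<bar>
          \<le> C * (b powr (2 / \<eta>) * ln (ln T) powr (6 + \<epsilon>) * (ln T)\<^sup>2 + 1))"
  using AE_good_point
proof (rule AE_mp, intro AE_I2 impI)
  fix x :: "real \<times> real"
  assume "\<exists>Z\<ge>0. good_point Z x"
  then obtain Z where Z: "0 \<le> Z" "good_point Z x" by blast
  define C where "C = (432 * Z + 377) * 12 * 2 powr (6 + \<epsilon>)"
  have C: "0 < C" unfolding C_def using Z(1) by (intro mult_pos_pos) auto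
  \<comment> \<open>Both ranges at once: p is the exponent in the lower bound for b, and R stands
    for the claimed main term without its power of ln ln T.\<close>
  have *: "\<bar>real (card (Q_set T a b c x)) - measure lebesgue (Omega_set T a b c)\<bar> \<le> C * (R * ln (ln T) powr (6 + \<epsilon>) + 1)"
    if h: "1 < T" "0 < a" "a < b" "b < 1" "0 < c" "c < 1 / 2"
      and p: "0 < p" "p \<le> 2" "(c * ln T) powr (- p) \<le> b"
      and R: "b powr (2 / 3) * ln T powr (4 / 3) \<le> R" for T a b c p R
  proof -
    have v: "0 < c * ln T" using h by simp
    note vv = one_le_of_powr_neg_le[OF v h(4) p]
    have "(c * ln T)\<^sup>2 \<le> (ln T)\<^sup>2"
      using h v by (intro power_mono mult_left_le_one_le) auto
    then have "1 / (ln T)\<^sup>2 \<le> 1 / (c * ln T)\<^sup>2"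
      using v h by (intro divide_left_mono) auto
    then have "1 / (ln T)\<^sup>2 \<le> b" using vv(2) by linarith
    then have "\<bar>real (card (Q_set T a b c x)) - measure lebesgue (Omega_set T a b c)\<bar>
       \<le> C * (b powr (2 / 3) * ln T powr (4 / 3) * ln (ln T) powr (6 + \<epsilon>))"
      unfolding C_def using h vv(1) assms(5) by (intro discrepancy_le Z)
    also have "\<dots> \<le> C * (R * ln (ln T) powr (6 + \<epsilon>) + 1)"
      using C R mult_right_mono[OF R, of "ln (ln T) powr (6 + \<epsilon>)"] by (intro mult_left_mono) auto
    finally show ?thesis .
  qed
  \<comment> \<open>The inequality \<eta> / (3 - \<eta>) \<le> 2 is equivalent to \<eta> \<le> 2; it
    makes the second range admissible in the previous step.\<close>
  have \<eta>: "0 < \<eta> / (3 - \<eta>)" "\<eta> / (3 - \<eta>) \<le> 2" using assms by (auto simp: field_simps)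
  show "\<exists>C>0. \<forall>T a b c :: real.
      1 < T \<longrightarrow> 0 < a \<longrightarrow> 0 < b \<longrightarrow> 0 < c \<longrightarrow> a < b \<longrightarrow> b < 1 \<longrightarrow> c < 1 / 2 \<longrightarrow>
      a \<ge> ln T powr (- \<theta>) \<longrightarrow> \<zeta> * b \<le> c\<^sup>2 \<longrightarrow>
      ((c * ln T) powr (- \<eta>) \<le> b \<and> b \<le> (c * ln T) powr (- \<eta> / (3 - \<eta>)) \<longrightarrow>
        \<bar>real (card (Q_set T a b c x)) - measure lebesgue (Omega_set T a b c)\<bar>
          \<le> C * (inverse c * b powr (1 - 1 / \<eta>) * ln (ln T) powr (6 + \<epsilon>) * ln T + 1)) \<and>
      (b \<ge> (c * ln T) powr (- \<eta> / (3 - \<eta>)) \<longrightarrow>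
        \<bar>real (card (Q_set T a b c x)) - measure lebesgue (Omega_set T a b c)\<bar>
          \<le> C * (b powr (2 / \<eta>) * ln (ln T) powr (6 + \<epsilon>) * (ln T)\<^sup>2 + 1))"
  proof (intro exI[of _ C] conjI C allI impI)
    fix T a b c :: real
    assume h: "1 < T" "0 < a" "0 < b" "0 < c" "a < b" "b < 1" "c < 1 / 2"
    assume i: "(c * ln T) powr (- \<eta>) \<le> b \<and> b \<le> (c * ln T) powr (- \<eta> / (3 - \<eta>))"
    have "b powr (2 / 3) * ln T powr (4 / 3) \<le> inverse c * b powr (1 - 1 / \<eta>) * ln T"
      using h i assms by (intro main_term_le_case1) auto
    then have "\<bar>real (card (Q_set T a b c x)) - measure lebesgue (Omega_set T a b c)\<bar>
      \<le> C * (inverse c * b powr (1 - 1 / \<eta>) * ln T * ln (ln T) powr (6 + \<epsilon>) + 1)"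
      using h i assms by (intro *[of T a b c \<eta>]) auto
    then show "\<bar>real (card (Q_set T a b c x)) - measure lebesgue (Omega_set T a b c)\<bar>
      \<le> C * (inverse c * b powr (1 - 1 / \<eta>) * ln (ln T) powr (6 + \<epsilon>) * ln T + 1)"
      by (simp only: mult_ac)
  next
    fix T a b c :: real
    assume h: "1 < T" "0 < a" "0 < b" "0 < c" "a < b" "b < 1" "c < 1 / 2"
    assume ii: "(c * ln T) powr (- \<eta> / (3 - \<eta>)) \<le> b"
    have "b powr (2 / 3) * ln T powr (4 / 3) \<le> b powr (2 / \<eta>) * (ln T)\<^sup>2"
      using h ii assms by (intro main_term_le_case2) auto
    then have "\<bar>real (card (Q_set T a b c x)) - measure lebesgue (Omega_set T a b c)\<bar>
      \<le> C * (b powr (2 / \<eta>) * (ln T)\<^sup>2 * ln (ln T) powr (6 + \<epsilon>) + 1)"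
      using h ii \<eta> by (intro *[of T a b c "\<eta> / (3 - \<eta>)"]) auto
    then show "\<bar>real (card (Q_set T a b c x)) - measure lebesgue (Omega_set T a b c)\<bar>
      \<le> C * (b powr (2 / \<eta>) * ln (ln T) powr (6 + \<epsilon>) * (ln T)\<^sup>2 + 1)"
      by (simp only: mult_ac)
  qed
qed

end
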